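(* Let $\mathfrak S$ be a finite subset of $\mathbb Z^2$ with $|j|\le1$ for all $(i,j)\in\mathfrak S$; let $A_j(x)=\sum_{(i,j)\in\mathfrak S}x^i$ for $j\in\{-1,0,1\}$, $\Delta(x;t)=(1-tA_0(x))^2-4t^2A_1(x)A_{-1}(x)$, let $(\Delta_0(t),\Delta_+(x;t),\Delta_-(\bar x;t))$ be the canonical factorization of $\Delta$, and let $$Z(x;t)=\frac{1-tA_0(x)-\sqrt{\Delta(x;t)}}{2t}.$$ For every $j\in\mathbb Z$ the generating function $S_j(x;t)$ of walks on the slit plane with steps in $\mathfrak S$ ending at ordinate $j$ is algebraic; more precisely, for $j\ge0$, $$S_j(x;t)=\frac1{\sqrt{\Delta_+(x;t)}}\Big(\frac{Z(x;t)}{A_{-1}(x)}\Big)^j,\qquad S_{-j}(x;t)=\frac1{\sqrt{\Delta_+(x;t)}}\Big(\frac{Z(x;t)}{A_1(x)}\Big)^j.$$ For every $(i,j)$ the generating function $S_{i,j}(t)$ of walks on the slit plane ending at $(i,j)$ is algebraic; more precisely: if $j=0$, $S_{i,j}(t)$ belongs to the extension of $\mathbb Q(t)$ generated by the coefficients of $\Delta_+(x;t)$ as a polynomial in $x$; if $j>0$, it belongs to the extension of $\mathbb Q(t)$ generated by $\sqrt{\Delta_0(t)}$, the coefficients of $\Delta_+(x;t)$ and $\Delta_-(x;t)$ (as polynomials in $x$), the series $\sqrt{\Delta_+(\alpha_i;t)}$ where the $\alpha_i$ are the roots of $A_{-1}(x)$, and the algebraic numbers $\alpha_i$ themselves; if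 $j<0$ the same holds with $A_{-1}(x)$ replaced by $A_1(x)$.
   Context: $\bar x=1/x$. A walk with steps in $\mathfrak S$ is a sequence $(w_0,\dots,w_n)$ of points of $\mathbb Z^2$ with $w_0=(0,0)$ and $w_k-w_{k-1}\in\mathfrak S$; $n$ is its length. It is on the slit plane if none of $w_1,\dots,w_n$ lies on $\mathcal H=\{(k,0):k\le0\}$. $S_j(x;t)=\sum_nt^n\sum_ia_{i,j}(n)x^i$ and $S_{i,j}(t)=\sum_na_{i,j}(n)t^n$, where $a_{i,j}(n)$ is the number of slit-plane walks of length $n$ ending at $(i,j)$. Canonical factorization: for a power series $D(x;t)$ in $t$ with coefficients in $\mathbb R[x,\bar x]$ and $D(x;0)=1$, there is a unique triple of formal power series in $t$ with $D=D_0(t)D_+(x;t)D_-(\bar x;t)$, where $D_0$ has real coefficients, $D_+$ has coefficients in $\mathbb R[x]$, $D_-$ has coefficients in $\mathbb R[\bar x]$, and $D_0(0)=D_+(x;0)=D_-(\bar x;0)=D_+(0;t)=D_-(0;t)=1$; for polynomial $\Delta$ as here, $\Delta_+$ and $\Delta_-$ are polynomials in $x$ and $\bar x$ respectively with coefficients power series in $t$.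
   Formalization: When A_{-1}=0 (or A_1=0) the quotient Z/A_{-1} (or Z/A_1) is 0/0; there it is read as tA_1/(1-tA_0) (or tA_{-1}/(1-tA_0)), the power series solving the divided quadratic equation, and the zero Laurent polynomial is taken to have no roots. *)

theory Defs
  imports
    "HOL-Computational_Algebra.Computational_Algebra"
    "HOL-Library.Product_Plus"
    Complex_Main
begin

section \<open>Walks on the slit plane\<close>

definition half_line :: "(int \<times> int) set" where
  "half_line = {(k, 0) | k. k \<le> 0}"

text \<open>A walk of length \<open>n\<close> is the list \<open>[w\<^sub>0, \<dots>, w\<^sub>n]\<close> of its \<open>n + 1\<close> points.\<close>

definition slit_walks :: "(int \<times> int) set \<Rightarrow> nat \<Rightarrow> int \<times> int \<Rightarrow> (int \<times> int) list set" where
  "slit_walks S n p = {w. length w = n + 1 \<and> w ! 0 = (0, 0) \<and>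
     (\<forall>k\<in>{1..n}. w ! k - w ! (k - 1) \<in> S) \<and>
     (\<forall>k\<in>{1..n}. w ! k \<notin> half_line) \<and> w ! n = p}"

definition slit_count :: "(int \<times> int) set \<Rightarrow> int \<Rightarrow> int \<Rightarrow> nat \<Rightarrow> nat" where
  "slit_count S i j n = card (slit_walks S n (i, j))"

section \<open>Series in two variables\<close>

text \<open>
  Laurent polynomials in \<open>x\<close> are viewed inside \<open>\<real>((x))\<close>, i.e. type \<^typ>\<open>real fls\<close> with
  \<open>x =\<close> \<^const>\<open>fls_X\<close>. Power series in \<open>t\<close> with such coefficients have type
  \<^typ>\<open>real fls fps\<close> and lie in the field \<open>\<real>((x))((t))\<close>, i.e. \<^typ>\<open>real fls fls\<close>.
  Power series in \<open>t\<close> whose coefficients are polynomials in one variable (\<open>x\<close> or \<open>1/x\<close>)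
  have type \<^typ>\<open>real poly fps\<close>.
\<close>

definition x_var :: "real fls fls" where "x_var = fls_const fls_X"

definition t_var :: "'a::field fls" where "t_var = fls_X"

text \<open>\<open>S\<^sub>j(x;t)\<close>; for finite \<open>S\<close> the inner sum is finite.\<close>

definition slit_gf :: "(int \<times> int) set \<Rightarrow> int \<Rightarrow> real fls fps" where
  "slit_gf S j = Abs_fps (\<lambda>n. \<Sum>i | slit_count S i j n \<noteq> 0.
     of_nat (slit_count S i j n) * fls_X powi i)"

text \<open>\<open>S\<^sub>i\<^sub>,\<^sub>j(t)\<close>, as an element of \<open>\<complex>((t))\<close>.\<close>

definition slit_gf_point :: "(int \<times> int) set \<Rightarrow> int \<Rightarrow> int \<Rightarrow> complex fls" where
  "slit_gf_point S i j = fps_to_fls (Abs_fps (\<lambda>n. of_nat (slit_count S i j n)))"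

text \<open>Apply the coefficient embedding \<open>h\<close> and substitute \<open>a\<close> for the polynomial variable.\<close>

definition subst_var ::
    "('a::comm_semiring_1 \<Rightarrow> 'b::comm_semiring_1) \<Rightarrow> 'b \<Rightarrow> 'a poly fps \<Rightarrow> 'b fps" where
  "subst_var h a D = Abs_fps (\<lambda>n. poly (map_poly h (D $ n)) a)"

definition map_coeffs :: "('a::zero \<Rightarrow> 'b::zero) \<Rightarrow> 'a fps \<Rightarrow> 'b fps" where
  "map_coeffs h D = Abs_fps (\<lambda>n. h (D $ n))"

text \<open>The square root with constant term 1 of a series with constant term 1.\<close>

definition fps_sqrt :: "'a::field fps \<Rightarrow> 'a fps" where
  "fps_sqrt D = fps_radical (\<lambda>_ _. 1) 2 D"

section \<open>Canonical factorization\<close>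

definition is_canonical_factorization ::
    "real fls fps \<Rightarrow> real fps \<times> real poly fps \<times> real poly fps \<Rightarrow> bool" where
  "is_canonical_factorization D = (\<lambda>(D0, Dp, Dm).
     D = map_coeffs fls_const D0 * subst_var fls_const fls_X Dp
           * subst_var fls_const (inverse fls_X) Dm \<and>
     D0 $ 0 = 1 \<and> Dp $ 0 = 1 \<and> Dm $ 0 = 1 \<and>
     subst_var id 0 Dp = 1 \<and> subst_var id 0 Dm = 1)"

definition canonical_factorization ::
    "real fls fps \<Rightarrow> real fps \<times> real poly fps \<times> real poly fps" where
  "canonical_factorization D = (THE F. is_canonical_factorization D F)"

section \<open>The series \<open>\<Delta>\<close> and \<open>Z\<close>\<close>

definition A :: "(int \<times> int) set \<Rightarrow> int \<Rightarrow> 'a::field \<Rightarrow> 'a" where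
  "A S k x = (\<Sum>i | (i, k) \<in> S. x powi i)"

definition Delta :: "(int \<times> int) set \<Rightarrow> real fls fps" where
  "Delta S = (1 - fps_X * fps_const (A S 0 fls_X))\<^sup>2
     - 4 * fps_X\<^sup>2 * fps_const (A S 1 fls_X) * fps_const (A S (-1) fls_X)"

definition Z :: "(int \<times> int) set \<Rightarrow> real fls fls" where
  "Z S = (1 - t_var * A S 0 x_var - fps_to_fls (fps_sqrt (Delta S))) / (2 * t_var)"

text \<open>
  \<open>Z / A\<^sub>k\<close> for \<open>k = \<plusminus>1\<close>. If \<open>A\<^sub>k = 0\<close> then \<open>Z = 0\<close> as well and the quotient has the form
  \<open>0/0\<close>. Since \<open>Z = t A\<^sub>1 A\<^sub>-\<^sub>1 + t A\<^sub>0 Z + t Z\<^sup>2\<close>, the quotient \<open>W = Z / A\<^sub>k\<close> is the power series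
  in \<open>t\<close> determined by \<open>W = t A\<^sub>-\<^sub>k + t A\<^sub>0 W + t A\<^sub>k W\<^sup>2\<close>, which is what is used in that case.
\<close>

definition Z_quot :: "(int \<times> int) set \<Rightarrow> int \<Rightarrow> real fls fls" where
  "Z_quot S k = (if A S k x_var \<noteq> 0 then Z S / A S k x_var
     else t_var * A S (-k) x_var / (1 - t_var * A S 0 x_var))"

text \<open>
  The roots of the Laurent polynomial \<open>A\<^sub>k\<close>. The zero Laurent polynomial is taken to have
  no roots, so that nothing is adjoined on its account.
\<close>

definition A_roots :: "(int \<times> int) set \<Rightarrow> int \<Rightarrow> complex set" where
  "A_roots S k = {\<alpha>. A S k x_var \<noteq> 0 \<and> \<alpha> \<noteq> 0 \<and> A S k \<alpha> = 0}"

section \<open>Field extensions and algebraicity\<close>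

text \<open>
  The subfield generated by \<open>G\<close>. In characteristic 0 it contains \<open>\<rat>\<close>; thus \<open>\<rat>(t)\<close> is
  the case \<open>G = {t}\<close>, and the extension of \<open>\<rat>(t)\<close> generated by \<open>G\<close> is obtained from
  \<open>{t} \<union> G\<close>.
\<close>

inductive_set generated_field :: "'a::field set \<Rightarrow> 'a set" for G where
  one: "1 \<in> generated_field G"
| incl: "a \<in> G \<Longrightarrow> a \<in> generated_field G"
| uminus: "a \<in> generated_field G \<Longrightarrow> - a \<in> generated_field G"
| inverse: "a \<in> generated_field G \<Longrightarrow> inverse a \<in> generated_field G"
| add: "a \<in> generated_field G \<Longrightarrow> b \<in> generated_field G \<Longrightarrow> a + b \<in> generated_field G"
| mult: "a \<in> generated_field G \<Longrightarrow> b \<in> generated_field G \<Longrightarrow> a * b \<in> generated_field G"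

definition algebraic_over :: "'a::field set \<Rightarrow> 'a \<Rightarrow> bool" where
  "algebraic_over K y \<longleftrightarrow> (\<exists>p. (\<forall>i. coeff p i \<in> K) \<and> p \<noteq> 0 \<and> poly p y = 0)"

text \<open>The coefficients, in \<open>\<real>[[t]] \<subseteq> \<complex>((t))\<close>, of \<open>D(x;t)\<close> with respect to \<open>x\<close>.\<close>

definition x_coeffs :: "real poly fps \<Rightarrow> complex fls set" where
  "x_coeffs D = {fps_to_fls (Abs_fps (\<lambda>n. complex_of_real (coeff (D $ n) k))) | k. True}"

definition point_generators ::
    "(int \<times> int) set \<Rightarrow> int \<Rightarrow> real fps \<Rightarrow> real poly fps \<Rightarrow> real poly fps \<Rightarrow> complex fls set" where
  "point_generators S k D0 Dp Dm =
     {fps_to_fls (map_coeffs complex_of_real (fps_sqrt D0))}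
     \<union> x_coeffs Dp \<union> x_coeffs Dm
     \<union> {fps_to_fls (fps_sqrt (subst_var complex_of_real \<alpha> Dp)) | \<alpha>. \<alpha> \<in> A_roots S k}
     \<union> {fls_const \<alpha> | \<alpha>. \<alpha> \<in> A_roots S k}"

end

theory Submission
  imports "HOL-Algebra.Algebraic_Closure_Type" Defs
begin

text \<open>
  Let \<open>H(1/x;t)\<close> enumerate the walks that return to the half-line for the first time at their
  last step. Appending a step to a slit plane walk gives a linear recurrence for the series
  \<open>S\<^sub>j\<close>; away from \<open>j = 0\<close> it is homogeneous and determines the \<open>S\<^sub>j\<close> from \<open>S\<^sub>0\<close>, so
  \<open>S\<^sub>j = S\<^sub>0 W\<^sup>j\<close> with \<open>W = Z/A\<^sub>-\<^sub>1\<close>, and at \<open>j = 0\<close> it becomes \<open>S\<^sub>0 \<surd>\<Delta> = 1 - H\<close>. As \<open>S\<^sub>0\<close> is a series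
  in \<open>x\<close> and \<open>H\<close> one in \<open>1/x\<close>, this is the canonical factorization in disguise:
  \<open>\<Delta>\<^sub>+ = 1/S\<^sub>0\<^sup>2\<close> and \<open>\<Delta>\<^sub>0 \<Delta>\<^sub>- = (1 - H)\<^sup>2\<close>. Both factors have bounded degree, so their coefficients
  are algebraic, being the coefficients of factors of the polynomial \<open>x\<^sup>m \<Delta>\<close> over \<open>\<rat>(t)\<close>.

  For a fixed endpoint with \<open>j > 0\<close> one divides by \<open>A\<^sub>-\<^sub>1\<close> one root \<open>\<alpha>\<close> at a time, starting from
  \<open>2 t A\<^sub>-\<^sub>1 S\<^sub>1 = S\<^sub>0 (1 - t A\<^sub>0) - (1 - H)\<close>. The invariant is that the part of the series with
  nonnegative exponents has its Taylor coefficients at \<open>0\<close> and at every \<open>\<alpha>\<close> in the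
  prescribed field, and the part with negative exponents its coefficients. If \<open>A\<^sub>-\<^sub>1 = 0\<close>, then
  \<open>1 - t A\<^sub>0\<close> splits into a factor in \<open>x\<close> and one in \<open>1/x\<close> which are coprime over the field, and
  partial fractions apply. The case \<open>j < 0\<close> is symmetric.
\<close>

text \<open>The generators named in the theorem are the initial values of two recursions. Expanded
  at a root alpha, \<open>Delta_+ S_0^2 = 1\<close> gives every Taylor coefficient of
  \<open>S_0\<close> once its value there, \<open>1 / sqrt(Delta_+(alpha))\<close>, is known; at
  \<open>x = 0\<close> that value is 1, so \<open>j = 0\<close> requires no square root. Likewise
  \<open>Delta_0 Delta_- = (1 - H)^2\<close> gives \<open>1 - H\<close> from its constant term
  \<open>sqrt(Delta_0)\<close>. The obstacle is that a coefficient in \<open>x\<close> of a product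
  of a series in \<open>x\<close> and a series in \<open>1/x\<close>, both of unbounded degree, is
  an infinite sum, so fields containing the coefficients of both factors need not contain it. Hence
  \<open>S_0 W^j\<close> is not expanded for a fixed endpoint: its series is reached by sums,
  products with Laurent polynomials, and divisions. If \<open>A_k = 0\<close> such products remain,
  and partial fractions reduce them to powers of a single factor. Delta is real while the alpha are
  complex, so the walk series are set up over any field of characteristic 0.\<close>

hide_const (open) up_ring.coeff up_ring.monom Polynomials.degree Polynomials.lead_coeff

section \<open>Subfields as sets, and elements algebraic over them\<close>

definition is_subfield :: "'a::field set \<Rightarrow> bool" where
  "is_subfield K \<longleftrightarrow> 1 \<in> K \<and> (\<forall>a\<in>K. - a \<in> K \<and> inverse a \<in> K) \<and>
     (\<forall>a\<in>K. \<forall>b\<in>K. a + b \<in> K \<and> a * b \<in> K)"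

context
  fixes K :: "'a::field set"
  assumes K: "is_subfield K"
begin

lemma is_subfieldD:
  "1 \<in> K" "0 \<in> K" "a \<in> K \<Longrightarrow> - a \<in> K" "a \<in> K \<Longrightarrow> inverse a \<in> K"
  "a \<in> K \<Longrightarrow> b \<in> K \<Longrightarrow> a + b \<in> K" "a \<in> K \<Longrightarrow> b \<in> K \<Longrightarrow> a - b \<in> K"
  "a \<in> K \<Longrightarrow> b \<in> K \<Longrightarrow> a * b \<in> K" "a \<in> K \<Longrightarrow> b \<in> K \<Longrightarrow> a / b \<in> K"
proof -
  show 1: "1 \<in> K" and 2: "\<And>a. a \<in> K \<Longrightarrow> - a \<in> K" and 3: "\<And>a. a \<in> K \<Longrightarrow> inverse a \<in> K"
    and 4: "\<And>a b. a \<in> K \<Longrightarrow> b \<in> K \<Longrightarrow> a + b \<in> K" and 5: "\<And>a b. a \<in> K \<Longrightarrow> b \<in> K \<Longrightarrow> a * b \<in> K"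
    using K by (auto simp: is_subfield_def)
  show "0 \<in> K" using 4[OF 1 2[OF 1]] by simp
  show "a \<in> K \<Longrightarrow> b \<in> K \<Longrightarrow> a - b \<in> K" using 4[of a "- b"] 2 by simp
  show "a \<in> K \<Longrightarrow> b \<in> K \<Longrightarrow> a / b \<in> K" using 5 3 by (simp add: divide_inverse)
qed

lemma is_subfield_sum: "(\<And>x. x \<in> B \<Longrightarrow> f x \<in> K) \<Longrightarrow> sum f B \<in> K"
  by (induction B rule: infinite_finite_induct) (auto intro: is_subfieldD)

lemma is_subfield_power: "a \<in> K \<Longrightarrow> a ^ n \<in> K"
  by (induction n) (auto intro: is_subfieldD)

lemma is_subfield_powi: "a \<in> K \<Longrightarrow> a powi n \<in> K"
  by (auto simp: power_int_def intro: is_subfieldD is_subfield_power)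

lemma is_subfield_of_nat: "of_nat n \<in> K"
  by (induction n) (auto intro: is_subfieldD)

lemma is_subfield_numeral: "numeral n \<in> K"
  using is_subfield_of_nat[of "numeral n"] by simp

end

lemma is_subfield_generated_field: "is_subfield (generated_field G)"
  by (auto simp: is_subfield_def intro: generated_field.intros)

lemma generated_field_subset:
  assumes "is_subfield K" "G \<subseteq> K" shows "generated_field G \<subseteq> K"
proof
  fix a assume "a \<in> generated_field G"
  then show "a \<in> K"
    by induction (use assms in \<open>auto intro: is_subfieldD\<close>)
qed

lemma generated_field_mono: "G \<subseteq> H \<Longrightarrow> generated_field G \<subseteq> generated_field H"
  by (intro generated_field_subset is_subfield_generated_field) (auto intro: generated_field.incl)

lemma algebraic_over_self: "is_subfield K \<Longrightarrow> y \<in> K \<Longrightarrow> algebraic_over K y"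
  unfolding algebraic_over_def
  by (intro exI[of _ "[:- y, 1:]"]) (auto simp: coeff_pCons is_subfieldD split: nat.splits)

lemma algebraic_over_mono: "K \<subseteq> K' \<Longrightarrow> algebraic_over K y \<Longrightarrow> algebraic_over K' y"
  unfolding algebraic_over_def by blast

text \<open>Bridge to the notion of algebraic elements in HOL-Algebra, whose polynomials are
  coefficient lists with the leading coefficient first.\<close>

context
  fixes R :: "'a::field ring"
  defines R_def: "R \<equiv> ring_of_type_algebra"
begin

interpretation R: field R unfolding R_def by rule

lemma ring_of_type_algebra_sel:
  "carrier R = UNIV" "x \<otimes>\<^bsub>R\<^esub> y = x * y" "x \<oplus>\<^bsub>R\<^esub> y = x + y" "\<one>\<^bsub>R\<^esub> = 1" "\<zero>\<^bsub>R\<^esub> = 0"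
  by (simp_all add: R_def ring_of_type_algebra_def)

lemma ring_of_type_algebra_a_inv: "\<ominus>\<^bsub>R\<^esub> x = - x"
  by (rule R.minus_equality) (simp_all add: ring_of_type_algebra_sel)

lemma ring_of_type_algebra_m_inv: "x \<noteq> 0 \<Longrightarrow> inv\<^bsub>R\<^esub> x = inverse x"
  by (rule R.inv_unique'[symmetric]) (simp_all add: ring_of_type_algebra_sel)

lemma subfield_iff_is_subfield: "subfield K R \<longleftrightarrow> is_subfield K"
proof
  assume *: "is_subfield K"
  show "subfield K R"
    by (rule R.subfieldI'[OF R.subringI])
       (use * in \<open>auto simp: ring_of_type_algebra_sel ring_of_type_algebra_a_inv
          ring_of_type_algebra_m_inv intro: is_subfieldD\<close>)
next
  assume *: "subfield K R"
  note sub = subringE[OF subfieldE(1)[OF *], unfolded ring_of_type_algebra_sel]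
  have "inverse a \<in> K" if "a \<in> K" for a
    using R.subfield_m_inv(1)[OF *, of a] that sub(2)
    by (cases "a = 0") (auto simp: ring_of_type_algebra_sel ring_of_type_algebra_m_inv)
  then show "is_subfield K"
    unfolding is_subfield_def using sub(3,5-7)
    by (auto simp: ring_of_type_algebra_sel ring_of_type_algebra_a_inv)
qed

lemma ring_of_type_algebra_pow: "x [^]\<^bsub>R\<^esub> (n::nat) = x ^ n"
  by (induction n) (simp_all add: ring_of_type_algebra_sel mult.commute)

lemma eval_eq_poly: "R.eval p x = poly (Poly (rev p)) x"
  by (induction p)
     (auto simp: ring_of_type_algebra_sel ring_of_type_algebra_pow Poly_append poly_monom add.commute)

lemma algebraic_iff_algebraic_over:
  fixes K :: "'a set"
  assumes "is_subfield K"
  shows "(R.algebraic over K) x \<longleftrightarrow> algebraic_over K x"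
proof
  assume *: "(R.algebraic over K) x"
  from assms have sr: "subring K R" by (auto simp flip: subfield_iff_is_subfield intro: subfieldE)
  obtain p where p: "p \<in> carrier (K [X]\<^bsub>R\<^esub>)" "p \<noteq> []" "R.eval p x = \<zero>\<^bsub>R\<^esub>"
    using R.algebraicE[OF sr _ *] by (auto simp: ring_of_type_algebra_sel)
  have pp: "set p \<subseteq> K" "hd p \<noteq> 0"
    using p by (auto simp: univ_poly_def polynomial_def ring_of_type_algebra_sel)
  have "Poly (rev p) \<noteq> 0"
  proof
    assume "Poly (rev p) = 0"
    then obtain n where n: "rev p = replicate n 0" by (auto simp: Poly_eq_0)
    then have "hd p \<in> set (replicate n 0)" using p(2) by (metis hd_in_set set_rev)
    then show False using pp by auto
  qed
  moreover have "coeff (Poly (rev p)) i \<in> K" for i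
    using pp(1) is_subfieldD(2)[OF assms] nth_mem[of i "rev p"]
    by (auto simp: nth_default_def)
  ultimately show "algebraic_over K x"
    unfolding algebraic_over_def using p(3)
    by (intro exI[of _ "Poly (rev p)"]) (auto simp: eval_eq_poly ring_of_type_algebra_sel)
next
  assume "algebraic_over K x"
  then obtain p where p: "\<And>i. coeff p i \<in> K" "p \<noteq> 0" "poly p x = 0"
    by (auto simp: algebraic_over_def)
  show "(R.algebraic over K) x"
  proof (rule R.algebraicI)
    show "rev (coeffs p) \<noteq> []" using p by simp
    show "R.eval (rev (coeffs p)) x = \<zero>\<^bsub>R\<^esub>"
      using p by (simp add: eval_eq_poly ring_of_type_algebra_sel)
    show "rev (coeffs p) \<in> carrier (K [X]\<^bsub>R\<^esub>)"
      using p by (auto simp: univ_poly_def polynomial_def ring_of_type_algebra_sel hd_rev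
          last_coeffs_eq_coeff_degree coeffs_def)
  qed
qed

lemma is_subfield_algebraic_over:
  fixes K :: "'a set"
  assumes "is_subfield K"
  shows "is_subfield {y. algebraic_over K y}"
  using R.subfield_of_algebraics[of K] assms
  unfolding subfield_iff_is_subfield algebraic_iff_algebraic_over[OF assms]
  by (simp add: ring_of_type_algebra_sel)

end

lemma generated_field_algebraic_over:
  assumes "is_subfield K" "\<And>g. g \<in> G \<Longrightarrow> algebraic_over K g" "y \<in> generated_field G"
  shows "algebraic_over K y"
  using generated_field_subset[OF is_subfield_algebraic_over[OF assms(1)], of G] assms(2,3) by auto

text \<open>If \<open>p\<close> annihilates \<open>y^2\<close>, then \<open>p\<close> composed with
  \<open>X^2\<close> annihilates \<open>y\<close>, and its coefficients are those of
  \<open>p\<close> interleaved with zeros.\<close>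

lemma algebraic_over_sqrt:
  fixes y :: "'a::field"
  assumes "is_subfield K" "algebraic_over K (y\<^sup>2)"
  shows "algebraic_over K y"
proof -
  obtain p where p: "\<And>i. coeff p i \<in> K" "p \<noteq> 0" "poly p (y\<^sup>2) = 0"
    using assms(2) by (auto simp: algebraic_over_def)
  let ?m = "monom (1::'a) 2"
  have "coeff (pcompose p ?m) i \<in> K" for i
  proof -
    have "coeff (pcompose q ?m) i \<in> K" if "\<And>i. coeff q i \<in> K" for q i
      using that
    proof (induction q arbitrary: i)
      case 0
      then show ?case by (simp add: is_subfieldD[OF assms(1)])
    next
      case (pCons a q)
      have "coeff q i \<in> K" for i using pCons.prems[of "Suc i"] by simp
      moreover have "a \<in> K" using pCons.prems[of 0] by simp
      ultimately show ?case using pCons.IH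
        by (auto simp: pcompose_pCons coeff_monom_mult coeff_pCons split: nat.splits
            intro!: is_subfieldD[OF assms(1)])
    qed
    then show ?thesis using p(1) by blast
  qed
  moreover have "pcompose p ?m \<noteq> 0"
    using p(2) pcompose_eq_0_iff[of ?m p] by (simp add: degree_monom_eq)
  ultimately show ?thesis
    unfolding algebraic_over_def using p(3)
    by (intro exI[of _ "pcompose p ?m"]) (auto simp: poly_pcompose poly_monom)
qed

lemma is_subfield_coeff_mult:
  assumes "is_subfield K" "\<And>i. coeff p i \<in> K" "\<And>i. coeff q i \<in> K"
  shows "coeff (p * q) i \<in> K"
  unfolding coeff_mult by (intro is_subfield_sum is_subfieldD assms)

lemma map_poly_to_ac_mult: "map_poly to_ac (p * q) = map_poly to_ac p * map_poly to_ac q"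
  by (rule poly_eqI) (simp add: coeff_map_poly coeff_mult to_ac_sum)

text \<open>In an algebraic closure \<open>F\<close> is its leading coefficient times a product of
  factors \<open>X - x\<close>, where each \<open>x\<close> is a root of \<open>F * G\<close> and
  hence algebraic. So the monic product has algebraic coefficients, and \<open>coeff F m = 1\<close>
  recovers the leading coefficient from them. The index \<open>m\<close> is free because one
  canonical factor is normalized at its constant term and the reversal of the other at its top
  coefficient.\<close>

lemma algebraic_over_coeff_factor:
  fixes F G :: "'a::field poly"
  assumes K: "is_subfield K" and P: "\<And>i. coeff (F * G) i \<in> K" "F * G \<noteq> 0" and m: "coeff F m = 1"
  shows "algebraic_over K (coeff F k)"
proof -
  \<comment> \<open>The closure is a type of its own: \<open>K\<close> is carried into it along
    \<open>to_ac\<close>, and the annihilating polynomial is carried back along \<open>of_ac\<close>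
    at the end.\<close>
  define K' where "K' = to_ac ` K"
  have K': "is_subfield K'"
    unfolding is_subfield_def K'_def
  proof safe
    fix a b assume "a \<in> K" "b \<in> K"
    then show "to_ac a + to_ac b \<in> to_ac ` K" "to_ac a * to_ac b \<in> to_ac ` K"
      by (metis image_eqI is_subfieldD(5,7)[OF K] to_ac_add to_ac_mult)+
  next
    fix a assume "a \<in> K"
    then show "- to_ac a \<in> to_ac ` K" "inverse (to_ac a) \<in> to_ac ` K"
      by (metis image_eqI is_subfieldD(3,4)[OF K] to_ac_minus to_ac_inverse)+
  next
    show "1 \<in> to_ac ` K" by (metis image_eqI is_subfieldD(1)[OF K] to_ac_1)
  qed
  define B where "B = {y. algebraic_over K' y}"
  have B: "is_subfield B" unfolding B_def by (rule is_subfield_algebraic_over[OF K'])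
  let ?F = "map_poly to_ac F"
  have F0: "?F \<noteq> 0" using m by (auto simp: map_poly_eq_0_iff)
  obtain A where A: "?F = smult (lead_coeff ?F) (\<Prod>x\<in>#A. [:- x, 1:])"
    using alg_closed_imp_factorization[OF F0] by auto
  let ?Q = "\<Prod>x\<in>#A. [:- x, 1:]"
  have "x \<in> B" if "x \<in># A" for x
  proof -
    have "[:- x, 1:] dvd ?Q" using that by (intro dvd_prod_mset) auto
    then have "poly ?Q x = 0" by (simp add: poly_eq_0_iff_dvd)
    then have "poly ?F x = 0" by (subst A) simp
    then have "poly (map_poly to_ac (F * G)) x = 0" by (simp add: map_poly_to_ac_mult)
    moreover have "map_poly to_ac (F * G) \<noteq> 0" using P(2) by (simp add: map_poly_eq_0_iff)
    ultimately show ?thesis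
      unfolding B_def algebraic_over_def using P(1)
      by (intro CollectI exI[of _ "map_poly to_ac (F * G)"]) (auto simp: coeff_map_poly K'_def)
  qed
  then have Q: "coeff ?Q i \<in> B" for i
  proof (induction A arbitrary: i)
    case empty
    then show ?case by (auto simp: is_subfieldD[OF B] coeff_1)
  next
    case (add x A)
    have *: "coeff [:- x, 1:] i \<in> B" for i
      using add.prems[of x]
      by (auto simp: coeff_pCons is_subfieldD[OF B] split: nat.splits)
    show ?case
      using is_subfield_coeff_mult[OF B, OF *] add by auto
  qed
  have c: "to_ac (coeff F i) = lead_coeff ?F * coeff ?Q i" for i
    using arg_cong[OF A, of "\<lambda>p. coeff p i"] by (simp add: coeff_map_poly)
  have 1: "lead_coeff ?F * coeff ?Q m = 1" using c[of m] m by simp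
  then have "lead_coeff ?F = inverse (coeff ?Q m)"
    by (metis inverse_unique mult.commute)
  then have "to_ac (coeff F k) \<in> B"
    unfolding c by (auto intro!: is_subfieldD[OF B] Q)
  then obtain p where p: "\<And>i. coeff p i \<in> K'" "p \<noteq> 0" "poly p (to_ac (coeff F k)) = 0"
    by (auto simp: B_def algebraic_over_def)
  define q where "q = map_poly of_ac p"
  have pq: "p = map_poly to_ac q"
  proof (rule poly_eqI)
    fix i show "coeff p i = coeff (map_poly to_ac q) i"
      using p(1)[of i] by (auto simp: q_def coeff_map_poly K'_def)
  qed
  have "to_ac (poly q x) = poly (map_poly to_ac q) (to_ac x)" for x
    by (induction q) (simp_all add: map_poly_pCons)
  then have "poly q (coeff F k) = 0"
    using p(3) pq by (metis to_ac_eq_0_iff)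
  moreover have "coeff q i \<in> K" for i
    using p(1)[of i] by (auto simp: q_def coeff_map_poly K'_def)
  moreover have "q \<noteq> 0" using p(2) pq by auto
  ultimately show ?thesis unfolding algebraic_over_def by blast
qed

section \<open>Ring homomorphisms, inverses and square roots of power series\<close>

unbundle fps_syntax

text \<open>One predicate for embeddings, substitutions, exchange of variables and Taylor shifts, so
  that identities between series are transported by the same few rules.\<close>

definition is_ring_hom :: "('a::comm_ring_1 \<Rightarrow> 'b::comm_ring_1) \<Rightarrow> bool" where
  "is_ring_hom h \<longleftrightarrow> h 1 = 1 \<and> (\<forall>x y. h (x + y) = h x + h y) \<and> (\<forall>x y. h (x * y) = h x * h y)"

context
  fixes h :: "'a::comm_ring_1 \<Rightarrow> 'b::comm_ring_1"
  assumes h: "is_ring_hom h"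
begin

lemma is_ring_homD:
  "h 1 = 1" "h 0 = 0" "h (x + y) = h x + h y" "h (x * y) = h x * h y"
  "h (- x) = - h x" "h (x - y) = h x - h y"
proof -
  show a: "h (x + y) = h x + h y" for x y using h by (auto simp: is_ring_hom_def)
  show z: "h 0 = 0" using a[of 0 0] by simp
  show m: "h (- x) = - h x" for x using a[of x "- x"] z by (simp add: eq_neg_iff_add_eq_0 add.commute)
  show "h (x - y) = h x - h y" using a[of x "- y"] m[of y] by simp
qed (use h in \<open>auto simp: is_ring_hom_def\<close>)

lemma is_ring_hom_power: "h (x ^ n) = h x ^ n"
  by (induction n) (auto simp: is_ring_homD)

lemma is_ring_hom_sum: "h (sum f B) = (\<Sum>x\<in>B. h (f x))"
  by (induction B rule: infinite_finite_induct) (auto simp: is_ring_homD)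

lemma is_ring_hom_of_nat: "h (of_nat n) = of_nat n"
  by (induction n) (auto simp: is_ring_homD)

lemma is_ring_hom_numeral: "h (numeral n) = numeral n"
  using is_ring_hom_of_nat[of "numeral n"] by simp

lemma is_ring_hom_map_poly: "is_ring_hom (map_poly h)"
  unfolding is_ring_hom_def
  by (auto simp: poly_eq_iff coeff_map_poly is_ring_homD is_ring_hom_sum coeff_mult)

lemma is_ring_hom_map_coeffs: "is_ring_hom (map_coeffs h)"
  unfolding is_ring_hom_def
  by (auto simp: fps_eq_iff map_coeffs_def fps_mult_nth is_ring_homD is_ring_hom_sum)

end

lemma is_ring_hom_comp: "is_ring_hom g \<Longrightarrow> is_ring_hom f \<Longrightarrow> is_ring_hom (\<lambda>x. g (f x))"
  by (simp add: is_ring_hom_def)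

lemma is_ring_hom_poly: "is_ring_hom (\<lambda>p. poly p (a::'a::comm_ring_1))"
  by (simp add: is_ring_hom_def)

lemma is_ring_hom_pcompose: "is_ring_hom (\<lambda>p. pcompose p (q::'a::comm_ring_1 poly))"
  by (simp add: is_ring_hom_def pcompose_add pcompose_mult pcompose_1)

lemma is_ring_hom_of_real: "is_ring_hom complex_of_real"
  by (simp add: is_ring_hom_def)

lemma is_ring_hom_const_poly: "is_ring_hom (\<lambda>c::'a::comm_ring_1. [:c:])"
  by (simp add: is_ring_hom_def)

lemma is_ring_hom_fls_const: "is_ring_hom (fls_const :: 'a::comm_ring_1 \<Rightarrow> _)"
  by (simp add: is_ring_hom_def flip: fls_plus_const)

lemma is_ring_hom_fps_to_fls: "is_ring_hom (fps_to_fls :: 'a::comm_ring_1 fps \<Rightarrow> _)"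
  by (simp add: is_ring_hom_def fls_times_fps_to_fls)

lemma is_ring_hom_fps_const: "is_ring_hom (fps_const :: 'a::comm_ring_1 \<Rightarrow> _)"
  by (simp add: is_ring_hom_def)

lemma map_coeffs_nth [simp]: "map_coeffs h f $ n = h (f $ n)"
  by (simp add: map_coeffs_def)

lemma subst_var_eq_map_coeffs: "subst_var h a = map_coeffs (\<lambda>p. poly (map_poly h p) a)"
  by (rule ext) (simp add: subst_var_def map_coeffs_def)

lemma is_ring_hom_subst_var: "is_ring_hom h \<Longrightarrow> is_ring_hom (subst_var h a)"
  unfolding subst_var_eq_map_coeffs
  by (intro is_ring_hom_map_coeffs is_ring_hom_comp[OF is_ring_hom_poly] is_ring_hom_map_poly)

text \<open>Meant for polynomial coefficients: they form no field, but a constant term 1 is still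
  invertible.\<close>

lemma fps_unit_inverse_exists:
  fixes f :: "'a::comm_ring_1 fps"
  assumes "f $ 0 = 1"
  obtains g where "f * g = 1" "g $ 0 = 1"
proof
  show "f * fps_right_inverse f 1 = 1"
    using fps_right_inverse[of f 1] assms by simp
  show "fps_right_inverse f 1 $ 0 = 1" by simp
qed

lemma fps_sqrt_square:
  fixes f :: "'a::field_char_0 fps"
  assumes "f $ 0 = 1"
  shows "(fps_sqrt f)\<^sup>2 = f" "fps_sqrt f $ 0 = 1"
  using power_radical[of f "\<lambda>_ _. 1" 1] assms by (simp_all add: fps_sqrt_def numeral_2_eq_2)

text \<open>With \<open>s\<close> the chosen root, \<open>(g - s) (g + s) = 0\<close>, and
  \<open>g + s\<close> has constant term 2.\<close>

lemma fps_sqrt_unique: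
  fixes f g :: "'a::field_char_0 fps"
  assumes "g\<^sup>2 = f" "g $ 0 = 1"
  shows "g = fps_sqrt f"
proof -
  have f0: "f $ 0 = 1" using assms by (auto simp: power2_eq_square)
  have "(g - fps_sqrt f) * (g + fps_sqrt f) = 0"
    using assms(1) fps_sqrt_square(1)[OF f0] by (simp add: algebra_simps power2_eq_square)
  moreover have "(g + fps_sqrt f) $ 0 \<noteq> 0" using fps_sqrt_square(2)[OF f0] assms by simp
  then have "g + fps_sqrt f \<noteq> 0" by force
  ultimately show ?thesis by simp
qed

lemma fps_sqrt_hom:
  fixes f :: "'a::field_char_0 fps" and h :: "'a \<Rightarrow> 'b::field_char_0"
  assumes "is_ring_hom h" "f $ 0 = 1"
  shows "map_coeffs h (fps_sqrt f) = fps_sqrt (map_coeffs h f)"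
  using fps_sqrt_square[OF assms(2)] is_ring_hom_power[OF is_ring_hom_map_coeffs[OF assms(1)], of "fps_sqrt f" 2]
    is_ring_homD(1)[OF assms(1)]
  by (intro fps_sqrt_unique) simp_all

text \<open>Here \<open>s\<close> plays the part of \<open>1 / sqrt D\<close> over polynomial
  coefficients, where \<open>fps_sqrt\<close> has no meaning; \<open>g\<close> substitutes a value
  for the variable and lands in series over a field. It serves with \<open>g = right\<close> for the
  closed form and with evaluation at a root.\<close>

lemma hom_sqrt:
  fixes D s :: "'a::comm_ring_1 fps" and g :: "'a fps \<Rightarrow> 'b::field_char_0 fps"
  assumes "is_ring_hom g" "\<And>E. E $ 0 = 1 \<Longrightarrow> g E $ 0 = 1" "D * s\<^sup>2 = 1" "s $ 0 = 1"
  shows "g s * fps_sqrt (g D) = 1"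
proof -
  note r = is_ring_homD[OF assms(1)]
  obtain s' where s': "s * s' = 1" "s' $ 0 = 1" using fps_unit_inverse_exists[OF assms(4)] .
  have "D = D * (s * s')\<^sup>2" by (simp add: s')
  also have "\<dots> = D * s\<^sup>2 * s'\<^sup>2" by (simp only: power_mult_distrib mult_ac)
  finally have "D = s'\<^sup>2" by (simp add: assms(3))
  then have "g s' = fps_sqrt (g D)"
    using s'(2) assms(2) by (intro fps_sqrt_unique) (simp_all add: power2_eq_square r)
  then show ?thesis using s'(1) by (metis r(1,4))
qed

section \<open>Laurent polynomials as sums of a polynomial in \<open>x\<close> and a polynomial in \<open>1/x\<close>\<close>

text \<open>The type \<open>poly fps\<close> does not record whether its variable is
  \<open>x\<close> or \<open>1/x\<close>; \<open>right\<close> reads it as \<open>x\<close>,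
  \<open>left\<close> as \<open>1/x\<close>.\<close>

definition right :: "'a::field poly fps \<Rightarrow> 'a fls fps" where
  "right = subst_var fls_const fls_X"

definition left :: "'a::field poly fps \<Rightarrow> 'a fls fps" where
  "left = subst_var fls_const (inverse fls_X)"

definition pconst :: "'a::comm_ring_1 fps \<Rightarrow> 'a poly fps" where
  "pconst = map_coeffs (\<lambda>c. [:c:])"

definition xpow :: "int \<Rightarrow> 'a::field fls fps" where
  "xpow k = fps_const (fls_X powi k)"

lemma is_ring_hom_right: "is_ring_hom right" and is_ring_hom_left: "is_ring_hom left"
  by (simp_all add: right_def left_def is_ring_hom_subst_var is_ring_hom_fls_const)

lemma is_ring_hom_pconst: "is_ring_hom pconst"
  by (simp add: pconst_def is_ring_hom_map_coeffs is_ring_hom_const_poly)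

lemma fls_X_intpow_mult_nth: "(fls_X_intpow k * f :: 'a::field fls) $$ i = f $$ (i - k)"
  using fls_X_intpow_times_conv_shift(1)[of k f] by simp

lemma xpow_mult_nth: "((xpow k * F) $ n) $$ i = (F $ n) $$ (i - k)"
  by (simp add: xpow_def fls_X_intpow_mult_nth)

lemma xpow_mult_xpow: "xpow k * xpow l = (xpow (k + l) :: 'a::field fls fps)"
  by (simp add: xpow_def fls_X_intpow_times_conv_shift)

lemma xpow_0 [simp]: "xpow 0 = 1"
  by (simp add: xpow_def)

lemma poly_fls_X_nth:
  "poly (map_poly fls_const p) fls_X $$ i = (if i < 0 then 0 else coeff p (nat i))"
  for p :: "'a::field poly"
proof (induction p arbitrary: i)
  case (pCons a p)
  have "(fls_X * f) $$ i = f $$ (i - 1)" for f :: "'a fls"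
    using fls_X_intpow_mult_nth[of 1 f i] by (simp add: fls_X_conv_shift_1)
  moreover have "coeff (pCons a p) (nat i) = coeff p (nat (i - 1))" if "i > 0"
  proof -
    have "nat i = Suc (nat (i - 1))" using that by simp
    then show ?thesis by (metis coeff_pCons_Suc)
  qed
  ultimately show ?case using pCons.IH by (auto simp: map_poly_pCons)
qed auto

lemma poly_fls_X_inverse_nth:
  "poly (map_poly fls_const p) (inverse fls_X) $$ i = (if i > 0 then 0 else coeff p (nat (- i)))"
  for p :: "'a::field poly"
proof (induction p arbitrary: i)
  case (pCons a p)
  have "(inverse fls_X * f) $$ i = f $$ (i + 1)" for f :: "'a fls"
    using fls_X_intpow_mult_nth[of "-1" f i] by (simp add: fls_inverse_X fls_X_inv_conv_shift_1)
  moreover have "coeff (pCons a p) (nat (- i)) = coeff p (nat (- i - 1))" if "i < 0"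
  proof -
    have "nat (- i) = Suc (nat (- i - 1))" using that by simp
    then show ?thesis by (metis coeff_pCons_Suc)
  qed
  ultimately show ?case using pCons.IH
    by (auto simp: map_poly_pCons diff_add_eq simp del: fls_inverse_X)
qed auto

lemma right_nth: "(right D $ n) $$ i = (if i < 0 then 0 else coeff (D $ n) (nat i))"
  by (simp add: right_def subst_var_def poly_fls_X_nth)

lemma left_nth: "(left D $ n) $$ i = (if i > 0 then 0 else coeff (D $ n) (nat (- i)))"
  by (simp add: left_def subst_var_def poly_fls_X_inverse_nth del: fls_inverse_X)

lemma right_pconst: "right (pconst c) = map_coeffs fls_const c"
  and left_pconst: "left (pconst c) = map_coeffs fls_const c"
  by (auto simp: right_def left_def pconst_def subst_var_def fps_eq_iff map_poly_pCons)

lemma right_var: "right (fps_const [:0, 1:]) = xpow 1"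
  and left_var: "left (fps_const [:0, 1:]) = xpow (- 1)"
  by (auto simp: right_def left_def subst_var_def fps_eq_iff map_poly_pCons xpow_def
      fls_X_conv_shift_1 fls_X_inv_conv_shift_1)

lemma right_inject: "right D = right E \<longleftrightarrow> D = E"
proof
  assume *: "right D = right E"
  show "D = E"
  proof (intro fps_ext poly_eqI)
    fix n i
    show "coeff (D $ n) i = coeff (E $ n) i"
      using arg_cong[OF *, of "\<lambda>F. (F $ n) $$ int i"] by (simp add: right_nth)
  qed
qed auto

lemma left_inject: "left D = left E \<longleftrightarrow> D = E"
proof
  assume *: "left D = left E"
  show "D = E"
  proof (intro fps_ext poly_eqI)
    fix n i
    show "coeff (D $ n) i = coeff (E $ n) i"
      using arg_cong[OF *, of "\<lambda>F. (F $ n) $$ (- int i)"] by (simp add: left_nth)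
  qed
qed auto

lemma pconstI:
  assumes "\<And>n i. i > 0 \<Longrightarrow> coeff (D $ n) i = 0"
  shows "D = pconst (Abs_fps (\<lambda>n. coeff (D $ n) 0))"
  using assms by (auto simp: pconst_def fps_eq_iff poly_eq_iff coeff_pCons split: nat.splits)

text \<open>Only the exponent 0 can occur on both sides. This is the formal counterpart of the
  Liouville argument in a Wiener-Hopf factorization; uniqueness of the canonical factors and the
  divisions by \<open>x - a\<close> and by \<open>t\<close> rest on it.\<close>

lemma right_eq_left:
  assumes "right D = left E"
  obtains c where "D = pconst c" "E = pconst c"
proof
  have *: "(if i < 0 then 0 else coeff (D $ n) (nat i)) = (if i > 0 then 0 else coeff (E $ n) (nat (- i)))" for n i
    using arg_cong[OF assms, of "\<lambda>F. (F $ n) $$ i"] by (simp add: right_nth left_nth)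
  have 1: "coeff (D $ n) i = 0" "coeff (E $ n) i = 0" if "i > 0" for n i
    using *[of "int i" n] *[of "- int i" n] that by auto
  have 2: "coeff (D $ n) 0 = coeff (E $ n) 0" for n using *[of 0 n] by simp
  show "D = pconst (Abs_fps (\<lambda>n. coeff (D $ n) 0))" "E = pconst (Abs_fps (\<lambda>n. coeff (D $ n) 0))"
    using pconstI[of D] pconstI[of E] 1 by (auto simp: 2)
qed

section \<open>Coefficients with respect to \<open>x\<close>\<close>

definition xcoef :: "int \<Rightarrow> 'a::field fls fps \<Rightarrow> 'a fls" where
  "xcoef i F = fps_to_fls (Abs_fps (\<lambda>n. (F $ n) $$ i))"

text \<open>\<open>xser\<close> exchanges the variables: the result is a series in \<open>x\<close> over the field of Laurent
  series in \<open>t\<close>.\<close>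

definition xser :: "'a::field poly fps \<Rightarrow> 'a fls fps" where
  "xser D = Abs_fps (\<lambda>k. fps_to_fls (Abs_fps (\<lambda>n. coeff (D $ n) k)))"

lemma xcoef_add: "xcoef i (F + G) = xcoef i F + xcoef i G"
  by (simp add: xcoef_def fls_eq_iff)

lemma xcoef_0: "xcoef i 0 = 0"
  by (simp add: xcoef_def fls_eq_iff)

lemma xcoef_xpow_mult: "xcoef i (xpow k * F) = xcoef (i - k) F"
  by (simp add: xcoef_def xpow_mult_nth)

lemma xcoef_const_mult: "xcoef i (map_coeffs fls_const c * F) = fps_to_fls c * xcoef i F"
proof -
  have *: "(\<Sum>x\<in>B. f x) $$ i = (\<Sum>x\<in>B. f x $$ i)" for B and f :: "nat \<Rightarrow> 'a fls"
    by (induction B rule: infinite_finite_induct) auto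
  have "Abs_fps (\<lambda>n. ((map_coeffs fls_const c * F) $ n) $$ i) = c * Abs_fps (\<lambda>n. (F $ n) $$ i)"
    by (simp add: fps_eq_iff fps_mult_nth *)
  then show ?thesis by (simp add: xcoef_def fls_times_fps_to_fls)
qed

lemma xser_nth: "xser D $ k = fps_to_fls (Abs_fps (\<lambda>n. coeff (D $ n) k))"
  by (simp add: xser_def)

lemma xcoef_right: "xcoef i (right D) = (if i < 0 then 0 else xser D $ nat i)"
  and xcoef_left: "xcoef i (left D) = (if i > 0 then 0 else xser D $ nat (- i))"
  by (auto simp: xcoef_def xser_nth right_nth left_nth fls_eq_iff)

text \<open>A product of series in two variables is a double Cauchy sum, which does not depend on
  the variable expanded first.\<close>

lemma is_ring_hom_xser: "is_ring_hom xser"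
  unfolding is_ring_hom_def
proof (intro conjI allI)
  show "xser 1 = (1 :: 'a fls fps)"
    by (auto simp: fps_eq_iff xser_nth fls_eq_iff coeff_1)
  fix D E :: "'a poly fps"
  show "xser (D + E) = xser D + xser E"
    by (auto simp: fps_eq_iff xser_nth fls_eq_iff)
  show "xser (D * E) = xser D * xser E"
  proof (rule fps_ext)
    fix k
    have hom: "is_ring_hom (fps_to_fls :: 'a fps \<Rightarrow> _)" by (rule is_ring_hom_fps_to_fls)
    have "Abs_fps (\<lambda>n. coeff ((D * E) $ n) k) =
        (\<Sum>i=0..k. Abs_fps (\<lambda>n. coeff (D $ n) i) * Abs_fps (\<lambda>n. coeff (E $ n) (k - i)))" (is "?l = ?r")
    proof (rule fps_ext)
      fix n
      have "?l $ n = (\<Sum>j=0..n. \<Sum>i\<le>k. coeff (D $ j) i * coeff (E $ (n - j)) (k - i))"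
        by (simp add: fps_mult_nth coeff_sum coeff_mult)
      also have "\<dots> = (\<Sum>i\<le>k. \<Sum>j=0..n. coeff (D $ j) i * coeff (E $ (n - j)) (k - i))"
        by (rule sum.swap)
      also have "\<dots> = ?r $ n"
        by (simp add: fps_sum_nth fps_mult_nth atMost_atLeast0)
      finally show "?l $ n = ?r $ n" .
    qed
    then show "xser (D * E) $ k = (xser D * xser E) $ k"
      by (simp add: xser_nth fps_mult_nth is_ring_hom_sum[OF hom] is_ring_homD(4)[OF hom])
  qed
qed

lemma xser_pconst: "xser (pconst c) = fps_const (fps_to_fls c)"
  by (auto simp: fps_eq_iff xser_nth pconst_def fls_eq_iff coeff_pCons split: nat.splits)

lemma xser_linear: "xser (fps_const [:a, b:]) = fps_const (fls_const a) + fps_const (fls_const b) * fps_X"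
proof (rule fps_ext)
  fix k
  have "Abs_fps (\<lambda>n. coeff (fps_const [:a, b:] $ n) k) = fps_const (coeff [:a, b:] k)"
    by (auto simp: fps_eq_iff)
  then show "xser (fps_const [:a, b:]) $ k = (fps_const (fls_const a) + fps_const (fls_const b) * fps_X) $ k"
    by (auto simp: xser_nth coeff_pCons split: nat.splits)
qed

section \<open>Series with coefficients in a subfield\<close>

definition fps_over :: "'a::zero set \<Rightarrow> 'a fps \<Rightarrow> bool" where
  "fps_over K f \<longleftrightarrow> (\<forall>k. f $ k \<in> K)"

context
  fixes K :: "'a::field set"
  assumes K: "is_subfield K"
begin

lemma fps_over_const: "c \<in> K \<Longrightarrow> fps_over K (fps_const c)"
  and fps_over_1: "fps_over K 1"
  and fps_over_0: "fps_over K 0"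
  and fps_over_X: "fps_over K fps_X"
  and fps_over_add: "fps_over K f \<Longrightarrow> fps_over K g \<Longrightarrow> fps_over K (f + g)"
  and fps_over_diff: "fps_over K f \<Longrightarrow> fps_over K g \<Longrightarrow> fps_over K (f - g)"
  and fps_over_mult: "fps_over K f \<Longrightarrow> fps_over K g \<Longrightarrow> fps_over K (f * g)"
  by (auto simp: fps_over_def fps_mult_nth fps_X_def is_subfieldD[OF K]
      intro!: is_subfield_sum[OF K])

lemma fps_over_sum: "(\<And>b. b \<in> B \<Longrightarrow> fps_over K (f b)) \<Longrightarrow> fps_over K (sum f B)"
  by (induction B rule: infinite_finite_induct) (auto intro: fps_over_add fps_over_0)

lemma fps_over_power: "fps_over K f \<Longrightarrow> fps_over K (f ^ n)"
  by (induction n) (auto intro: fps_over_mult fps_over_1)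

text \<open>Comparing coefficients gives \<open>g\<close> by a forward recursion whose only division
  is by \<open>f $ 0\<close>.\<close>

lemma fps_over_cancel:
  assumes "fps_over K (f * g)" "fps_over K f" "f $ 0 \<noteq> 0"
  shows "fps_over K g"
proof -
  have "g $ n \<in> K" for n
  proof (induction n rule: less_induct)
    case (less n)
    have "(f * g) $ n = f $ 0 * g $ n + (\<Sum>i=1..n. f $ i * g $ (n - i))"
      unfolding fps_mult_nth by (simp add: sum.atLeast_Suc_atMost)
    then have "g $ n = ((f * g) $ n - (\<Sum>i=1..n. f $ i * g $ (n - i))) / f $ 0"
      using assms(3) by simp
    also have "\<dots> \<in> K"
      using assms(1,2) less by (intro is_subfieldD[OF K] is_subfield_sum[OF K]) (auto simp: fps_over_def)
    finally show ?case .
  qed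
  then show ?thesis by (simp add: fps_over_def)
qed

lemma fps_over_X_cancel: "fps_over K (fps_X * g) \<Longrightarrow> fps_over K g"
proof -
  assume *: "fps_over K (fps_X * g)"
  have "(fps_X * g) $ Suc k = g $ k" for k by simp
  then show ?thesis using * unfolding fps_over_def by metis
qed

text \<open>The recursion for a square root divides only by \<open>2 * g $ 0\<close>, so the
  constant term is the only element that may have to be adjoined. This is why the theorem adjoins
  just one square root per expansion point.\<close>

lemma fps_over_sqrt:
  fixes g :: "'a fps"
  assumes "fps_over K (g * g)" "g $ 0 \<in> K" "g $ 0 \<noteq> 0" "(2::'a) \<noteq> 0"
  shows "fps_over K g"
proof -
  have "g $ n \<in> K" for n
  proof (induction n rule: less_induct)
    case (less n)
    show ?case
    proof (cases "n = 0")
      case False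
      then obtain m where m: "n = Suc m" by (cases n) auto
      have "(g * g) $ n = 2 * g $ 0 * g $ n + (\<Sum>i=1..m. g $ i * g $ (n - i))"
        unfolding fps_mult_nth m by (simp add: sum.atLeast_Suc_atMost)
      then have "g $ n = ((g * g) $ n - (\<Sum>i=1..m. g $ i * g $ (n - i))) / (2 * g $ 0)"
        using assms(3,4) by simp
      also have "\<dots> \<in> K"
        using assms(1,2) less m is_subfield_numeral[OF K, of "num.Bit0 num.One"]
        by (intro is_subfieldD[OF K] is_subfield_sum[OF K]) (auto simp: fps_over_def)
      finally show ?thesis .
    qed (use assms in auto)
  qed
  then show ?thesis by (simp add: fps_over_def)
qed

end

section \<open>Counting walks on the slit plane\<close>

lemma slit_walks_0: "slit_walks S 0 p = (if p = (0, 0) then {[(0, 0)]} else {})"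
  by (auto simp: slit_walks_def length_Suc_conv)

text \<open>Deleting the last point leaves a slit plane walk ending at \<open>p - s\<close>, with
  \<open>s\<close> the last step; the deleted point only had to avoid the half-line.\<close>

lemma slit_walks_Suc:
  "slit_walks S (Suc n) p =
     (if p \<in> half_line then {} else \<Union>s\<in>S. (\<lambda>w. w @ [p]) ` slit_walks S n (p - s))"
proof (intro Set.set_eqI iffI)
  fix w assume w: "w \<in> slit_walks S (Suc n) p"
  then obtain v q where v: "w = v @ [q]" "length v = n + 1"
    by (cases w rule: rev_cases) (auto simp: slit_walks_def)
  have nth: "w ! k = v ! k" if "k \<le> n" for k using that v by (auto simp: nth_append)
  have q: "q = p" using w v by (auto simp: slit_walks_def nth_append)
  have wD: "w ! Suc n = p" "w ! 0 = (0, 0)"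
    "\<And>k. k \<in> {1..Suc n} \<Longrightarrow> w ! k - w ! (k - 1) \<in> S \<and> w ! k \<notin> half_line"
    using w unfolding slit_walks_def by auto
  have notin: "p \<notin> half_line" using wD(3)[of "Suc n"] wD(1) by simp
  define s where "s = p - v ! n"
  have "s \<in> S"
    using wD(3)[of "Suc n"] wD(1) nth[of n] by (simp add: s_def)
  moreover have "v \<in> slit_walks S n (p - s)"
  proof -
    have "v ! k - v ! (k - 1) \<in> S \<and> v ! k \<notin> half_line" if "k \<in> {1..n}" for k
    proof -
      have "w ! k - w ! (k - 1) \<in> S \<and> w ! k \<notin> half_line"
        using wD(3)[of k] that by simp
      then show ?thesis using nth[of k] nth[of "k - 1"] that by auto
    qed
    moreover have "v ! 0 = (0, 0)" using wD(2) nth[of 0] by simp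
    ultimately show ?thesis using v(2) by (auto simp: slit_walks_def s_def)
  qed
  ultimately show "w \<in> (if p \<in> half_line then {} else \<Union>s\<in>S. (\<lambda>w. w @ [p]) ` slit_walks S n (p - s))"
    using notin v q by auto
next
  fix w assume "w \<in> (if p \<in> half_line then {} else \<Union>s\<in>S. (\<lambda>w. w @ [p]) ` slit_walks S n (p - s))"
  then obtain s v where v: "p \<notin> half_line" "s \<in> S" "w = v @ [p]" "v \<in> slit_walks S n (p - s)"
    by (auto split: if_splits)
  have len: "length v = n + 1" "v ! n = p - s" using v by (auto simp: slit_walks_def)
  have nth: "w ! k = v ! k" if "k \<le> n" for k using that v len by (auto simp: nth_append)
  have last: "w ! Suc n = p" using v len by (auto simp: nth_append)
  have "w ! k - w ! (k - 1) \<in> S \<and> w ! k \<notin> half_line" if "k \<in> {1..Suc n}" for k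
  proof (cases "k = Suc n")
    case True
    then show ?thesis using v len nth[of n] last by auto
  next
    case False
    then have "k \<in> {1..n}" using that by auto
    then show ?thesis using v(4) nth[of k] nth[of "k - 1"] by (auto simp: slit_walks_def)
  qed
  then show "w \<in> slit_walks S (Suc n) p"
    using v len nth[of 0] last by (auto simp: slit_walks_def)
qed

text \<open>The endpoint is not tested against the half-line. At points of the half-line this
  therefore counts the walks of length \<open>n + 1\<close> that return there for the first time at
  their last step, that is, the coefficients of \<open>H\<close>.\<close>

definition step_count :: "(int \<times> int) set \<Rightarrow> int \<Rightarrow> int \<Rightarrow> nat \<Rightarrow> nat" where
  "step_count S i j n = (\<Sum>(a, b)\<in>S. slit_count S (i - a) (j - b) n)"

context
  fixes S :: "(int \<times> int) set"
  assumes fin: "finite S"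
begin

lemma finite_slit_walks: "finite (slit_walks S n p)"
proof (induction n arbitrary: p)
  case 0
  then show ?case by (simp add: slit_walks_0)
next
  case (Suc n)
  then show ?case using fin by (simp add: slit_walks_Suc)
qed

lemma slit_count_0: "slit_count S i j 0 = (if i = 0 \<and> j = 0 then 1 else 0)"
  by (simp add: slit_count_def slit_walks_0)

lemma slit_count_Suc:
  "slit_count S i j (Suc n) = (if j = 0 \<and> i \<le> 0 then 0 else step_count S i j n)"
proof -
  have "card (\<Union>s\<in>S. (\<lambda>w. w @ [(i, j)]) ` slit_walks S n ((i, j) - s)) =
      (\<Sum>s\<in>S. card ((\<lambda>w. w @ [(i, j)]) ` slit_walks S n ((i, j) - s)))"
  proof (rule card_UN_disjoint)
    show "\<forall>s\<in>S. finite ((\<lambda>w. w @ [(i, j)]) ` slit_walks S n ((i, j) - s))"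
      by (simp add: finite_slit_walks)
    have "s = s'" if "w \<in> slit_walks S n ((i, j) - s)" "w \<in> slit_walks S n ((i, j) - s')" for w s s'
    proof -
      have "(i, j) - s = (i, j) - s'" using that unfolding slit_walks_def by simp
      then show ?thesis by (metis diff_diff_eq2 add_diff_cancel_left')
    qed
    then show "\<forall>s\<in>S. \<forall>s'\<in>S. s \<noteq> s' \<longrightarrow> (\<lambda>w. w @ [(i, j)]) ` slit_walks S n ((i, j) - s) \<inter>
        (\<lambda>w. w @ [(i, j)]) ` slit_walks S n ((i, j) - s') = {}"
      by blast
  qed (rule fin)
  also have "\<dots> = step_count S i j n"
    unfolding step_count_def slit_count_def
    by (intro sum.cong refl) (auto simp: card_image inj_on_def)
  finally show ?thesis
    by (auto simp: slit_count_def slit_walks_Suc half_line_def)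
qed

lemma finite_slit_count: "finite {p. slit_count S (fst p) (snd p) n \<noteq> 0}"
proof (induction n)
  case 0
  have "{p. slit_count S (fst p) (snd p) 0 \<noteq> 0} \<subseteq> {(0, 0)}" by (auto simp: slit_count_0)
  then show ?case using finite_subset by blast
next
  case (Suc n)
  have "{p. slit_count S (fst p) (snd p) (Suc n) \<noteq> 0} \<subseteq>
      (\<lambda>(p, s). p + s) ` ({p. slit_count S (fst p) (snd p) n \<noteq> 0} \<times> S)"
  proof
    fix p assume "p \<in> {p. slit_count S (fst p) (snd p) (Suc n) \<noteq> 0}"
    then have "step_count S (fst p) (snd p) n \<noteq> 0" by (auto simp: slit_count_Suc split: if_splits)
    then obtain s where s: "s \<in> S" "slit_count S (fst p - fst s) (snd p - snd s) n \<noteq> 0"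
      unfolding step_count_def by (metis (mono_tags, lifting) case_prod_beta sum.neutral)
    then show "p \<in> (\<lambda>(p, s). p + s) ` ({p. slit_count S (fst p) (snd p) n \<noteq> 0} \<times> S)"
      by (intro image_eqI[of _ _ "(p - s, s)"]) auto
  qed
  then show ?case using Suc fin by (meson finite_SigmaI finite_imageI finite_subset)
qed

lemma finite_slit_count_row: "finite {i. slit_count S i j n \<noteq> 0}"
proof -
  have "finite ((\<lambda>i. (i, j)) -` {p. slit_count S (fst p) (snd p) n \<noteq> 0})"
    by (intro finite_vimageI finite_slit_count) (auto simp: inj_on_def)
  then show ?thesis by (simp add: vimage_def)
qed

lemma finite_step_count_row: "finite {i. step_count S i j n \<noteq> 0}"
proof -
  have "{i. step_count S i j n \<noteq> 0} \<subseteq> (\<Union>s\<in>S. (\<lambda>i. i + fst s) ` {i. slit_count S i (j - snd s) n \<noteq> 0})"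
  proof
    fix i assume "i \<in> {i. step_count S i j n \<noteq> 0}"
    then obtain s where s: "s \<in> S" "slit_count S (i - fst s) (j - snd s) n \<noteq> 0"
      unfolding step_count_def by (metis (mono_tags, lifting) case_prod_beta mem_Collect_eq sum.neutral)
    then show "i \<in> (\<Union>s\<in>S. (\<lambda>i. i + fst s) ` {i. slit_count S i (j - snd s) n \<noteq> 0})"
      by (intro UN_I[OF s(1)] image_eqI[of _ _ "i - fst s"]) auto
  qed
  then show ?thesis using fin finite_slit_count_row by (meson finite_UN_I finite_imageI finite_subset)
qed

end

text \<open>A copy of \<open>slit_gf\<close> with free coefficient field: real for the closed form,
  complex for the arguments that involve roots.\<close>

definition slit_series :: "(int \<times> int) set \<Rightarrow> int \<Rightarrow> 'a::field_char_0 fls fps" where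
  "slit_series S j = Abs_fps (\<lambda>n. \<Sum>i | slit_count S i j n \<noteq> 0.
     of_nat (slit_count S i j n) * fls_X powi i)"

lemma slit_gf_eq_slit_series: "slit_gf S j = slit_series S j"
  by (simp add: slit_gf_def slit_series_def)

abbreviation Ac :: "(int \<times> int) set \<Rightarrow> int \<Rightarrow> 'a::field fls fps" where
  "Ac S k \<equiv> fps_const (A S k fls_X)"

lemma fls_nth_sum: "(\<Sum>x\<in>B. f x) $$ i = (\<Sum>x\<in>B. f x $$ i)"
  by (induction B rule: infinite_finite_induct) auto

lemma Ac_mult_nth: "((Ac S k * F) $ n) $$ i = (\<Sum>a | (a, k) \<in> S. (F $ n) $$ (i - a))"
  by (simp add: A_def sum_distrib_right fls_nth_sum fls_X_intpow_mult_nth)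

lemma coeff_Abs_poly:
  assumes "finite {k. f k \<noteq> 0}"
  shows "coeff (Abs_poly f) k = f k"
  using assms by (subst Abs_poly_inverse) (auto simp: MOST_iff_cofinite)

text \<open>\<open>S\<^sub>0(x;t)\<close> as a polynomial series in \<open>x\<close>, and \<open>1 - H(1/x;t)\<close> as one in \<open>1/x\<close>.\<close>

definition axis_poly :: "(int \<times> int) set \<Rightarrow> 'a::field_char_0 poly fps" where
  "axis_poly S = Abs_fps (\<lambda>n. Abs_poly (\<lambda>k. of_nat (slit_count S (int k) 0 n)))"

definition hit_poly :: "(int \<times> int) set \<Rightarrow> 'a::field_char_0 poly fps" where
  "hit_poly S = Abs_fps (\<lambda>n. if n = 0 then 1
     else Abs_poly (\<lambda>k. - of_nat (step_count S (- int k) 0 (n - 1))))"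

context
  fixes S :: "(int \<times> int) set"
  assumes fin: "finite S" and small: "\<forall>(i, j)\<in>S. \<bar>j\<bar> \<le> 1"
begin

lemma slit_series_nth: "((slit_series S j :: 'a::field_char_0 fls fps) $ n) $$ i = of_nat (slit_count S i j n)"
proof -
  have "((slit_series S j :: 'a fls fps) $ n) $$ i =
      (\<Sum>k | slit_count S k j n \<noteq> 0. (of_nat (slit_count S k j n) * fls_X powi k) $$ i)"
    by (simp only: slit_series_def fps_nth_Abs_fps fls_nth_sum)
  also have "\<dots> = (\<Sum>k | slit_count S k j n \<noteq> 0. if k = i then of_nat (slit_count S k j n) else 0)"
  proof (rule sum.cong[OF refl])
    fix k
    have "(of_nat (slit_count S k j n) * fls_X powi k :: 'a fls) =
        fls_X_intpow k * fls_const (of_nat (slit_count S k j n))"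
      by (simp add: fls_of_nat mult.commute)
    then show "(of_nat (slit_count S k j n) * fls_X powi k :: 'a fls) $$ i =
        (if k = i then of_nat (slit_count S k j n) else 0)"
      by (simp only: fls_X_intpow_mult_nth) auto
  qed
  also have "\<dots> = of_nat (slit_count S i j n)"
    using finite_slit_count_row[OF fin, of j n] by (subst sum.delta) auto
  finally show ?thesis .
qed

lemma coeff_axis_poly: "coeff (axis_poly S $ n) k = of_nat (slit_count S (int k) 0 n)"
proof -
  have "finite (int -` {i. slit_count S i 0 n \<noteq> 0})"
    by (intro finite_vimageI finite_slit_count_row fin) auto
  then show ?thesis by (simp add: axis_poly_def coeff_Abs_poly vimage_def)
qed

lemma coeff_hit_poly:
  "coeff (hit_poly S $ Suc n) k = - of_nat (step_count S (- int k) 0 n)"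
proof -
  have "finite ((\<lambda>k. - int k) -` {i. step_count S i 0 n \<noteq> 0})"
    by (intro finite_vimageI finite_step_count_row fin) (auto simp: inj_on_def)
  then show ?thesis by (simp add: hit_poly_def coeff_Abs_poly vimage_def)
qed

lemma axis_poly_0: "axis_poly S $ 0 = 1"
  by (rule poly_eqI) (simp add: coeff_axis_poly slit_count_0[OF fin])

lemma hit_poly_0: "hit_poly S $ 0 = 1"
  by (simp add: hit_poly_def)

text \<open>The origin lies on the half-line, so only the empty walk ends there. This is the
  normalization at \<open>x = 0\<close> that makes \<open>1 / S_0^2\<close> a canonical
  factor.\<close>

lemma coeff_axis_poly_0: "coeff (axis_poly S $ n) 0 = (if n = 0 then 1 else 0)"
  by (cases n) (auto simp: coeff_axis_poly slit_count_0[OF fin] slit_count_Suc[OF fin])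

text \<open>On the axis the half-line forbids all endpoints with \<open>i \<le> 0\<close> except
  that of the empty walk, so no negative power of \<open>x\<close> occurs.\<close>

lemma slit_series_0: "slit_series S 0 = right (axis_poly S)"
proof (intro fps_ext fls_eqI)
  fix n i
  show "(slit_series S 0 $ n) $$ i = (right (axis_poly S) $ n) $$ i"
    by (cases n) (auto simp: slit_series_nth right_nth coeff_axis_poly slit_count_0[OF fin] slit_count_Suc[OF fin])
qed

text \<open>A step of height \<open>b\<close> reaches ordinate \<open>j\<close> from ordinate
  \<open>j - b\<close>; the bound on heights leaves exactly the three values of \<open>b\<close> on
  the left.\<close>

lemma step_count_eq:
  "((Ac S 1 * (slit_series S (j - 1) :: 'a::field_char_0 fls fps) + Ac S 0 * slit_series S j + Ac S (- 1) * slit_series S (j + 1)) $ n) $$ i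
    = of_nat (step_count S i j n)"
proof -
  let ?B = "\<lambda>k. (\<lambda>a. (a, k)) ` {a. (a, k) \<in> S}"
  have finB: "finite {a. (a, k) \<in> S}" for k
  proof -
    have "{a. (a, k) \<in> S} \<subseteq> fst ` S" by force
    then show ?thesis using fin finite_subset by blast
  qed
  have "b = 1 \<or> b = 0 \<or> b = - 1" if "(a, b) \<in> S" for a b
  proof -
    have "\<bar>b\<bar> \<le> 1" using small that by blast
    then show ?thesis by arith
  qed
  then have "S = (\<Union>k\<in>{1, 0, -1}. ?B k)" by (auto simp: image_iff) metis+
  then have "step_count S i j n = (\<Sum>(a, b)\<in>(\<Union>k\<in>{1, 0, -1}. ?B k). slit_count S (i - a) (j - b) n)"
    unfolding step_count_def by (rule sum.cong) auto
  also have "\<dots> = (\<Sum>k\<in>{1, 0, -1}. \<Sum>(a, b)\<in>?B k. slit_count S (i - a) (j - b) n)"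
    by (rule sum.UNION_disjoint) (auto simp: finB)
  also have "\<dots> = (\<Sum>k\<in>{1, 0, -1}. \<Sum>a | (a, k) \<in> S. slit_count S (i - a) (j - k) n)"
    by (intro sum.cong refl) (subst sum.reindex, auto simp: inj_on_def)
  finally show ?thesis
    by (simp del: fps_mult_left_const_nth add: Ac_mult_nth slit_series_nth)
qed

lemma slit_series_rec:
  assumes "j \<noteq> 0"
  shows "(slit_series S j :: 'a::field_char_0 fls fps) = fps_X * (Ac S 1 * slit_series S (j - 1) + Ac S 0 * slit_series S j
    + Ac S (- 1) * slit_series S (j + 1))"
proof (intro fps_ext fls_eqI)
  fix n i
  show "((slit_series S j :: 'a fls fps) $ n) $$ i = ((fps_X * (Ac S 1 * slit_series S (j - 1) + Ac S 0 * slit_series S j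
    + Ac S (- 1) * slit_series S (j + 1))) $ n) $$ i"
  proof (cases n)
    case 0
    then show ?thesis using assms by (simp add: slit_series_nth slit_count_0[OF fin])
  next
    case (Suc m)
    then show ?thesis
      using step_count_eq[where 'a='a, of j m i] assms
      by (simp add: slit_series_nth slit_count_Suc[OF fin] del: fps_mult_left_const_nth fps_add_nth)
  qed
qed

text \<open>On the axis, the appended steps that land on the half-line must be removed.
  \<open>hit_poly\<close> subtracts them, and its constant term 1 supplies the empty walk.\<close>

lemma slit_series_rec_0:
  "(slit_series S 0 :: 'a::field_char_0 fls fps) = left (hit_poly S) + fps_X * (Ac S 1 * slit_series S (- 1) + Ac S 0 * slit_series S 0
    + Ac S (- 1) * slit_series S 1)"
proof (intro fps_ext fls_eqI)
  fix n i
  show "((slit_series S 0 :: 'a fls fps) $ n) $$ i = ((left (hit_poly S) + fps_X * (Ac S 1 * slit_series S (- 1) + Ac S 0 * slit_series S 0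
    + Ac S (- 1) * slit_series S 1)) $ n) $$ i"
  proof (cases n)
    case 0
    then show ?thesis by (auto simp: slit_series_nth slit_count_0[OF fin] left_nth hit_poly_0 coeff_1)
  next
    case (Suc m)
    have "((fps_X * F) $ Suc m) = F $ m" for F :: "'a fls fps" by simp
    then show ?thesis
      using step_count_eq[where 'a='a, of 0 m i] Suc
      by (auto simp: fps_add_nth[of "left _"] slit_series_nth slit_count_Suc[OF fin] left_nth coeff_hit_poly
          simp del: fps_mult_left_const_nth fps_add_nth)
  qed
qed

end

section \<open>The series of walks ending at a given ordinate\<close>

text \<open>The recurrence looks ahead to \<open>f (Suc (Suc j))\<close>, so induction on
  \<open>j\<close> fails; but its factor \<open>t\<close> expresses each coefficient of
  \<open>t^(n+1)\<close> through coefficients of \<open>t^n\<close>, so induction on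
  \<open>n\<close> works for all \<open>j\<close> simultaneously.\<close>

lemma linear_recurrence_unique:
  fixes f g :: "nat \<Rightarrow> 'a::comm_ring_1 fps"
  assumes "f 0 = g 0"
    and f: "\<And>j. f (Suc j) = fps_X * (fps_const a * f j + fps_const b * f (Suc j) + fps_const c * f (Suc (Suc j)))"
    and g: "\<And>j. g (Suc j) = fps_X * (fps_const a * g j + fps_const b * g (Suc j) + fps_const c * g (Suc (Suc j)))"
  shows "f j = g j"
proof (rule fps_ext)
  fix n show "f j $ n = g j $ n"
  proof (induction n arbitrary: j)
    case 0
    show ?case
    proof (cases j)
      case (Suc i)
      then show ?thesis using arg_cong[OF f[of i], of "\<lambda>F. F $ 0"] arg_cong[OF g[of i], of "\<lambda>F. F $ 0"] by simp
    qed (simp add: assms(1))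
  next
    case (Suc n)
    show ?case
    proof (cases j)
      case (Suc i)
      then show ?thesis
        using arg_cong[OF f[of i], of "\<lambda>F. F $ Suc n"] arg_cong[OF g[of i], of "\<lambda>F. F $ Suc n"]
        by (simp add: Suc.IH)
    qed (simp add: assms(1))
  qed
qed

definition Disc :: "(int \<times> int) set \<Rightarrow> 'a::field_char_0 fls fps" where
  "Disc S = (1 - fps_X * Ac S 0)\<^sup>2 - 4 * fps_X\<^sup>2 * Ac S 1 * Ac S (- 1)"

lemma Delta_eq_Disc: "Delta S = Disc S"
  by (simp add: Delta_def Disc_def)

text \<open>This is \<open>Z / A\<^sub>k\<close>, written in a form that makes sense if \<open>A\<^sub>k = 0\<close>.\<close>

definition Wser :: "(int \<times> int) set \<Rightarrow> int \<Rightarrow> 'a::field_char_0 fls fps" where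
  "Wser S k = 2 * fps_X * Ac S (- k) * inverse (1 - fps_X * Ac S 0 + fps_sqrt (Disc S))"

lemma Disc_nth_0: "Disc S $ 0 = 1"
  by (simp add: Disc_def power2_eq_square)

lemma Wser_denominator:
  fixes S defines "d \<equiv> 1 - fps_X * Ac S 0 + fps_sqrt (Disc S) :: 'a::field_char_0 fls fps"
  shows "d * inverse d = 1"
proof -
  have "d $ 0 = 2" by (simp add: d_def fps_sqrt_square(2)[OF Disc_nth_0])
  then show ?thesis by (metis inverse_mult_eq_1' zero_neq_numeral)
qed

text \<open>With \<open>u = 1 - t A_0\<close> and \<open>q = sqrt Delta\<close> one has
  \<open>u^2 - q^2 = 4 t^2 A_1 A_-1\<close>; \<open>Wser\<close> is
  \<open>(u - q) / (2 t A_k)\<close> with the numerator rationalized.\<close>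

lemma Wser_times_Ac:
  assumes "k \<in> {1, - 1}"
  shows "2 * fps_X * Ac S k * Wser S k = (1 - fps_X * Ac S 0 - fps_sqrt (Disc S) :: 'a::field_char_0 fls fps)"
proof -
  define u q where "u = (1 - fps_X * Ac S 0 :: 'a fls fps)" and "q = (fps_sqrt (Disc S) :: 'a fls fps)"
  define d where "d = inverse (u + q)"
  have d: "(u + q) * d = 1" using Wser_denominator[of S] by (simp add: u_def q_def d_def)
  have "q\<^sup>2 = u\<^sup>2 - 4 * fps_X\<^sup>2 * Ac S k * Ac S (- k)"
    unfolding q_def u_def fps_sqrt_square(1)[OF Disc_nth_0] using assms by (auto simp: Disc_def mult_ac)
  then have "4 * fps_X\<^sup>2 * Ac S k * Ac S (- k) = (u - q) * (u + q)"
    by (simp add: algebra_simps power2_eq_square)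
  moreover have "2 * fps_X * Ac S k * Wser S k = 4 * fps_X\<^sup>2 * Ac S k * Ac S (- k) * d"
    by (simp only: Wser_def u_def[symmetric] q_def[symmetric] d_def[symmetric])
      (simp only: mult_ac power2_eq_square, simp add: mult_ac)
  ultimately have "2 * fps_X * Ac S k * Wser S k = (u - q) * ((u + q) * d)"
    by (simp only: mult_ac)
  then have "2 * fps_X * Ac S k * Wser S k = u - q" by (simp only: d mult_1_right)
  then show ?thesis by (simp only: u_def q_def)
qed

text \<open>The two identities \<open>2 t A_k W = u - q\<close> and
  \<open>W (u + q) = 2 t A_-k\<close> both hold without dividing by \<open>A_k\<close>; adding
  \<open>W\<close> times the first to the second eliminates \<open>q\<close>.\<close>

lemma Wser_quadratic:
  assumes "k \<in> {1, - 1}"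
  shows "Wser S k = fps_X * (Ac S (- k) + Ac S 0 * Wser S k + Ac S k * (Wser S k :: 'a::field_char_0 fls fps)\<^sup>2)"
proof -
  define u q where "u = (1 - fps_X * Ac S 0 :: 'a fls fps)" and "q = (fps_sqrt (Disc S) :: 'a fls fps)"
  define d where "d = inverse (u + q)"
  define W where "W = (Wser S k :: 'a fls fps)"
  have d: "(u + q) * d = 1" using Wser_denominator[of S] by (simp add: u_def q_def d_def)
  have W: "W = 2 * fps_X * Ac S (- k) * d"
    by (simp add: W_def Wser_def u_def q_def d_def)
  have uq: "2 * fps_X * Ac S k * W = u - q"
    unfolding W_def u_def q_def by (rule Wser_times_Ac[OF assms])
  have "W * (u + q) = 2 * (fps_X * Ac S (- k)) * ((u + q) * d)" by (simp only: W mult_ac)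
  then have Wd: "W * (u + q) = 2 * (fps_X * Ac S (- k))" by (simp only: d mult_1_right)
  have alg: "W = t * (a + b * W + c * W\<^sup>2)"
    if "u = 1 - t * b" "2 * t * c * W = u - q" "W * (u + q) = 2 * (t * a)" for t a b c :: "'a fls fps"
  proof -
    have "2 * (t * (a + c * W\<^sup>2)) = W * (u + q) + (2 * t * c * W) * W"
      unfolding that(3) by (simp add: algebra_simps power2_eq_square)
    also have "\<dots> = 2 * (u * W)" unfolding that(2) by (simp add: algebra_simps)
    finally have "t * (a + c * W\<^sup>2) = u * W" by simp
    then show ?thesis by (simp add: that(1) algebra_simps)
  qed
  have "W = fps_X * (Ac S (- k) + Ac S 0 * W + Ac S k * W\<^sup>2)"
    by (rule alg[OF u_def uq Wd])
  then show ?thesis unfolding W_def .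
qed

context
  fixes S :: "(int \<times> int) set"
  assumes fin: "finite S" and small: "\<forall>(i, j)\<in>S. \<bar>j\<bar> \<le> 1"
begin

text \<open>The sign \<open>k\<close> treats both half planes at once: the ordinate
  \<open>- k * j\<close> is at distance \<open>j\<close> from the axis, \<open>A_k\<close> collects
  the steps toward the axis and \<open>A_-k\<close> those away from it.\<close>

lemma slit_series_rec_row:
  assumes k: "k \<in> {1, - 1}"
  shows "slit_series S (- k * int (Suc j)) = fps_X * (Ac S (- k) * slit_series S (- k * int j)
    + Ac S 0 * slit_series S (- k * int (Suc j))
    + Ac S k * (slit_series S (- k * int (Suc (Suc j))) :: 'a::field_char_0 fls fps))"
proof -
  have "- k * int (Suc j) \<noteq> 0" using k by auto
  note rec = slit_series_rec[OF fin small this, where 'a='a]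
  show ?thesis
  proof (cases "k = 1")
    case True
    have "- 1 * int (Suc j) - 1 = - 1 * int (Suc (Suc j))" "- 1 * int (Suc j) + 1 = - 1 * int j" by simp_all
    then show ?thesis using rec unfolding True by (simp only: add_ac)
  next
    case False
    then have k: "k = - 1" using k by simp
    have "- (- 1) * int (Suc j) - 1 = - (- 1) * int j" "- (- 1) * int (Suc j) + 1 = - (- 1) * int (Suc (Suc j))"
      by simp_all
    then show ?thesis using rec unfolding k by (simp only: minus_minus)
  qed
qed

text \<open>Multiplied by \<open>S_0 W^j\<close>, the quadratic equation of \<open>W\<close> becomes
  the recurrence, so \<open>S_0 W^j\<close> is a solution with the right initial term.\<close>

lemma slit_series_eq:
  assumes k: "k \<in> {1, - 1}"
  shows "slit_series S (- k * int j) = slit_series S 0 * (Wser S k :: 'a::field_char_0 fls fps) ^ j"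
proof -
  define f where "f = (\<lambda>j. slit_series S (- k * int j) :: 'a fls fps)"
  define W where "W = (Wser S k :: 'a fls fps)"
  have "f j = slit_series S 0 * W ^ j"
  proof (rule linear_recurrence_unique[where a = "A S (- k) fls_X" and b = "A S 0 fls_X" and c = "A S k fls_X"])
    fix j
    show "f (Suc j) = fps_X * (Ac S (- k) * f j + Ac S 0 * f (Suc j) + Ac S k * f (Suc (Suc j)))"
      unfolding f_def by (rule slit_series_rec_row[OF k])
    have alg: "G * W ^ j * (t * (a + b * W + c * W\<^sup>2)) =
        t * (a * (G * W ^ j) + b * (G * W ^ Suc j) + c * (G * W ^ Suc (Suc j)))" for G t a b c :: "'a fls fps"
      by (simp add: algebra_simps power2_eq_square)
    have "slit_series S 0 * W ^ Suc j = slit_series S 0 * W ^ j * W" by simp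
    also have "\<dots> = slit_series S 0 * W ^ j * (fps_X * (Ac S (- k) + Ac S 0 * W + Ac S k * W\<^sup>2))"
      using Wser_quadratic[OF k, of S, where 'a='a] unfolding W_def by (rule arg_cong)
    also have "\<dots> = fps_X * (Ac S (- k) * (slit_series S 0 * W ^ j) +
        Ac S 0 * (slit_series S 0 * W ^ Suc j) + Ac S k * (slit_series S 0 * W ^ Suc (Suc j)))"
      by (rule alg)
    finally show "slit_series S 0 * W ^ Suc j = \<dots>" .
  qed (simp add: f_def)
  then show ?thesis by (simp add: f_def W_def)
qed

lemma slit_series_first_row:
  assumes k: "k \<in> {1, - 1}"
  shows "2 * fps_X * Ac S k * slit_series S (- k) =
    slit_series S 0 * (1 - fps_X * Ac S 0 - fps_sqrt (Disc S) :: 'a::field_char_0 fls fps)"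
proof -
  have "slit_series S (- k) = slit_series S 0 * (Wser S k :: 'a fls fps)"
    using slit_series_eq[OF k, where 'a='a, of 1] by simp
  then show ?thesis unfolding Wser_times_Ac[OF k, where 'a='a, of S, symmetric] by (simp only: mult_ac)
qed

text \<open>Both neighbouring rows satisfy \<open>2 t A_k S_-k = S_0 (u - q)\<close>. Inserted into
  twice the recurrence at ordinate 0 they leave \<open>2 S_0 q\<close>; doubling avoids any division
  by \<open>t\<close> or \<open>A_k\<close>.\<close>

lemma left_hit_poly:
  "left (hit_poly S) = (slit_series S 0 * fps_sqrt (Disc S) :: 'a::field_char_0 fls fps)"
proof -
  have alg: "h = G * q" if "G = h + t * (a1 * m + a0 * G + a2 * p)" "2 * t * a1 * m = G * (1 - t * a0 - q)"
    "2 * t * a2 * p = G * (1 - t * a0 - q)" for h G q t a0 a1 a2 m p :: "'a fls fps"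
  proof -
    have "2 * h = 2 * G - 2 * t * a0 * G - 2 * t * a1 * m - 2 * t * a2 * p"
    proof -
      have "h = G - t * (a1 * m + a0 * G + a2 * p)" using that(1) by (metis add_diff_cancel_right')
      then have "2 * h = 2 * (G - t * (a1 * m + a0 * G + a2 * p))" by (rule arg_cong)
      then show ?thesis by (simp add: algebra_simps)
    qed
    also have "\<dots> = 2 * (G * q)"
      unfolding that(2,3) by (simp add: algebra_simps)
    finally show ?thesis by simp
  qed
  show ?thesis
    using slit_series_first_row[of 1, where 'a='a] slit_series_first_row[of "-1", where 'a='a]
    by (intro alg[OF slit_series_rec_0[OF fin small, where 'a='a]]) simp_all
qed

text \<open>Trading \<open>S_0 sqrt Delta\<close> for \<open>1 - H\<close> leaves on the right only
  a series in \<open>x\<close> and one in \<open>1/x\<close>, up to Laurent polynomial factors,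
  whose coefficients can be controlled separately.\<close>

lemma slit_series_first_row_hit:
  assumes k: "k \<in> {1, - 1}"
  shows "2 * fps_X * Ac S k * slit_series S (- k) =
    slit_series S 0 * (1 - fps_X * Ac S 0) - (left (hit_poly S) :: 'a::field_char_0 fls fps)"
  unfolding slit_series_first_row[OF k] left_hit_poly by (rule right_diff_distrib)

lemma right_left_Disc:
  "right (axis_poly S) ^ 2 * Disc S = (left (hit_poly S) ^ 2 :: 'a::field_char_0 fls fps)"
  unfolding left_hit_poly slit_series_0[OF fin small, symmetric]
  by (simp add: power_mult_distrib fps_sqrt_square(1)[OF Disc_nth_0])

end

section \<open>The canonical factorization\<close>

definition ev0 :: "'a::comm_ring_1 poly fps \<Rightarrow> 'a fps" where "ev0 = subst_var id 0"

lemma is_ring_hom_ev0: "is_ring_hom ev0"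
  unfolding ev0_def by (rule is_ring_hom_subst_var) (simp add: is_ring_hom_def)

lemma ev0_nth: "ev0 D $ n = coeff (D $ n) 0"
  by (simp add: ev0_def subst_var_def poly_0_coeff_0)

lemma ev0_pconst: "ev0 (pconst c) = c"
  by (simp add: fps_eq_iff ev0_nth pconst_def)

lemma ev0_inverse: "D * E = 1 \<Longrightarrow> ev0 D = 1 \<Longrightarrow> ev0 E = 1"
  using is_ring_homD(1,4)[OF is_ring_hom_ev0] by (metis mult_1)

lemma pconst_nth_0: "pconst c $ 0 = [:c $ 0:]"
  by (simp add: pconst_def)

lemma is_canonical_factorization_iff:
  "is_canonical_factorization D (D0, Dp, Dm) \<longleftrightarrow>
     D = right Dp * left (pconst D0 * Dm) \<and> D0 $ 0 = 1 \<and> Dp $ 0 = 1 \<and> Dm $ 0 = 1 \<and> ev0 Dp = 1 \<and> ev0 Dm = 1"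
  by (simp add: is_canonical_factorization_def right_def[symmetric] left_def[symmetric] ev0_def[symmetric]
      is_ring_homD(4)[OF is_ring_hom_left] left_pconst mult_ac del: fls_inverse_X)

text \<open>The quotient of the two plus factors equals a quotient of series in \<open>1/x\<close>,
  so it is free of \<open>x\<close>; its value at \<open>x = 0\<close> makes it 1. The same
  normalization then separates the two remaining factors.\<close>

lemma is_canonical_factorization_unique:
  assumes "is_canonical_factorization D (D0, Dp, Dm)" "is_canonical_factorization D (E0, Ep, Em)"
  shows "D0 = E0 \<and> Dp = Ep \<and> Dm = Em"
proof -
  note D = assms[unfolded is_canonical_factorization_iff]
  note r = is_ring_homD[OF is_ring_hom_right] and l = is_ring_homD[OF is_ring_hom_left]
    and e = is_ring_homD[OF is_ring_hom_ev0]
  obtain ip where ip: "Ep * ip = 1" using fps_unit_inverse_exists D by metis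
  have "(pconst D0 * Dm) $ 0 = 1" using D by (simp add: pconst_nth_0)
  then obtain im where im: "pconst D0 * Dm * im = 1" using fps_unit_inverse_exists by metis
  have eq: "right Dp * left (pconst D0 * Dm) = right Ep * left (pconst E0 * Em)" using D by simp
  have "right (Dp * ip) = right Dp * left (pconst D0 * Dm) * right ip * left im"
    using arg_cong[OF im, of left] by (simp add: r l mult_ac)
  also have "\<dots> = right (Ep * ip) * left (pconst E0 * Em * im)"
    unfolding eq by (simp add: r l mult_ac)
  finally have "right (Dp * ip) = left (pconst E0 * Em * im)" by (simp add: ip r)
  then obtain c where c: "Dp * ip = pconst c" by (rule right_eq_left)
  have "ev0 (Dp * ip) = 1" using D ev0_inverse[OF ip] by (simp add: e)
  then have "c = 1" using c by (simp add: ev0_pconst)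
  then have "Dp * ip = 1" using c by (simp add: is_ring_homD[OF is_ring_hom_pconst])
  moreover have "Dp * (Ep * ip) = Ep * (Dp * ip)" by (simp only: mult_ac)
  ultimately have p: "Dp = Ep" using ip by simp
  have "right Dp \<noteq> 0"
  proof
    assume "right Dp = 0"
    then have "right Dp = right 0" by (simp add: r)
    then have "Dp = 0" by (simp only: right_inject)
    then show False using D by (simp add: e)
  qed
  then have "left (pconst D0 * Dm) = left (pconst E0 * Em)" using eq p by simp
  then have m: "pconst D0 * Dm = pconst E0 * Em" by (simp only: left_inject)
  have "ev0 (pconst D0 * Dm) = ev0 (pconst E0 * Em)" by (simp only: m)
  then have "D0 = E0" using D by (simp add: e ev0_pconst)
  moreover have "pconst D0 \<noteq> 0"
  proof
    assume "pconst D0 = 0"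
    then have "ev0 (pconst D0) = ev0 0" by (rule arg_cong)
    then show False using D by (simp add: e ev0_pconst)
  qed
  ultimately show ?thesis using m p by simp
qed

lemma canonical_factorization_Delta:
  assumes fin: "finite S" and small: "\<forall>(i, j)\<in>S. \<bar>j\<bar> \<le> 1"
    and F: "(D0, Dp, Dm) = canonical_factorization (Delta S)"
  shows "is_canonical_factorization (Delta S) (D0, Dp, Dm)"
    and "Dp * (axis_poly S)\<^sup>2 = 1" and "pconst D0 * Dm = (hit_poly S)\<^sup>2"
proof -
  note r = is_ring_homD[OF is_ring_hom_right] and l = is_ring_homD[OF is_ring_hom_left]
    and e = is_ring_homD[OF is_ring_hom_ev0] and c = is_ring_homD[OF is_ring_hom_pconst]
  define s h where "s = (axis_poly S :: real poly fps)" and "h = (hit_poly S :: real poly fps)"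
  have s0: "s $ 0 = 1" and h0: "h $ 0 = 1" unfolding s_def h_def
    by (rule axis_poly_0[OF fin small] hit_poly_0[OF fin small])+
  have es: "ev0 s = 1"
    by (auto simp: fps_eq_iff ev0_nth s_def coeff_axis_poly_0[OF fin small])
  obtain s' where s': "s * s' = 1" "s' $ 0 = 1" using fps_unit_inverse_exists[OF s0] .
  \<comment> \<open>\<open>E0\<close> is the part of \<open>(1 - H)^2\<close> free of
    \<open>1/x\<close>; dividing by it normalizes \<open>Em\<close>.\<close>
  define E0 where "E0 = ev0 (h\<^sup>2)"
  have E00: "E0 $ 0 = 1" by (simp add: E0_def ev0_nth power2_eq_square h0)
  obtain i0 where i0: "E0 * i0 = 1" "i0 $ 0 = 1" using fps_unit_inverse_exists[OF E00] .
  define Ep Em where "Ep = s'\<^sup>2" and "Em = h\<^sup>2 * pconst i0"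
  have pE: "pconst E0 * Em = h\<^sup>2"
    using arg_cong[OF i0(1), of pconst] by (simp add: Em_def c mult.left_commute)
  have "right s ^ 2 * Delta S = left h ^ 2"
    using right_left_Disc[OF fin small, where 'a=real] by (simp add: Delta_eq_Disc s_def h_def)
  then have "right (s * s') ^ 2 * Delta S = right (s'\<^sup>2) * left (h\<^sup>2)"
    by (simp add: r l power2_eq_square mult_ac)
  then have D: "Delta S = right Ep * left (pconst E0 * Em)"
    unfolding pE by (simp add: Ep_def s' r)
  have can: "is_canonical_factorization (Delta S) (E0, Ep, Em)"
    unfolding is_canonical_factorization_iff
  proof (intro conjI D E00)
    show "Ep $ 0 = 1" "Em $ 0 = 1"
      by (simp_all add: Ep_def Em_def power2_eq_square s' h0 i0 pconst_nth_0)
    show "ev0 Ep = 1" using ev0_inverse[OF s'(1) es] by (simp add: Ep_def power2_eq_square e)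
    show "ev0 Em = 1" using i0 by (simp add: Em_def e E0_def ev0_pconst)
  qed
  have eq: "(D0, Dp, Dm) = (E0, Ep, Em)"
    unfolding F canonical_factorization_def
  proof (rule the_equality, rule can)
    fix G assume "is_canonical_factorization (Delta S) G"
    then show "G = (E0, Ep, Em)"
      using is_canonical_factorization_unique[OF _ can] by (cases G) auto
  qed
  then show "is_canonical_factorization (Delta S) (D0, Dp, Dm)" using can by simp
  show "pconst D0 * Dm = (hit_poly S)\<^sup>2" using eq pE by (simp add: h_def)
  have "Ep * s\<^sup>2 = (s * s')\<^sup>2" by (simp add: Ep_def power2_eq_square mult_ac)
  then show "Dp * (axis_poly S)\<^sup>2 = 1" using eq s' by (simp add: s_def)
qed

section \<open>Closed form\<close>

lemma right_nth_0: "D $ 0 = 1 \<Longrightarrow> right D $ 0 = 1"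
  by (simp add: right_def subst_var_def)

lemma fls_const_powi: "fls_const a powi i = fls_const (a powi i :: 'a::field)"
  by (simp add: power_int_def fls_const_power flip: fls_inverse_const)

lemma A_x_var: "A S k x_var = fls_const (A S k fls_X)"
  unfolding A_def x_var_def
  by (subst is_ring_hom_sum[OF is_ring_hom_fls_const], rule sum.cong[OF refl], rule fls_const_powi)

lemma Z_quot_eq:
  assumes k: "k \<in> {1, - 1}"
  shows "Z_quot S k = fps_to_fls (Wser S k)"
proof -
  note h = is_ring_homD[OF is_ring_hom_fps_to_fls] is_ring_hom_numeral[OF is_ring_hom_fps_to_fls]
  have t0: "t_var \<noteq> (0 :: real fls fls)" by (simp add: t_var_def)
  have Ac: "fps_to_fls (Ac S l) = A S l x_var" for l by (simp add: A_x_var)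
  have t: "fps_to_fls fps_X = (t_var :: real fls fls)" by (simp add: t_var_def)
  define W where "W = fps_to_fls (Wser S k :: real fls fps)"
  show ?thesis
  proof (cases "A S k (x_var :: real fls fls) = 0")
    case False
    have "fps_to_fls (2 * fps_X * Ac S k * Wser S k) = fps_to_fls (1 - fps_X * Ac S 0 - fps_sqrt (Delta S))"
      by (simp only: Wser_times_Ac[OF k] Delta_eq_Disc)
    then have "2 * t_var * A S k x_var * W = 1 - t_var * A S 0 x_var - fps_to_fls (fps_sqrt (Delta S))"
      by (simp only: h Ac t W_def)
    then have "Z S = A S k x_var * W"
      unfolding Z_def using t0 by (simp add: field_simps)
    then show ?thesis unfolding Z_quot_def using False by (simp add: W_def)
  next
    case True
    then have A0: "A S k (fls_X :: real fls) = 0" by (simp add: A_x_var)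
    \<comment> \<open>For \<open>A_k = 0\<close> the quadratic equation becomes linear, and its
      solution is the value that \<open>Z_quot\<close> prescribes in this case.\<close>
    have "Wser S k = fps_X * (Ac S (- k) + Ac S 0 * Wser S k + Ac S k * (Wser S k :: real fls fps)\<^sup>2)"
      by (rule Wser_quadratic[OF k])
    then have "Wser S k = fps_X * (Ac S (- k) + Ac S 0 * (Wser S k :: real fls fps))"
      by (simp only: A0 fps_const_0_eq_0 mult_zero_left add_0_right)
    then have "fps_to_fls (Wser S k :: real fls fps) = fps_to_fls (fps_X * (Ac S (- k) + Ac S 0 * Wser S k))"
      by (rule arg_cong)
    then have "W = t_var * (A S (- k) x_var + A S 0 x_var * W)"
      by (simp only: h Ac t W_def)
    then have W: "W * (1 - t_var * A S 0 x_var) = t_var * A S (- k) x_var"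
      by (simp add: algebra_simps)
    have "(1 - fps_X * Ac S 0 :: real fls fps) $ 0 \<noteq> 0" by simp
    then have "(1 - fps_X * Ac S 0 :: real fls fps) \<noteq> 0" by (metis fps_zero_nth)
    then have "fps_to_fls (1 - fps_X * Ac S 0 :: real fls fps) \<noteq> 0" by (simp only: fps_to_fls_eq_0_iff not_False_eq_True)
    then have "1 - t_var * A S 0 x_var \<noteq> (0 :: real fls fls)" by (simp only: h Ac t not_False_eq_True)
    then have "W = t_var * A S (- k) x_var / (1 - t_var * A S 0 x_var)"
      using W by (simp add: nonzero_eq_divide_eq)
    then show ?thesis unfolding Z_quot_def using True by (simp add: W_def)
  qed
qed

lemma slit_gf_closed_form:
  assumes fin: "finite S" and small: "\<forall>(i, j)\<in>S. \<bar>j\<bar> \<le> 1"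
    and F: "(D0, Dp, Dm) = canonical_factorization (Delta S)"
    and k: "k \<in> {1, - 1}"
  shows "fps_to_fls (slit_gf S (- k * int j)) =
      1 / fps_to_fls (fps_sqrt (subst_var fls_const fls_X Dp)) * Z_quot S k ^ j"
proof -
  note h = is_ring_homD[OF is_ring_hom_fps_to_fls]
  have "right (axis_poly S) * fps_sqrt (right Dp) = 1"
    by (rule hom_sqrt[OF is_ring_hom_right right_nth_0 canonical_factorization_Delta(2)[OF fin small F] axis_poly_0[OF fin small]])
  then have "fps_to_fls (slit_series S 0) * fps_to_fls (fps_sqrt (right Dp)) = 1"
    by (metis h(1,4) slit_series_0[OF fin small])
  then have "fps_to_fls (slit_series S 0) = 1 / fps_to_fls (fps_sqrt (right Dp))"
    by (metis eq_divide_eq_1 mult_zero_right nonzero_eq_divide_eq zero_neq_one)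
  then show ?thesis
    unfolding slit_gf_eq_slit_series slit_series_eq[OF fin small k] Z_quot_eq[OF k] right_def[symmetric]
    by (simp only: h fps_to_fls_power)
qed

section \<open>Degree bounds\<close>

definition coeff_ser :: "nat \<Rightarrow> 'a::zero poly fps \<Rightarrow> 'a fps" where
  "coeff_ser k D = Abs_fps (\<lambda>n. coeff (D $ n) k)"

text \<open>Uniformity in \<open>n\<close> is the point: only then is the series in \<open>t\<close>
  also a polynomial in \<open>x\<close> over series in \<open>t\<close>.\<close>

definition bounded_degree :: "nat \<Rightarrow> 'a::zero poly fps \<Rightarrow> bool" where
  "bounded_degree N D \<longleftrightarrow> (\<forall>n. degree (D $ n) \<le> N)"

lemma xser_nth_coeff_ser: "xser D $ k = fps_to_fls (coeff_ser k D)"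
  by (simp add: xser_nth coeff_ser_def)

lemma coeff_ser_mult: "coeff_ser k (D * E) = (\<Sum>i\<le>k. coeff_ser i D * coeff_ser (k - i) (E :: 'a::field poly fps))"
proof -
  have hom: "is_ring_hom (fps_to_fls :: 'a fps \<Rightarrow> _)" by (rule is_ring_hom_fps_to_fls)
  have "fps_to_fls (coeff_ser k (D * E)) = (xser D * xser E) $ k"
    by (simp only: xser_nth_coeff_ser[symmetric] is_ring_homD[OF is_ring_hom_xser])
  also have "\<dots> = fps_to_fls (\<Sum>i\<le>k. coeff_ser i D * coeff_ser (k - i) E)"
    by (simp add: fps_mult_nth xser_nth_coeff_ser is_ring_homD[OF hom] is_ring_hom_sum[OF hom] atMost_atLeast0)
  finally show ?thesis by simp
qed

lemma bounded_degreeI: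
  assumes "\<And>n i. i > N \<Longrightarrow> coeff (D $ n) i = 0" shows "bounded_degree N D"
  using assms by (auto simp: bounded_degree_def intro: degree_le)

lemma bounded_degree_coeff_ser: "bounded_degree N D \<Longrightarrow> k > N \<Longrightarrow> coeff_ser k D = 0"
  by (auto simp: bounded_degree_def coeff_ser_def fps_eq_iff intro!: coeff_eq_0 intro: le_less_trans)

text \<open>A ring homomorphism need not respect infinite sums; this finite expansion allows one to
  be evaluated on \<open>D\<close> through the coefficients in \<open>x\<close>.\<close>

lemma bounded_degree_eq_sum:
  fixes D :: "'a::comm_ring_1 poly fps"
  assumes "bounded_degree N D"
  shows "D = (\<Sum>k\<le>N. pconst (coeff_ser k D) * fps_const [:0, 1:] ^ k)"
proof (rule fps_ext)
  fix n
  have "(\<Sum>k\<le>N. pconst (coeff_ser k D) * fps_const [:0, 1:] ^ k) $ n = (\<Sum>k\<le>N. monom (coeff (D $ n) k) k)"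
    by (simp add: fps_sum_nth pconst_def coeff_ser_def fps_const_power monom_altdef)
  also have "\<dots> = D $ n"
    using assms by (intro poly_as_sum_of_monoms') (simp add: bounded_degree_def)
  finally show "D $ n = (\<Sum>k\<le>N. pconst (coeff_ser k D) * fps_const [:0, 1:] ^ k) $ n" ..
qed

lemma left_fps_X: "left fps_X = fps_X" and right_fps_X: "right fps_X = fps_X"
  by (auto simp: left_def right_def subst_var_def fps_eq_iff fps_X_def simp del: fls_inverse_X)

text \<open>\<open>upper M\<close> means that no exponent of \<open>x\<close> exceeds
  \<open>M\<close>, and \<open>lower M\<close> that none is below \<open>- M\<close>, uniformly in
  \<open>t\<close> and with Laurent polynomial coefficients. In factored form the bounds add up
  under multiplication.\<close>

definition upper :: "int \<Rightarrow> 'a::field fls fps \<Rightarrow> bool" where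
  "upper M F \<longleftrightarrow> (\<exists>D. F = xpow M * left D)"

definition lower :: "int \<Rightarrow> 'a::field fls fps \<Rightarrow> bool" where
  "lower M F \<longleftrightarrow> (\<exists>D. F = xpow (- M) * right D)"

lemma upper_mult: "upper M F \<Longrightarrow> upper N G \<Longrightarrow> upper (M + N) (F * G)"
proof -
  assume "upper M F" "upper N G"
  then obtain D E where "F = xpow M * left D" "G = xpow N * left E" by (auto simp: upper_def)
  then have "F * G = xpow (M + N) * left (D * E)"
    by (simp only: xpow_mult_xpow[symmetric] is_ring_homD[OF is_ring_hom_left] mult_ac)
  then show ?thesis by (auto simp: upper_def)
qed

lemma lower_mult: "lower M F \<Longrightarrow> lower N G \<Longrightarrow> lower (M + N) (F * G)"
proof -
  assume "lower M F" "lower N G"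
  then obtain D E where "F = xpow (- M) * right D" "G = xpow (- N) * right E" by (auto simp: lower_def)
  then have "F * G = xpow (- M + - N) * right (D * E)"
    by (simp only: xpow_mult_xpow[symmetric] is_ring_homD[OF is_ring_hom_right] mult_ac)
  then show ?thesis by (auto simp: lower_def)
qed

lemma xpow_eq_right: "i \<ge> 0 \<Longrightarrow> xpow i = right (fps_const [:0, 1:] ^ nat i :: 'a::field poly fps)"
  and xpow_eq_left: "i \<ge> 0 \<Longrightarrow> xpow (- i) = left (fps_const [:0, 1:] ^ nat i :: 'a poly fps)"
proof -
  have "xpow l ^ n = (xpow (l * int n) :: 'a fls fps)" for l n
    by (induction n) (auto simp: xpow_mult_xpow algebra_simps)
  note p = this
  show "i \<ge> 0 \<Longrightarrow> xpow i = right (fps_const [:0, 1:] ^ nat i :: 'a poly fps)"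
    using p[of 1 "nat i"] by (simp only: is_ring_hom_power[OF is_ring_hom_right] right_var) simp
  show "i \<ge> 0 \<Longrightarrow> xpow (- i) = left (fps_const [:0, 1:] ^ nat i :: 'a poly fps)"
    using p[of "-1" "nat i"] by (simp only: is_ring_hom_power[OF is_ring_hom_left] left_var) simp
qed

lemma upper_left: "upper 0 (left D)" and lower_right: "lower 0 (right D)"
  by (auto simp: upper_def lower_def)

lemma upper_mono: "upper M (F :: 'a::field fls fps) \<Longrightarrow> M \<le> N \<Longrightarrow> upper N F"
  and lower_mono: "lower M F \<Longrightarrow> M \<le> N \<Longrightarrow> lower N F"
proof -
  have 1: "upper (N - M) (1 :: 'a fls fps)" "lower (N - M) (1 :: 'a fls fps)" if "M \<le> N"
  proof -
    have "1 = xpow (N - M) * left (fps_const [:0, 1:] ^ nat (N - M) :: 'a poly fps)"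
      using that by (simp only: xpow_eq_left[symmetric] xpow_mult_xpow) simp
    then show "upper (N - M) (1 :: 'a fls fps)" unfolding upper_def by blast
    have "1 = xpow (- (N - M)) * right (fps_const [:0, 1:] ^ nat (N - M) :: 'a poly fps)"
      using that by (simp only: xpow_eq_right[symmetric] xpow_mult_xpow) simp
    then show "lower (N - M) (1 :: 'a fls fps)" unfolding lower_def by blast
  qed
  show "upper M F \<Longrightarrow> M \<le> N \<Longrightarrow> upper N F" using upper_mult[OF _ 1(1), of M F] by simp
  show "lower M F \<Longrightarrow> M \<le> N \<Longrightarrow> lower N F" using lower_mult[OF _ 1(2), of M F] by simp
qed

lemma upper_add: "upper M F \<Longrightarrow> upper M G \<Longrightarrow> upper M (F + G)"
  and upper_diff: "upper M F \<Longrightarrow> upper M G \<Longrightarrow> upper M (F - G)"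
  unfolding upper_def
  by (metis distrib_left is_ring_homD(3)[OF is_ring_hom_left])
     (metis right_diff_distrib is_ring_homD(6)[OF is_ring_hom_left])

lemma lower_add: "lower M F \<Longrightarrow> lower M G \<Longrightarrow> lower M (F + G)"
  and lower_diff: "lower M F \<Longrightarrow> lower M G \<Longrightarrow> lower M (F - G)"
  unfolding lower_def
  by (metis distrib_left is_ring_homD(3)[OF is_ring_hom_right])
     (metis right_diff_distrib is_ring_homD(6)[OF is_ring_hom_right])

lemma Ac_eq_sum: "Ac S k = (\<Sum>i | (i, k) \<in> S. xpow i)"
  by (simp add: A_def xpow_def is_ring_hom_sum[OF is_ring_hom_fps_const])

lemma upper_xpow: "i \<le> M \<Longrightarrow> upper M (xpow i :: 'a::field fls fps)"
  and lower_xpow: "- i \<le> M \<Longrightarrow> lower M (xpow i :: 'a fls fps)"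
proof -
  have "xpow i = xpow i * left (1 :: 'a poly fps)" "xpow i = xpow (- (- i)) * right (1 :: 'a poly fps)"
    by (simp_all add: is_ring_homD[OF is_ring_hom_left] is_ring_homD[OF is_ring_hom_right])
  then have "upper i (xpow i :: 'a fls fps)" "lower (- i) (xpow i :: 'a fls fps)"
    unfolding upper_def lower_def by blast+
  then show "i \<le> M \<Longrightarrow> upper M (xpow i :: 'a fls fps)" "- i \<le> M \<Longrightarrow> lower M (xpow i :: 'a fls fps)"
    by (blast intro: upper_mono lower_mono)+
qed

lemma upper_0: "upper M 0" and lower_0: "lower M 0"
  unfolding upper_def lower_def
  by (rule exI[of _ 0], simp add: is_ring_homD[OF is_ring_hom_left] is_ring_homD[OF is_ring_hom_right])+

lemma upper_Ac:
  assumes "\<And>i. (i, k) \<in> S \<Longrightarrow> \<bar>i\<bar> \<le> M"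
  shows "upper M (Ac S k :: 'a::field fls fps)" and "lower M (Ac S k :: 'a fls fps)"
proof -
  have *: "(\<And>i. i \<in> B \<Longrightarrow> \<bar>i\<bar> \<le> M) \<Longrightarrow> upper M (\<Sum>i\<in>B. xpow i :: 'a fls fps) \<and> lower M (\<Sum>i\<in>B. xpow i :: 'a fls fps)" for B
  proof (induction B rule: infinite_finite_induct)
    case (insert i B)
    then have "- i \<le> M" "i \<le> M" by (auto simp: abs_le_iff)
    with insert show ?case
      by (auto intro: upper_add lower_add upper_xpow lower_xpow)
  qed (auto intro: upper_0 lower_0)
  show "upper M (Ac S k :: 'a fls fps)" and "lower M (Ac S k :: 'a fls fps)"
    using *[of "{i. (i, k) \<in> S}"] assms unfolding Ac_eq_sum by simp_all
qed

lemma step_bound: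
  assumes "finite (S :: (int \<times> int) set)"
  obtains M where "M \<ge> 0" "\<And>i k. (i, k) \<in> S \<Longrightarrow> \<bar>i\<bar> \<le> M"
proof -
  let ?M = "\<Sum>s\<in>S. \<bar>fst s\<bar>"
  have "\<bar>i\<bar> \<le> ?M" if "(i, k) \<in> S" for i k
    using member_le_sum[OF that, of "\<lambda>s. \<bar>fst s\<bar>"] assms by auto
  then show ?thesis by (intro that[of ?M]) (auto intro: sum_nonneg)
qed

lemma upper_fps_X: "upper 0 (fps_X :: 'a::field fls fps)" "lower 0 (fps_X :: 'a fls fps)"
  by (metis left_fps_X upper_left, metis right_fps_X lower_right)

lemma upper_kernel:
  fixes S M assumes M: "M \<ge> 0" "\<And>i k. (i, k) \<in> S \<Longrightarrow> \<bar>i\<bar> \<le> M"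
  shows "upper M (1 - fps_X * Ac S 0 :: 'a::field fls fps)" "lower M (1 - fps_X * Ac S 0 :: 'a fls fps)"
proof -
  have "upper M (1 :: 'a fls fps)" "lower M (1 :: 'a fls fps)"
    using upper_xpow[of 0 M] lower_xpow[of 0 M] M(1) by simp_all
  moreover have "upper M (Ac S 0 :: 'a fls fps)" "lower M (Ac S 0 :: 'a fls fps)"
    by (rule upper_Ac, erule M(2))+
  ultimately show "upper M (1 - fps_X * Ac S 0 :: 'a fls fps)" "lower M (1 - fps_X * Ac S 0 :: 'a fls fps)"
    using upper_mult[OF upper_fps_X(1), of M "Ac S 0"] lower_mult[OF upper_fps_X(2), of M "Ac S 0"]
    by (auto intro: upper_diff lower_diff)
qed

lemma upper_Disc:
  fixes S M assumes M: "M \<ge> 0" "\<And>i k. (i, k) \<in> S \<Longrightarrow> \<bar>i\<bar> \<le> M"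
  shows "upper (2 * M) (Disc S :: 'a::field_char_0 fls fps)" "lower (2 * M) (Disc S :: 'a fls fps)"
proof -
  note x = upper_fps_X
  have a: "upper M (Ac S k :: 'a fls fps)" "lower M (Ac S k :: 'a fls fps)" for k
    by (rule upper_Ac, erule M(2))+
  have u: "upper M (1 - fps_X * Ac S 0 :: 'a fls fps)" "lower M (1 - fps_X * Ac S 0 :: 'a fls fps)"
    by (rule upper_kernel[OF M(1)], erule M(2))+
  have 4: "upper 0 (4 :: 'a fls fps)" "lower 0 (4 :: 'a fls fps)"
    by (metis is_ring_hom_numeral[OF is_ring_hom_left] upper_left)
       (metis is_ring_hom_numeral[OF is_ring_hom_right] lower_right)
  have "upper (2 * M) (4 * fps_X\<^sup>2 * Ac S 1 * Ac S (- 1) :: 'a fls fps)"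
    using upper_mult[OF upper_mult[OF upper_mult[OF 4(1) upper_mult[OF x(1) x(1)]] a(1)] a(1)]
    by (simp add: power2_eq_square)
  moreover have "upper (2 * M) ((1 - fps_X * Ac S 0)\<^sup>2 :: 'a fls fps)"
    using upper_mult[OF u(1) u(1)] by (simp add: power2_eq_square)
  ultimately show "upper (2 * M) (Disc S :: 'a fls fps)" unfolding Disc_def by (rule upper_diff[rotated])
  have "lower (2 * M) (4 * fps_X\<^sup>2 * Ac S 1 * Ac S (- 1) :: 'a fls fps)"
    using lower_mult[OF lower_mult[OF lower_mult[OF 4(2) lower_mult[OF x(2) x(2)]] a(2)] a(2)]
    by (simp add: power2_eq_square)
  moreover have "lower (2 * M) ((1 - fps_X * Ac S 0)\<^sup>2 :: 'a fls fps)"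
    using lower_mult[OF u(2) u(2)] by (simp add: power2_eq_square)
  ultimately show "lower (2 * M) (Disc S :: 'a fls fps)" unfolding Disc_def by (rule lower_diff[rotated])
qed

lemma upper_right_bounded_degree:
  assumes "upper M (right D)" "M \<ge> 0"
  shows "bounded_degree (nat M) D"
proof (rule bounded_degreeI)
  fix n i assume i: "i > nat M"
  from assms obtain E where "right D = xpow M * left E" by (auto simp: upper_def)
  then have "(right D $ n) $$ int i = ((xpow M * left E) $ n) $$ int i" by simp
  then show "coeff (D $ n) i = 0" using i assms(2) by (simp add: right_nth xpow_mult_nth left_nth)
qed

lemma lower_left_bounded_degree:
  assumes "lower M (left D)" "M \<ge> 0"
  shows "bounded_degree (nat M) D"
proof (rule bounded_degreeI)
  fix n i assume i: "i > nat M"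
  from assms obtain E where "left D = xpow (- M) * right E" by (auto simp: lower_def)
  then have "(left D $ n) $$ (- int i) = ((xpow (- M) * right E) $ n) $$ (- int i)" by simp
  then show "coeff (D $ n) i = 0" using i assms(2) by (simp add: right_nth xpow_mult_nth left_nth)
qed

text \<open>\<open>right P\<close> is \<open>F\<close> times the inverse of \<open>left Q\<close>,
  which has no positive exponents, so the upper bound on the exponents of \<open>F\<close> passes to
  \<open>P\<close>. The lower bound passes to \<open>Q\<close> symmetrically.\<close>

lemma right_left_factor_bounded_degree:
  assumes "F = right P * left Q" "P $ 0 = 1" "Q $ 0 = 1" "upper M F" "lower M F" "M \<ge> 0"
  shows "bounded_degree (nat M) P" "bounded_degree (nat M) Q"
proof -
  note r = is_ring_homD[OF is_ring_hom_right] and l = is_ring_homD[OF is_ring_hom_left]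
  obtain p q where p: "P * p = 1" and q: "Q * q = 1"
    using fps_unit_inverse_exists assms(2,3) by metis
  have "F * left q = right P * left (Q * q)" by (simp only: assms(1) l mult_ac)
  then have "right P = F * left q" by (simp add: q l)
  then have "upper (M + 0) (right P)" by (simp only: upper_mult[OF assms(4) upper_left])
  then show "bounded_degree (nat M) P" using assms(6) by (intro upper_right_bounded_degree) simp_all
  have "F * right p = right (P * p) * left Q" by (simp only: assms(1) r mult_ac)
  then have "left Q = F * right p" by (simp add: p r)
  then have "lower (M + 0) (left Q)" by (simp only: lower_mult[OF assms(5) lower_right])
  then show "bounded_degree (nat M) Q" using assms(6) by (intro lower_left_bounded_degree) simp_all
qed

section \<open>Algebraicity of the canonical factors\<close>

lemma coeff_ser_add: "coeff_ser k (D + E) = coeff_ser k D + coeff_ser k (E :: 'a::comm_ring_1 poly fps)"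
  and coeff_ser_diff: "coeff_ser k (D - E) = coeff_ser k D - coeff_ser k E"
  by (simp_all add: coeff_ser_def fps_eq_iff)

lemma coeff_ser_var: "coeff_ser k (fps_const [:0, 1:]) = (if k = 1 then 1 else 0)"
  and coeff_ser_fps_X: "coeff_ser k (fps_X :: 'a::field poly fps) = (if k = 0 then fps_X else 0)"
  and coeff_ser_1: "coeff_ser k (1 :: 'a poly fps) = (if k = 0 then 1 else 0)"
  by (auto simp: coeff_ser_def fps_eq_iff fps_X_def coeff_pCons coeff_1 split: nat.splits)

lemma coeff_ser_pconst: "coeff_ser k (pconst c) = (if k = 0 then c else 0)"
  by (auto simp: coeff_ser_def fps_eq_iff pconst_def coeff_pCons split: nat.splits)

lemma bounded_degree_pconst: "bounded_degree 0 (pconst c)"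
  by (simp add: bounded_degree_def pconst_def)

lemma bounded_degree_mult:
  fixes D E :: "'a::comm_ring_1 poly fps"
  assumes "bounded_degree M D" "bounded_degree N E"
  shows "bounded_degree (M + N) (D * E)"
  unfolding bounded_degree_def fps_mult_nth
proof (intro allI degree_sum_le)
  fix n i :: nat assume "i \<in> {0..n}"
  show "degree (D $ i * E $ (n - i)) \<le> M + N"
    using degree_mult_le[of "D $ i" "E $ (n - i)"] assms
    by (meson add_mono bounded_degree_def le_trans)
qed simp

text \<open>The coefficient field is reached through a homomorphism because algebraicity is needed
  both in \<open>real fls fls\<close> and in \<open>complex fls\<close>. The value is meaningful for
  series of bounded degree.\<close>

definition xpoly :: "('a::field fps \<Rightarrow> 'b::field) \<Rightarrow> 'a poly fps \<Rightarrow> 'b poly" where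
  "xpoly \<phi> D = Abs_poly (\<lambda>k. \<phi> (coeff_ser k D))"

definition coeff_ser_over :: "('a::field fps \<Rightarrow> 'b::field) \<Rightarrow> 'b set \<Rightarrow> 'a poly fps \<Rightarrow> bool" where
  "coeff_ser_over \<phi> K D \<longleftrightarrow> (\<forall>k. \<phi> (coeff_ser k D) \<in> K)"

context
  fixes \<phi> :: "'a::field fps \<Rightarrow> 'b::field"
  assumes hom: "is_ring_hom \<phi>"
begin

lemma coeff_xpoly:
  assumes "bounded_degree N D"
  shows "coeff (xpoly \<phi> D) k = \<phi> (coeff_ser k D)"
  unfolding xpoly_def
proof (rule coeff_Abs_poly)
  have "{k. \<phi> (coeff_ser k D) \<noteq> 0} \<subseteq> {..N}"
    using bounded_degree_coeff_ser[OF assms] by (auto simp: is_ring_homD[OF hom] simp flip: not_less)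
  then show "finite {k. \<phi> (coeff_ser k D) \<noteq> 0}" using finite_subset by blast
qed

lemma xpoly_mult:
  assumes "bounded_degree M D" "bounded_degree N E"
  shows "xpoly \<phi> (D * E) = xpoly \<phi> D * xpoly \<phi> E"
  by (rule poly_eqI)
     (simp add: coeff_mult coeff_xpoly[OF assms(1)] coeff_xpoly[OF assms(2)]
       coeff_xpoly[OF bounded_degree_mult[OF assms]] coeff_ser_mult is_ring_homD[OF hom] is_ring_hom_sum[OF hom])

context
  fixes K :: "'b set" assumes K: "is_subfield K"
begin

lemma coeff_ser_over_intros:
  "coeff_ser_over \<phi> K 1" "coeff_ser_over \<phi> K (fps_const [:0, 1:])" "\<phi> fps_X \<in> K \<Longrightarrow> coeff_ser_over \<phi> K fps_X"
  "coeff_ser_over \<phi> K D \<Longrightarrow> coeff_ser_over \<phi> K E \<Longrightarrow> coeff_ser_over \<phi> K (D + E)"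
  "coeff_ser_over \<phi> K D \<Longrightarrow> coeff_ser_over \<phi> K E \<Longrightarrow> coeff_ser_over \<phi> K (D - E)"
  "coeff_ser_over \<phi> K D \<Longrightarrow> coeff_ser_over \<phi> K E \<Longrightarrow> coeff_ser_over \<phi> K (D * E)"
  by (auto simp: coeff_ser_over_def coeff_ser_add coeff_ser_diff coeff_ser_1 coeff_ser_var coeff_ser_fps_X coeff_ser_mult
      is_ring_homD[OF hom] is_ring_hom_sum[OF hom] is_subfieldD[OF K] intro!: is_subfield_sum[OF K])

lemma coeff_ser_over_power: "coeff_ser_over \<phi> K D \<Longrightarrow> coeff_ser_over \<phi> K (D ^ n)"
  by (induction n) (auto intro: coeff_ser_over_intros)

lemma coeff_ser_over_0: "coeff_ser_over \<phi> K 0"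
  using coeff_ser_over_intros(5)[OF coeff_ser_over_intros(1,1)] by simp

lemma coeff_ser_over_sum: "(\<And>b. b \<in> B \<Longrightarrow> coeff_ser_over \<phi> K (D b)) \<Longrightarrow> coeff_ser_over \<phi> K (sum D B)"
  by (induction B rule: infinite_finite_induct) (auto intro: coeff_ser_over_intros coeff_ser_over_0)

lemma coeff_ser_over_4: "coeff_ser_over \<phi> K 4"
proof -
  have "coeff_ser_over \<phi> K (1 + 1 + (1 + 1))" by (intro coeff_ser_over_intros)
  then show ?thesis by simp
qed

end

end

text \<open>Dividing Delta by \<open>Delta_0\<close>, which is free of \<open>x\<close>, leaves
  \<open>Delta_+ Delta_-\<close>. The bound is \<open>2 * M\<close> because Delta is quadratic in
  the \<open>A_j\<close>.\<close>

lemma canonical_factor_degree: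
  assumes fin: "finite S" and small: "\<forall>(i, j)\<in>S. \<bar>j\<bar> \<le> 1"
    and F: "(D0, Dp, Dm) = canonical_factorization (Delta S)"
    and M: "M \<ge> 0" "\<And>i k. (i, k) \<in> S \<Longrightarrow> \<bar>i\<bar> \<le> M"
  shows "bounded_degree (nat (2 * M)) Dp" "bounded_degree (nat (2 * M)) Dm" "lower (2 * M) (left Dm)"
proof -
  note r = is_ring_homD[OF is_ring_hom_right] and l = is_ring_homD[OF is_ring_hom_left]
    and c = is_ring_homD[OF is_ring_hom_pconst]
  note can = canonical_factorization_Delta(1)[OF fin small F, unfolded is_canonical_factorization_iff Delta_eq_Disc]
  obtain i0 where i0: "D0 * i0 = 1" using fps_unit_inverse_exists can by metis
  let ?F = "Disc S * left (pconst i0)"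
  have "?F = right Dp * left (pconst (D0 * i0) * Dm)"
    by (simp only: conjunct1[OF can] l c mult_ac)
  then have eq: "?F = right Dp * left Dm" by (simp add: i0 c)
  have u: "upper (2 * M) ?F" using upper_mult[OF upper_Disc(1)[OF M] upper_left] by simp
  have lo: "lower (2 * M) ?F"
    using lower_mult[OF upper_Disc(2)[OF M] lower_right[of "pconst i0"]]
    by (simp add: right_pconst left_pconst)
  show "bounded_degree (nat (2 * M)) Dp" "bounded_degree (nat (2 * M)) Dm"
    using right_left_factor_bounded_degree[OF eq _ _ u lo] can M(1) by auto
  obtain p where p: "Dp * p = 1" using fps_unit_inverse_exists can by metis
  have "?F * right p = right (Dp * p) * left Dm" unfolding eq by (simp only: r mult_ac)
  then have "left Dm = ?F * right p" by (simp add: p r)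
  then show "lower (2 * M) (left Dm)" using lower_mult[OF lo lower_right] by simp
qed

lemma algebraic_over_canonical_factors:
  fixes \<phi> :: "real fps \<Rightarrow> 'b::field"
  assumes fin: "finite S" and small: "\<forall>(i, j)\<in>S. \<bar>j\<bar> \<le> 1"
    and F: "(D0, Dp, Dm) = canonical_factorization (Delta S)"
    and hom: "is_ring_hom \<phi>"
  shows "algebraic_over (generated_field {\<phi> fps_X}) (\<phi> (coeff_ser k Dp))"
    and "algebraic_over (generated_field {\<phi> fps_X}) (\<phi> (coeff_ser k Dm))"
    and "algebraic_over (generated_field {\<phi> fps_X}) (\<phi> D0)"
proof -
  note r = is_ring_homD[OF is_ring_hom_right] and l = is_ring_homD[OF is_ring_hom_left]
    and c = is_ring_homD[OF is_ring_hom_pconst] and f = is_ring_homD[OF hom]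
  note can = canonical_factorization_Delta(1)[OF fin small F, unfolded is_canonical_factorization_iff Delta_eq_Disc]
  obtain M where M: "M \<ge> 0" "\<And>i k. (i, k) \<in> S \<Longrightarrow> \<bar>i\<bar> \<le> M" using step_bound[OF fin] by metis
  define N where "N = nat (2 * M)"
  define K where "K = generated_field {\<phi> fps_X}"
  have K: "is_subfield K" unfolding K_def by (rule is_subfield_generated_field)
  have tK: "\<phi> fps_X \<in> K" unfolding K_def by (auto intro: generated_field.incl)
  have bd: "bounded_degree (nat (2 * M)) Dp" "bounded_degree (nat (2 * M)) Dm" "lower (2 * M) (left Dm)"
    by (rule canonical_factor_degree[OF fin small F M(1)], erule M(2))+
  \<comment> \<open>\<open>Rm\<close> is the reversal \<open>x^(2M) Delta_-\<close>, a polynomial in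
    \<open>x\<close>; the constant term 1 of \<open>Delta_-\<close> becomes its coefficient at
    \<open>N\<close>.\<close>
  obtain Rm where Rm: "left Dm = xpow (- (2 * M)) * right Rm" using bd(3) by (auto simp: lower_def)
  have Rm': "xpow (2 * M) * left Dm = right Rm"
    unfolding Rm mult.assoc[symmetric] xpow_mult_xpow by simp
  have cRm: "coeff (Rm $ n) k = (if k \<le> N then coeff (Dm $ n) (N - k) else 0)" for n k
  proof -
    have "(right Rm $ n) $$ int k = ((xpow (2 * M) * left Dm) $ n) $$ int k" by (simp only: Rm')
    then show ?thesis using M(1) by (auto simp: right_nth xpow_mult_nth left_nth N_def nat_diff_distrib)
  qed
  have bRm: "bounded_degree N Rm" by (rule bounded_degreeI) (simp add: cRm)
  have xRm: "coeff_ser k Rm = coeff_ser (N - k) Dm" if "k \<le> N" for k using that by (simp add: coeff_ser_def cRm)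
  have ev0: "coeff_ser 0 D = ev0 D" for D :: "real poly fps" by (simp add: coeff_ser_def fps_eq_iff ev0_nth)
  define v where "v = (fps_const [:0, 1:] :: real poly fps)"
  define b where "b k = (\<Sum>i | (i, k) \<in> S. v ^ nat (M + i))" for k
  \<comment> \<open>\<open>b k\<close> is \<open>x^M A_k\<close>, so \<open>P\<close> is
    \<open>x^(2M) Delta\<close> written with polynomials only; its coefficients visibly lie in the
    field generated by \<open>t\<close>.\<close>
  define P where "P = (v ^ nat M - fps_X * b 0)\<^sup>2 - 4 * fps_X\<^sup>2 * b 1 * b (- 1)"
  have rb: "right (b k) = xpow M * Ac S k" for k
  proof -
    have "right (b k) = (\<Sum>i | (i, k) \<in> S. right (v ^ nat (M + i)))"
      unfolding b_def by (rule is_ring_hom_sum[OF is_ring_hom_right])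
    also have "\<dots> = (\<Sum>i | (i, k) \<in> S. xpow M * xpow i)"
    proof (rule sum.cong[OF refl])
      fix i assume "i \<in> {i. (i, k) \<in> S}"
      then have "\<bar>i\<bar> \<le> M" using M(2) by blast
      then have "M + i \<ge> 0" by arith
      then show "right (v ^ nat (M + i)) = xpow M * xpow i"
        unfolding v_def xpow_mult_xpow by (rule xpow_eq_right[symmetric])
    qed
    finally show ?thesis by (simp add: Ac_eq_sum sum_distrib_left)
  qed
  have rv: "right (v ^ nat M) = xpow M" unfolding v_def by (rule xpow_eq_right[OF M(1), symmetric])
  have "right P = (xpow M - fps_X * (xpow M * Ac S 0))\<^sup>2 - 4 * fps_X\<^sup>2 * (xpow M * Ac S 1) * (xpow M * Ac S (- 1))"
    unfolding P_def
    by (simp only: power2_eq_square r rb rv right_fps_X is_ring_hom_numeral[OF is_ring_hom_right])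
  also have "\<dots> = (xpow M * xpow M) * Disc S"
  proof -
    have "(w - t * (w * a))\<^sup>2 - 4 * t\<^sup>2 * (w * p) * (w * q) = w * w * ((1 - t * a)\<^sup>2 - 4 * t\<^sup>2 * p * q)"
      for w t a p q :: "real fls fps" by (simp add: power2_eq_square algebra_simps)
    then show ?thesis unfolding Disc_def .
  qed
  also have "\<dots> = right Dp * (xpow (2 * M) * left Dm) * left (pconst D0)"
    unfolding conjunct1[OF can] l xpow_mult_xpow by (simp add: mult_ac mult_2)
  also have "\<dots> = right (Dp * Rm * pconst D0)"
    unfolding Rm' r right_pconst left_pconst ..
  finally have P: "P = Dp * Rm * pconst D0" by (simp only: right_inject)
  have "coeff_ser_over \<phi> K P"
    unfolding P_def b_def v_def power2_eq_square
    by (intro coeff_ser_over_intros[OF hom K] coeff_ser_over_power[OF hom K] coeff_ser_over_sum[OF hom K] coeff_ser_over_4[OF hom K] tK)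
  moreover have bP: "bounded_degree (N + N + 0) P"
    unfolding P N_def
    by (intro bounded_degree_mult bd bRm[unfolded N_def] bounded_degree_pconst)
  ultimately have PK: "coeff (xpoly \<phi> P) k \<in> K" for k
    by (simp add: coeff_xpoly[OF hom bP] coeff_ser_over_def)
  have P3: "xpoly \<phi> P = xpoly \<phi> Dp * xpoly \<phi> Rm * xpoly \<phi> (pconst D0)"
    unfolding P xpoly_mult[OF hom bounded_degree_mult[OF bd(1)[folded N_def] bRm] bounded_degree_pconst]
      xpoly_mult[OF hom bd(1)[folded N_def] bRm] ..
  have x1: "coeff (xpoly \<phi> Dp) 0 = 1"
    using can by (simp add: coeff_xpoly[OF hom bd(1)] ev0 f)
  have x2: "coeff (xpoly \<phi> Rm) N = 1"
    using can by (simp add: coeff_xpoly[OF hom bRm] xRm ev0 f)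
  have x3: "xpoly \<phi> (pconst D0) = [:\<phi> D0:]"
    by (rule poly_eqI) (auto simp: coeff_xpoly[OF hom bounded_degree_pconst] coeff_ser_pconst f coeff_pCons split: nat.splits)
  obtain i0 where i0: "D0 * i0 = 1" using fps_unit_inverse_exists can by metis
  have "\<phi> D0 * \<phi> i0 = 1" using arg_cong[OF i0, of \<phi>] by (simp add: f)
  then have D0: "\<phi> D0 \<noteq> 0" by auto
  have nz: "xpoly \<phi> P \<noteq> 0"
    unfolding P3 x3 using x1 x2 D0 by auto
  have aDp: "algebraic_over K (\<phi> (coeff_ser k Dp))" for k
  proof -
    have eq: "xpoly \<phi> P = xpoly \<phi> Dp * (xpoly \<phi> Rm * xpoly \<phi> (pconst D0))" by (simp only: P3 mult_ac)
    have "algebraic_over K (coeff (xpoly \<phi> Dp) k)"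
      by (rule algebraic_over_coeff_factor[OF K _ _ x1]) (use eq PK nz in auto)
    then show ?thesis by (simp add: coeff_xpoly[OF hom bd(1)])
  qed
  have aRm: "algebraic_over K (\<phi> (coeff_ser k Rm))" for k
  proof -
    have eq: "xpoly \<phi> P = xpoly \<phi> Rm * (xpoly \<phi> Dp * xpoly \<phi> (pconst D0))" by (simp only: P3 mult_ac)
    have "algebraic_over K (coeff (xpoly \<phi> Rm) k)"
      by (rule algebraic_over_coeff_factor[OF K _ _ x2]) (use eq PK nz in auto)
    then show ?thesis by (simp add: coeff_xpoly[OF hom bRm])
  qed
  have aDm: "algebraic_over K (\<phi> (coeff_ser k Dm))" for k
  proof (cases "k \<le> N")
    case True
    then show ?thesis using aRm[of "N - k"] xRm[of "N - k"] by simp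
  next
    case False
    then have "coeff_ser k Dm = 0" using bounded_degree_coeff_ser[OF bd(2)] by (simp add: N_def)
    then show ?thesis using algebraic_over_self[OF K is_subfieldD(2)[OF K]] by (simp add: f)
  qed
  \<comment> \<open>\<open>Delta_0\<close> is the ratio of a coefficient of \<open>P\<close> to the
    corresponding coefficient of \<open>Delta_+ Rm\<close>; the top one is nonzero.\<close>
  have "algebraic_over K (\<phi> D0)"
  proof -
    let ?B = "{y. algebraic_over K y}"
    have B: "is_subfield ?B" by (rule is_subfield_algebraic_over[OF K])
    let ?Q = "xpoly \<phi> Dp * xpoly \<phi> Rm"
    have "?Q \<noteq> 0" using x1 x2 by auto
    then have q: "coeff ?Q (degree ?Q) \<noteq> 0" by simp
    have "coeff ?Q i \<in> ?B" for i
      using aDp aRm by (intro is_subfield_coeff_mult[OF B]) (simp_all add: coeff_xpoly[OF hom bd(1)] coeff_xpoly[OF hom bRm])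
    moreover have "coeff (xpoly \<phi> P) i \<in> ?B" for i using PK algebraic_over_self[OF K] by blast
    moreover have "coeff (xpoly \<phi> P) i = coeff ?Q i * \<phi> D0" for i unfolding P3 x3 by simp
    then have "\<phi> D0 = coeff (xpoly \<phi> P) (degree ?Q) / coeff ?Q (degree ?Q)" using q by simp
    ultimately have "\<phi> D0 \<in> ?B" using is_subfieldD(8)[OF B] by metis
    then show ?thesis by simp
  qed
  then show "algebraic_over (generated_field {\<phi> fps_X}) (\<phi> D0)" by (simp add: K_def)
  show "algebraic_over (generated_field {\<phi> fps_X}) (\<phi> (coeff_ser k Dp))"
    "algebraic_over (generated_field {\<phi> fps_X}) (\<phi> (coeff_ser k Dm))"
    using aDp aDm by (simp_all add: K_def)
qed

section \<open>Algebraicity of the slit plane series\<close>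

lemma fps_to_fls_sqrt_square:
  fixes f :: "'a::field_char_0 fps"
  assumes "f $ 0 = 1" shows "(fps_to_fls (fps_sqrt f))\<^sup>2 = fps_to_fls f"
  using fps_sqrt_square(1)[OF assms] by (metis fps_to_fls_power)

text \<open>The closed form needs only two square roots: that of \<open>Delta_+\<close>, a
  polynomial in \<open>x\<close> with coefficients algebraic over the field generated by
  \<open>t\<close>, and that of Delta, which lies in the base field.\<close>

lemma algebraic_slit_gf:
  assumes fin: "finite S" and small: "\<forall>(i, j)\<in>S. \<bar>j\<bar> \<le> 1"
    and F: "(D0, Dp, Dm) = canonical_factorization (Delta S)"
  shows "algebraic_over (generated_field {x_var, t_var}) (fps_to_fls (slit_gf S j))"
proof -
  define K where "K = generated_field {x_var, t_var :: real fls fls}"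
  define B where "B = {y. algebraic_over K y}"
  have K: "is_subfield K" unfolding K_def by (rule is_subfield_generated_field)
  have xt: "x_var \<in> K" "t_var \<in> K" unfolding K_def by (auto intro: generated_field.incl)
  have B: "is_subfield B" unfolding B_def by (rule is_subfield_algebraic_over[OF K])
  have KB: "y \<in> K \<Longrightarrow> y \<in> B" for y unfolding B_def using algebraic_over_self[OF K] by blast
  have sqrtB: "y \<in> B" if "y\<^sup>2 \<in> B" for y
    using that algebraic_over_sqrt[OF K] by (simp add: B_def)
  note h = is_ring_homD[OF is_ring_hom_fps_to_fls]
  have can: "Dp $ 0 = 1"
    using canonical_factorization_Delta(1)[OF fin small F] by (simp add: is_canonical_factorization_iff)
  define \<phi> where "\<phi> f = fps_to_fls (map_coeffs fls_const f :: real fls fps)" for f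
  have hom: "is_ring_hom \<phi>"
    unfolding \<phi>_def
    by (intro is_ring_hom_comp[OF is_ring_hom_fps_to_fls] is_ring_hom_map_coeffs is_ring_hom_fls_const)
  have "map_coeffs fls_const (fps_X :: real fps) = fps_X" by (auto simp: fps_eq_iff fps_X_def)
  then have \<phi>X: "\<phi> fps_X = t_var" by (simp add: \<phi>_def t_var_def)
  have "generated_field {\<phi> fps_X} \<subseteq> K"
    unfolding \<phi>X K_def by (rule generated_field_mono) auto
  then have coef: "\<phi> (coeff_ser k Dp) \<in> B" for k
    using algebraic_over_canonical_factors(1)[OF fin small F hom, of k] algebraic_over_mono
    by (auto simp: B_def)
  obtain M where M: "M \<ge> 0" "\<And>i k. (i, k) \<in> S \<Longrightarrow> \<bar>i\<bar> \<le> M" using step_bound[OF fin] by metis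
  have "bounded_degree (nat (2 * M)) Dp"
    by (rule canonical_factor_degree[OF fin small F M(1)], erule M(2))
  then have "right Dp = right (\<Sum>k\<le>nat (2 * M). pconst (coeff_ser k Dp) * fps_const [:0, 1:] ^ k)"
    using bounded_degree_eq_sum by metis
  also have "\<dots> = (\<Sum>k\<le>nat (2 * M). map_coeffs fls_const (coeff_ser k Dp) * xpow 1 ^ k)"
    by (simp only: is_ring_hom_sum[OF is_ring_hom_right] is_ring_homD[OF is_ring_hom_right]
        is_ring_hom_power[OF is_ring_hom_right] right_pconst right_var)
  finally have "fps_to_fls (right Dp) = (\<Sum>k\<le>nat (2 * M). \<phi> (coeff_ser k Dp) * fps_to_fls (xpow 1) ^ k)"
    by (simp only: is_ring_hom_sum[OF is_ring_hom_fps_to_fls] h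
        is_ring_hom_power[OF is_ring_hom_fps_to_fls] \<phi>_def)
  moreover have "fps_to_fls (xpow 1) = x_var"
    by (simp add: x_var_def xpow_def fls_X_conv_shift_1)
  ultimately have "fps_to_fls (right Dp) \<in> B"
    using coef KB[OF xt(1)] by (auto intro!: is_subfield_sum[OF B] is_subfieldD[OF B] is_subfield_power[OF B])
  then have sB: "fps_to_fls (fps_sqrt (right Dp)) \<in> B"
    by (intro sqrtB[of "fps_to_fls (fps_sqrt (right Dp))"]) (simp add: fps_to_fls_sqrt_square right_nth_0 can)
  have AK: "A S k x_var \<in> K" for k
    unfolding A_def by (intro is_subfield_sum[OF K] is_subfield_powi[OF K] xt)
  have 2: "2 \<in> K" "4 \<in> K" using is_subfield_numeral[OF K] by blast+
  have Ac: "fps_to_fls (Ac S k) = A S k x_var" for k by (simp add: A_x_var)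
  have t: "fps_to_fls fps_X = (t_var :: real fls fls)" by (simp add: t_var_def)
  have "fps_to_fls (Delta S) \<in> K"
    unfolding Delta_def power2_eq_square
    by (simp only: h is_ring_hom_numeral[OF is_ring_hom_fps_to_fls] Ac t)
       (intro is_subfieldD[OF K] AK xt 2)
  then have "fps_to_fls (fps_sqrt (Delta S)) \<in> B"
    by (intro sqrtB[of "fps_to_fls (fps_sqrt (Delta S))"])
       (simp add: fps_to_fls_sqrt_square Delta_eq_Disc Disc_nth_0 KB)
  then have "Z S \<in> B" unfolding Z_def
    by (intro is_subfieldD[OF B] KB[OF xt(2)] KB[OF AK] KB[OF 2(1)])
  then have ZB: "Z_quot S k \<in> B" for k unfolding Z_quot_def
    by (auto intro!: is_subfieldD[OF B] KB[OF xt(2)] KB[OF AK])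
  obtain k n where k: "k \<in> {1, - 1}" "j = - k * int n"
  proof (cases "j \<ge> 0")
    case True then show ?thesis using that[of "-1" "nat j"] by simp
  next
    case False then show ?thesis using that[of 1 "nat (- j)"] by simp
  qed
  have "fps_to_fls (slit_gf S j) \<in> B"
    unfolding k(2) slit_gf_closed_form[OF fin small F k(1)] right_def[symmetric]
    by (intro is_subfieldD[OF B] is_subfield_power[OF B] sB ZB)
  then show ?thesis by (simp add: B_def K_def)
qed

section \<open>Passage to complex coefficients\<close>

definition cpx :: "real poly fps \<Rightarrow> complex poly fps" where
  "cpx = map_coeffs (map_poly complex_of_real)"

definition evp :: "'a::comm_ring_1 \<Rightarrow> 'a poly fps \<Rightarrow> 'a fps" where
  "evp a = map_coeffs (\<lambda>p. poly p a)"

lemma is_ring_hom_cpx: "is_ring_hom cpx"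
  unfolding cpx_def by (intro is_ring_hom_map_coeffs is_ring_hom_map_poly is_ring_hom_of_real)

lemma is_ring_hom_evp: "is_ring_hom (evp a)"
  unfolding evp_def by (intro is_ring_hom_map_coeffs is_ring_hom_poly)

lemma coeff_cpx: "coeff (cpx D $ n) k = complex_of_real (coeff (D $ n) k)"
  by (simp add: cpx_def coeff_map_poly)

lemma cpx_nth_0: "D $ 0 = 1 \<Longrightarrow> cpx D $ 0 = 1"
  by (simp add: cpx_def)

lemma subst_var_eq_evp: "subst_var complex_of_real a D = evp a (cpx D)"
  by (simp add: subst_var_def evp_def cpx_def map_coeffs_def)

lemma cpx_pconst: "cpx (pconst c) = pconst (map_coeffs complex_of_real c)"
  by (simp add: fps_eq_iff cpx_def pconst_def map_poly_pCons)

lemma coeff_ser_cpx: "coeff_ser k (cpx D) = map_coeffs complex_of_real (coeff_ser k D)"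
  by (simp add: fps_eq_iff coeff_ser_def coeff_cpx)

lemma x_coeffs_eq: "x_coeffs D = {xser (cpx D) $ k | k. True}"
  by (simp add: x_coeffs_def xser_nth coeff_cpx)

lemma bounded_degree_cpx: "bounded_degree N D \<Longrightarrow> bounded_degree N (cpx D)"
  by (auto simp: bounded_degree_def cpx_def intro: le_trans[OF map_poly_degree_leq])

lemma cpx_axis_poly:
  assumes "finite S" "\<forall>(i, j)\<in>S. \<bar>j\<bar> \<le> 1"
  shows "cpx (axis_poly S) = axis_poly S"
  by (intro fps_ext poly_eqI) (simp add: coeff_cpx coeff_axis_poly[OF assms])

lemma cpx_hit_poly:
  assumes "finite S" "\<forall>(i, j)\<in>S. \<bar>j\<bar> \<le> 1"
  shows "cpx (hit_poly S) = hit_poly S"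
proof (intro fps_ext poly_eqI)
  fix n k
  show "coeff (cpx (hit_poly S) $ n) k = coeff (hit_poly S $ n) k"
    by (cases n) (simp_all add: coeff_cpx hit_poly_0[OF assms] coeff_hit_poly[OF assms] coeff_1)
qed

lemma evp_nth_0: "D $ 0 = 1 \<Longrightarrow> evp a D $ 0 = 1"
  by (simp add: evp_def)

lemma slit_gf_point_eq:
  assumes "finite S" "\<forall>(i, j)\<in>S. \<bar>j\<bar> \<le> 1"
  shows "slit_gf_point S i j = xcoef i (slit_series S j)"
  by (simp add: slit_gf_point_def xcoef_def slit_series_nth[OF assms])

text \<open>The witness is \<open>x^M A_k\<close>, whose coefficients are natural numbers and so
  belong to every subfield.\<close>

lemma A_roots_algebraic:
  assumes K: "is_subfield (K :: complex fls set)" and fin: "finite S" and a: "a \<in> A_roots S k"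
  shows "algebraic_over K (fls_const a)"
proof -
  obtain M where M: "M \<ge> 0" "\<And>i k. (i, k) \<in> S \<Longrightarrow> \<bar>i\<bar> \<le> M" using step_bound[OF fin] by metis
  define p where "p = (\<Sum>i | (i, k) \<in> S. monom (1 :: complex fls) (nat (M + i)))"
  have finB: "finite {i. (i, k) \<in> S}"
    using finite_vimageI[OF fin, of "\<lambda>i. (i, k)"] by (simp add: vimage_def inj_on_def)
  have nz: "{i. (i, k) \<in> S} \<noteq> {}"
  proof
    assume "{i. (i, k) \<in> S} = {}"
    then show False using a by (simp add: A_roots_def A_def)
  qed
  have Mi: "M + i \<ge> 0" if "(i, k) \<in> S" for i using M(2)[OF that] by arith
  have c: "coeff p n = of_nat (card {i. (i, k) \<in> S \<and> nat (M + i) = n})" for n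
  proof -
    have "coeff p n = (\<Sum>i | (i, k) \<in> S. if nat (M + i) = n then 1 else 0)"
      by (simp add: p_def coeff_sum)
    also have "\<dots> = (\<Sum>i\<in>{i\<in>{i. (i, k) \<in> S}. nat (M + i) = n}. 1)"
      using finB by (simp only: sum.inter_filter)
    finally show ?thesis by simp
  qed
  have "coeff p n \<in> K" for n unfolding c by (rule is_subfield_of_nat[OF K])
  moreover have "p \<noteq> 0"
  proof
    assume "p = 0"
    obtain i where i: "(i, k) \<in> S" using nz by auto
    have "finite {j. (j, k) \<in> S \<and> nat (M + j) = nat (M + i)}" using finite_subset[OF _ finB] by auto
    then have "card {j. (j, k) \<in> S \<and> nat (M + j) = nat (M + i)} \<noteq> 0" using i by auto
    then show False using c[of "nat (M + i)"] \<open>p = 0\<close> by (auto simp: fls_of_nat)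
  qed
  moreover have "poly p (fls_const a) = 0"
  proof -
    have "poly p (fls_const a) = (\<Sum>i | (i, k) \<in> S. fls_const (a ^ nat (M + i)))"
      by (simp add: p_def poly_sum poly_monom fls_const_power)
    also have "\<dots> = (\<Sum>i | (i, k) \<in> S. fls_const (a powi M) * fls_const (a powi i))"
    proof (rule sum.cong[OF refl])
      fix i assume "i \<in> {i. (i, k) \<in> S}"
      then have i: "M + i \<ge> 0" using Mi by blast
      have "a \<noteq> 0" using a by (simp add: A_roots_def)
      have "a ^ nat (M + i) = a powi (M + i)" using i by (simp add: power_int_def)
      also have "\<dots> = a powi M * a powi i" using \<open>a \<noteq> 0\<close> by (simp add: power_int_add)
      finally show "fls_const (a ^ nat (M + i)) = fls_const (a powi M) * fls_const (a powi i)" by simp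
    qed
    also have "\<dots> = fls_const (a powi M * A S k a)"
      by (simp only: A_def sum_distrib_left[symmetric] is_ring_hom_sum[OF is_ring_hom_fls_const]
          is_ring_homD[OF is_ring_hom_fls_const])
    finally show ?thesis using a by (simp add: A_roots_def)
  qed
  ultimately show ?thesis unfolding algebraic_over_def by blast
qed

lemma point_generators_algebraic:
  assumes fin: "finite S" and small: "\<forall>(i, j)\<in>S. \<bar>j\<bar> \<le> 1"
    and F: "(D0, Dp, Dm) = canonical_factorization (Delta S)"
    and g: "g \<in> {t_var} \<union> point_generators S k D0 Dp Dm"
  shows "algebraic_over (generated_field {t_var}) g"
proof -
  define K where "K = generated_field {t_var :: complex fls}"
  define B where "B = {y. algebraic_over K y}"
  have K: "is_subfield K" unfolding K_def by (rule is_subfield_generated_field)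
  have B: "is_subfield B" unfolding B_def by (rule is_subfield_algebraic_over[OF K])
  have sqrtB: "y \<in> B" if "y\<^sup>2 \<in> B" for y
    using that algebraic_over_sqrt[OF K] by (simp add: B_def)
  define \<phi> where "\<phi> f = fps_to_fls (map_coeffs complex_of_real f)" for f
  have hom: "is_ring_hom \<phi>"
    unfolding \<phi>_def
    by (intro is_ring_hom_comp[OF is_ring_hom_fps_to_fls] is_ring_hom_map_coeffs is_ring_hom_of_real)
  have "map_coeffs complex_of_real fps_X = fps_X" by (auto simp: fps_eq_iff fps_X_def)
  then have \<phi>X: "\<phi> fps_X = t_var" by (simp add: \<phi>_def t_var_def)
  note alg = algebraic_over_canonical_factors[OF fin small F hom, unfolded \<phi>X]
  have can: "D0 $ 0 = 1" "Dp $ 0 = 1"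
    using canonical_factorization_Delta(1)[OF fin small F] by (simp_all add: is_canonical_factorization_iff)
  have x: "xser (cpx D) $ k = \<phi> (coeff_ser k D)" for D k
    by (simp add: xser_nth_coeff_ser coeff_ser_cpx \<phi>_def)
  have coef: "x_coeffs Dp \<subseteq> B" "x_coeffs Dm \<subseteq> B"
    using alg by (auto simp: x_coeffs_eq x B_def K_def)
  have root: "fls_const a \<in> B" if "a \<in> A_roots S k" for a
    using A_roots_algebraic[OF K fin that] by (simp add: B_def)
  have "(fps_to_fls (map_coeffs complex_of_real (fps_sqrt D0)))\<^sup>2 = \<phi> D0"
    using can by (simp add: fps_sqrt_hom[OF is_ring_hom_of_real] fps_to_fls_sqrt_square \<phi>_def)
  then have s0: "fps_to_fls (map_coeffs complex_of_real (fps_sqrt D0)) \<in> B"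
    using alg(3) by (intro sqrtB[of "fps_to_fls (map_coeffs complex_of_real (fps_sqrt D0))"]) (simp add: B_def K_def)
  \<comment> \<open>Bounded degree makes \<open>Delta_+(a;t)\<close> a finite sum of algebraic
    terms; its square root is then algebraic too.\<close>
  have sa: "fps_to_fls (fps_sqrt (subst_var complex_of_real a Dp)) \<in> B" if "a \<in> A_roots S k" for a
  proof (rule sqrtB)
    obtain M where M: "M \<ge> 0" "\<And>i k. (i, k) \<in> S \<Longrightarrow> \<bar>i\<bar> \<le> M" using step_bound[OF fin] by metis
    have "bounded_degree (nat (2 * M)) Dp"
      by (rule canonical_factor_degree[OF fin small F M(1)], erule M(2))
    then have b: "bounded_degree (nat (2 * M)) (cpx Dp)" by (rule bounded_degree_cpx)
    have ep: "evp a (pconst c) = c" for c :: "complex fps" by (simp add: evp_def pconst_def fps_eq_iff)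
    have ev: "evp a (fps_const [:0, 1:]) = fps_const a" by (auto simp: evp_def fps_eq_iff)
    have "evp a (cpx Dp) = evp a (\<Sum>k\<le>nat (2 * M). pconst (coeff_ser k (cpx Dp)) * fps_const [:0, 1:] ^ k)"
      using bounded_degree_eq_sum[OF b] by simp
    also have "\<dots> = (\<Sum>k\<le>nat (2 * M). coeff_ser k (cpx Dp) * fps_const a ^ k)"
      by (simp only: is_ring_hom_sum[OF is_ring_hom_evp] is_ring_homD[OF is_ring_hom_evp]
          is_ring_hom_power[OF is_ring_hom_evp] ep ev)
    finally have "fps_to_fls (evp a (cpx Dp)) = (\<Sum>k\<le>nat (2 * M). \<phi> (coeff_ser k Dp) * fls_const a ^ k)"
      by (simp only: is_ring_hom_sum[OF is_ring_hom_fps_to_fls] is_ring_homD[OF is_ring_hom_fps_to_fls]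
          is_ring_hom_power[OF is_ring_hom_fps_to_fls] fps_const_to_fls coeff_ser_cpx \<phi>_def)
    also have "\<dots> \<in> B"
      using alg(1) root[OF that]
      by (intro is_subfield_sum[OF B] is_subfieldD[OF B] is_subfield_power[OF B]) (auto simp: B_def K_def)
    finally show "(fps_to_fls (fps_sqrt (subst_var complex_of_real a Dp)))\<^sup>2 \<in> B"
      by (simp add: subst_var_eq_evp fps_to_fls_sqrt_square evp_nth_0 cpx_nth_0 can)
  qed
  have "t_var \<in> K" unfolding K_def by (simp add: generated_field.incl)
  then have "t_var \<in> B" unfolding B_def by (simp add: algebraic_over_self[OF K])
  then have "g \<in> B"
    using g coef root s0 sa unfolding point_generators_def by auto
  then show ?thesis by (simp add: B_def K_def)
qed

text \<open>\<open>S_0\<close> has constant term 1 in \<open>x\<close>, so solving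
  \<open>Delta_+ S_0^2 = 1\<close> for it adjoins no square root.\<close>

lemma axis_poly_over:
  assumes fin: "finite S" and small: "\<forall>(i, j)\<in>S. \<bar>j\<bar> \<le> 1"
    and F: "(D0, Dp, Dm) = canonical_factorization (Delta S)"
    and E: "is_subfield E" "x_coeffs Dp \<subseteq> E"
  shows "fps_over E (xser (axis_poly S))"
proof -
  note h = is_ring_homD[OF is_ring_hom_xser] and hc = is_ring_homD[OF is_ring_hom_cpx]
  have "cpx (Dp * (axis_poly S)\<^sup>2) = 1" using canonical_factorization_Delta(2)[OF fin small F] by (simp add: hc)
  then have "cpx Dp * (axis_poly S * axis_poly S) = 1"
    by (simp only: hc power2_eq_square cpx_axis_poly[OF fin small])
  then have "xser (cpx Dp * (axis_poly S * axis_poly S)) = 1" by (simp only: h)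
  then have eq: "xser (cpx Dp) * (xser (axis_poly S) * xser (axis_poly S)) = 1" by (simp only: h)
  have s0: "xser (axis_poly S :: complex poly fps) $ 0 = 1"
    by (simp add: xser_nth coeff_axis_poly_0[OF fin small] fps_one_def[symmetric])
  have "(xser (cpx Dp) * (xser (axis_poly S) * xser (axis_poly S))) $ 0 = 1" by (simp only: eq) simp
  then have d0: "xser (cpx Dp) $ 0 \<noteq> 0" by auto
  have "fps_over E (xser (cpx Dp))" using E(2) by (auto simp: x_coeffs_eq fps_over_def)
  then have "fps_over E (xser (axis_poly S) * xser (axis_poly S :: complex poly fps))"
    by (rule fps_over_cancel[OF E(1) _ _ d0, rotated]) (simp add: eq fps_over_1[OF E(1)])
  then show ?thesis
    by (rule fps_over_sqrt[OF E(1)]) (simp_all add: s0 is_subfieldD[OF E(1)])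
qed

section \<open>Division by \<open>A\<^sub>k\<close>\<close>

text \<open>Each coefficient of \<open>t^n\<close> is a polynomial, so shifting \<open>x\<close> to
  \<open>a + x\<close> is legitimate even when the degrees are unbounded in
  \<open>n\<close>.\<close>

definition taylor :: "complex \<Rightarrow> complex poly fps \<Rightarrow> complex fls fps" where
  "taylor a D = xser (map_coeffs (\<lambda>p. pcompose p [:a, 1:]) D)"

lemma is_ring_hom_taylor: "is_ring_hom (taylor a)"
  unfolding taylor_def
  by (intro is_ring_hom_comp[OF is_ring_hom_xser] is_ring_hom_map_coeffs is_ring_hom_pcompose)

lemma taylor_0: "taylor 0 D = xser D"
proof -
  have "pcompose p [:0, 1:] = p" for p :: "complex poly" by (induction p) (simp_all add: pcompose_pCons)
  then have "map_coeffs (\<lambda>p. pcompose p [:0, 1:]) D = D" by (simp add: fps_eq_iff)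
  then show ?thesis by (simp add: taylor_def)
qed

lemma taylor_pconst: "taylor a (pconst c) = fps_const (fps_to_fls c)"
proof -
  have "map_coeffs (\<lambda>p. pcompose p [:a, 1:]) (pconst c) = pconst c"
    by (simp add: fps_eq_iff pconst_def)
  then show ?thesis by (simp add: taylor_def xser_pconst)
qed

lemma taylor_linear: "taylor a (fps_const [:b, 1:]) = fps_const (fls_const (a + b)) + fps_X"
proof -
  have "map_coeffs (\<lambda>p. pcompose p [:a, 1:]) (fps_const [:b, 1:]) = fps_const [:a + b, 1:]"
    by (auto simp: fps_eq_iff pcompose_pCons)
  then show ?thesis by (simp add: taylor_def xser_linear)
qed

lemma taylor_nth_0: "taylor a D $ 0 = fps_to_fls (evp a D)"
proof -
  have "coeff (pcompose p [:a, 1:]) 0 = poly p a" for p :: "complex poly"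
    by (simp add: poly_pcompose flip: poly_0_coeff_0)
  then show ?thesis by (simp add: taylor_def xser_nth evp_def map_coeffs_def)
qed

text \<open>The type admits Laurent series in \<open>x\<close> as coefficients; finiteness confines
  them to Laurent polynomials, which can be cut into a part in \<open>x\<close> and a part in
  \<open>1/x\<close>.\<close>

definition finite_x :: "'a::field fls fps \<Rightarrow> bool" where
  "finite_x F \<longleftrightarrow> (\<forall>n. finite {i. (F $ n) $$ i \<noteq> 0})"

lemma finite_x_add: "finite_x F \<Longrightarrow> finite_x G \<Longrightarrow> finite_x (F + G)"
  and finite_x_diff: "finite_x F \<Longrightarrow> finite_x G \<Longrightarrow> finite_x (F - G)"
proof -
  assume *: "finite_x F" "finite_x G"
  then have fin: "finite ({i. (F $ n) $$ i \<noteq> 0} \<union> {i. (G $ n) $$ i \<noteq> 0})" for n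
    by (simp add: finite_x_def)
  have "finite {i. (F $ n) $$ i + (G $ n) $$ i \<noteq> 0}" "finite {i. (F $ n) $$ i - (G $ n) $$ i \<noteq> 0}" for n
    by (rule finite_subset[OF _ fin[of n]], auto)+
  then show "finite_x (F + G)" "finite_x (F - G)" by (simp_all add: finite_x_def)
qed

lemma finite_x_xpow:
  assumes "finite_x F" shows "finite_x (xpow k * F)"
  unfolding finite_x_def
proof
  fix n
  have "{i. ((xpow k * F) $ n) $$ i \<noteq> 0} \<subseteq> (\<lambda>i. i + k) ` {i. (F $ n) $$ i \<noteq> 0}"
    by (auto simp: xpow_mult_nth intro!: image_eqI[of _ _ "_ - k"])
  then show "finite {i. ((xpow k * F) $ n) $$ i \<noteq> 0}"
    using assms finite_subset unfolding finite_x_def by blast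
qed

lemma finite_x_const: "finite_x F \<Longrightarrow> finite_x (fps_const (fls_const a) * F)"
  unfolding finite_x_def
  by (safe, rule finite_subset[of _ "{i. (F $ n) $$ i \<noteq> 0}" for n]) auto

lemma finite_x_right: "finite_x (right U)"
  unfolding finite_x_def
proof
  fix n
  have "{i. (right U $ n) $$ i \<noteq> 0} \<subseteq> int ` {..degree (U $ n)}"
  proof
    fix i assume "i \<in> {i. (right U $ n) $$ i \<noteq> 0}"
    then have "i \<ge> 0" "coeff (U $ n) (nat i) \<noteq> 0" by (auto simp: right_nth split: if_splits)
    then show "i \<in> int ` {..degree (U $ n)}"
      by (intro image_eqI[of _ _ "nat i"]) (auto intro: le_degree)
  qed
  then show "finite {i. (right U $ n) $$ i \<noteq> 0}" using finite_subset by blast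
qed

lemma finite_x_left: "finite_x (left U)"
  unfolding finite_x_def
proof
  fix n
  have "{i. (left U $ n) $$ i \<noteq> 0} \<subseteq> (\<lambda>k. - int k) ` {..degree (U $ n)}"
  proof
    fix i assume "i \<in> {i. (left U $ n) $$ i \<noteq> 0}"
    then have "i \<le> 0" "coeff (U $ n) (nat (- i)) \<noteq> 0" by (auto simp: left_nth split: if_splits)
    then show "i \<in> (\<lambda>k. - int k) ` {..degree (U $ n)}"
      by (intro image_eqI[of _ _ "nat (- i)"]) (auto intro: le_degree)
  qed
  then show "finite {i. (left U $ n) $$ i \<noteq> 0}" using finite_subset by blast
qed

text \<open>The factor \<open>1/x\<close> assigns the exponent 0 to \<open>U\<close>, which makes
  the two parts disjoint.\<close>

lemma finite_x_split:
  assumes "finite_x F"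
  obtains U V where "F = right U + xpow (- 1) * left V"
proof -
  define U where "U = Abs_fps (\<lambda>n. Abs_poly (\<lambda>k. (F $ n) $$ int k))"
  define V where "V = Abs_fps (\<lambda>n. Abs_poly (\<lambda>k. (F $ n) $$ (- int k - 1)))"
  have U: "coeff (U $ n) k = (F $ n) $$ int k" for n k
  proof -
    have "finite (int -` {i. (F $ n) $$ i \<noteq> 0})"
      using assms by (intro finite_vimageI) (auto simp: finite_x_def)
    then show ?thesis by (simp add: U_def coeff_Abs_poly vimage_def)
  qed
  have V: "coeff (V $ n) k = (F $ n) $$ (- int k - 1)" for n k
  proof -
    have "finite ((\<lambda>k. - int k - 1) -` {i. (F $ n) $$ i \<noteq> 0})"
      using assms by (intro finite_vimageI) (auto simp: finite_x_def inj_on_def)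
    then show ?thesis by (simp add: V_def coeff_Abs_poly vimage_def)
  qed
  have "F = right U + xpow (- 1) * left V"
    by (intro fps_ext fls_eqI) (auto simp: right_nth xpow_mult_nth left_nth U V)
  then show ?thesis by (rule that)
qed

text \<open>The point 0 is always included: expansion there gives the plain coefficients, and
  division by \<open>x\<close> becomes a division at a root.\<close>

definition taylor_over :: "complex fls set \<Rightarrow> complex set \<Rightarrow> complex poly fps \<Rightarrow> bool" where
  "taylor_over E R U \<longleftrightarrow> (\<forall>a\<in>insert 0 R. fps_over E (taylor a U))"

text \<open>Both \<open>U\<close> and \<open>V\<close> may contribute to the exponent 0, so a
  splitting is determined only up to a constant in \<open>x\<close>; the division lemmas have to
  identify that constant.\<close>

definition splits_over :: "complex fls set \<Rightarrow> complex set \<Rightarrow> complex fls fps \<Rightarrow> bool" where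
  "splits_over E R F \<longleftrightarrow> (\<exists>U V. F = right U + left V \<and> taylor_over E R U \<and> fps_over E (xser V))"

lemma pconst_plus_var_mult:
  obtains V' where "V = pconst (coeff_ser 0 V) + fps_const [:0, 1:] * V'"
proof
  show "V = pconst (coeff_ser 0 V) + fps_const [:0, 1:] * map_coeffs (poly_shift 1) V"
    by (auto simp: fps_eq_iff poly_eq_iff pconst_def coeff_ser_def coeff_pCons coeff_poly_shift split: nat.splits)
qed

context
  fixes E :: "complex fls set" and R :: "complex set"
  assumes E: "is_subfield E" and R: "\<And>a. a \<in> R \<Longrightarrow> fls_const a \<in> E"
begin

lemma root_over: "a \<in> insert 0 R \<Longrightarrow> fls_const a \<in> E"
  using R is_subfieldD(2)[OF E] by auto

lemma taylor_over_intros: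
  "taylor_over E R U \<Longrightarrow> taylor_over E R V \<Longrightarrow> taylor_over E R (U + V)"
  "taylor_over E R U \<Longrightarrow> taylor_over E R V \<Longrightarrow> taylor_over E R (U * V)"
  "fps_to_fls c \<in> E \<Longrightarrow> taylor_over E R (pconst c)"
  "taylor_over E R (fps_const [:0, 1:])" "taylor_over E R 0"
  unfolding taylor_over_def
  by (auto simp: is_ring_homD[OF is_ring_hom_taylor] taylor_pconst taylor_linear root_over
      intro!: fps_over_add[OF E] fps_over_mult[OF E] fps_over_const[OF E] fps_over_X[OF E] fps_over_0[OF E])

lemma splits_over_right: "taylor_over E R U \<Longrightarrow> splits_over E R (right U)"
  unfolding splits_over_def
  by (intro exI[of _ U] exI[of _ 0])
     (simp add: is_ring_homD[OF is_ring_hom_left] is_ring_homD[OF is_ring_hom_xser] fps_over_0[OF E])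

lemma splits_over_left: "fps_over E (xser V) \<Longrightarrow> splits_over E R (left V)"
  unfolding splits_over_def
  by (intro exI[of _ 0] exI[of _ V])
     (simp add: is_ring_homD[OF is_ring_hom_right] taylor_over_intros)

lemma splits_over_finite_x: "splits_over E R F \<Longrightarrow> finite_x F"
  by (auto simp: splits_over_def intro: finite_x_add finite_x_right finite_x_left)

lemma splits_over_add:
  assumes "splits_over E R F" "splits_over E R G" shows "splits_over E R (F + G)"
proof -
  obtain U V U' V' where "F = right U + left V" "taylor_over E R U" "fps_over E (xser V)"
    "G = right U' + left V'" "taylor_over E R U'" "fps_over E (xser V')"
    using assms unfolding splits_over_def by blast
  then show ?thesis
    unfolding splits_over_def
    by (intro exI[of _ "U + U'"] exI[of _ "V + V'"])
       (auto simp: is_ring_homD[OF is_ring_hom_left] is_ring_homD[OF is_ring_hom_right]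
         is_ring_homD[OF is_ring_hom_xser] intro: taylor_over_intros fps_over_add[OF E])
qed

lemma splits_over_const_mult:
  assumes "splits_over E R F" "fps_to_fls c \<in> E"
  shows "splits_over E R (map_coeffs fls_const c * F)"
proof -
  obtain U V where UV: "F = right U + left V" "taylor_over E R U" "fps_over E (xser V)"
    using assms unfolding splits_over_def by blast
  have "map_coeffs fls_const c * F = right (pconst c * U) + left (pconst c * V)"
    unfolding UV(1) by (simp add: is_ring_homD[OF is_ring_hom_left] is_ring_homD[OF is_ring_hom_right]
        right_pconst left_pconst distrib_left)
  moreover have "fps_over E (xser (pconst c * V))"
    using UV(3) assms(2) by (simp add: is_ring_homD[OF is_ring_hom_xser] xser_pconst fps_over_mult[OF E] fps_over_const[OF E])
  ultimately show ?thesis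
    unfolding splits_over_def using UV assms(2) taylor_over_intros by blast
qed

text \<open>Multiplication by \<open>x\<close> pushes the exponent-0 term of \<open>V\<close> over
  to \<open>U\<close>. This coefficient lies in \<open>E\<close>, so the Taylor conditions
  survive.\<close>

lemma splits_over_x:
  assumes "splits_over E R F" shows "splits_over E R (xpow 1 * F)"
proof -
  note r = is_ring_homD[OF is_ring_hom_right] and l = is_ring_homD[OF is_ring_hom_left]
    and h = is_ring_homD[OF is_ring_hom_xser]
  let ?x = "fps_const [:0, 1:] :: complex poly fps"
  obtain U V where UV: "F = right U + left V" "taylor_over E R U" "fps_over E (xser V)"
    using assms unfolding splits_over_def by blast
  obtain V' where V': "V = pconst (coeff_ser 0 V) + ?x * V'" by (rule pconst_plus_var_mult)
  define c where "c = coeff_ser 0 V"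
  have cE: "fps_to_fls c \<in> E" using UV(3) by (simp add: fps_over_def c_def xser_nth_coeff_ser)
  have "left V = left (pconst c) + xpow (- 1) * left V'"
    by (subst V') (simp only: l left_var c_def)
  then have "xpow 1 * F = right (?x * (U + pconst c)) + (xpow 1 * xpow (- 1)) * left V'"
    unfolding UV(1) by (simp add: r right_var left_pconst right_pconst algebra_simps)
  then have eq: "xpow 1 * F = right (?x * (U + pconst c)) + left V'" by (simp add: xpow_mult_xpow)
  have "xser V = fps_const (fps_to_fls c) + fps_X * xser V'"
    by (subst V') (simp add: h xser_pconst xser_linear c_def)
  then have "fps_X * xser V' = xser V - fps_const (fps_to_fls c)" by simp
  then have "fps_over E (fps_X * xser V')"
    using fps_over_diff[OF E UV(3) fps_over_const[OF E cE]] by simp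
  then have "fps_over E (xser V')" by (rule fps_over_X_cancel[OF E])
  then show ?thesis
    unfolding splits_over_def using eq UV(2) cE taylor_over_intros by blast
qed

text \<open>Comparing the parts of \<open>(x - a) G\<close> with nonnegative and with negative exponents leaves
  one unknown constant, and evaluation at \<open>x = a\<close> identifies it with the value there of the
  nonnegative part, which lies in \<open>E\<close>.\<close>

lemma splits_over_divide:
  assumes G: "finite_x G" and a: "a \<in> insert 0 R"
    and F: "splits_over E R ((xpow 1 - fps_const (fls_const a)) * G)"
  shows "splits_over E R G"
proof -
  note r = is_ring_homD[OF is_ring_hom_right] and l = is_ring_homD[OF is_ring_hom_left]
    and h = is_ring_homD[OF is_ring_hom_xser] and ty = is_ring_homD[OF is_ring_hom_taylor]
  let ?x = "fps_const [:- a, 1:] :: complex poly fps" and ?y = "fps_const [:1, - a:] :: complex poly fps"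
  obtain U V where UV: "(xpow 1 - fps_const (fls_const a)) * G = right U + left V"
    "taylor_over E R U" "fps_over E (xser V)"
    using F unfolding splits_over_def by blast
  obtain G1 G2 where G12: "G = right G1 + xpow (- 1) * left G2" using finite_x_split[OF G] .
  have rx: "right ?x = xpow 1 - fps_const (fls_const a)"
    by (auto simp: right_def subst_var_def fps_eq_iff map_poly_pCons xpow_def fls_X_conv_shift_1)
  have ly: "left ?y = 1 - fps_const (fls_const a) * xpow (- 1)"
    by (auto simp: left_def subst_var_def fps_eq_iff map_poly_pCons xpow_def fls_X_inv_conv_shift_1 mult.commute)
  have alg: "(x - b) * (g + y * g') = (x - b) * g + (x * y - b * y) * g'" for x y b g g' :: "complex fls fps"
    by (simp add: algebra_simps)
  have "(xpow 1 - fps_const (fls_const a)) * G = right (?x * G1)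
      + (xpow 1 * xpow (- 1) - fps_const (fls_const a) * xpow (- 1)) * left G2"
    unfolding G12 r rx
    by (rule alg)
  also have "\<dots> = right (?x * G1) + left (?y * G2)"
    by (simp add: xpow_mult_xpow l ly)
  finally have "right U + left V = right (?x * G1) + left (?y * G2)" using UV(1) by simp
  then have "right (U - ?x * G1) = left (?y * G2 - V)" by (simp add: r(6) l(6) algebra_simps)
  then obtain c where c: "U - ?x * G1 = pconst c" "?y * G2 - V = pconst c" by (rule right_eq_left)
  have tx: "taylor b (?x * G1) = taylor b U - fps_const (fps_to_fls c)" for b
  proof -
    have "taylor b (U - ?x * G1) = fps_const (fps_to_fls c)" unfolding c(1) by (rule taylor_pconst)
    then show ?thesis by (simp only: ty(6) diff_eq_eq eq_diff_eq add_ac)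
  qed
  have tx': "taylor b (?x * G1) = (fps_const (fls_const (b - a)) + fps_X) * taylor b G1" for b
    by (simp add: ty(4) taylor_linear)
  have "taylor a U $ 0 = fps_to_fls c"
    using arg_cong[OF trans[OF tx[of a, symmetric] tx'[of a]], of "\<lambda>f. f $ 0"] by simp
  moreover have "fps_over E (taylor a U)" using UV(2) a unfolding taylor_over_def by blast
  ultimately have cE: "fps_to_fls c \<in> E" unfolding fps_over_def by metis
  have "taylor_over E R G1"
    unfolding taylor_over_def
  proof
    fix b assume b: "b \<in> insert 0 R"
    have "fps_over E (taylor b U - fps_const (fps_to_fls c))"
      using UV(2) b cE by (intro fps_over_diff[OF E] fps_over_const[OF E]) (auto simp: taylor_over_def)
    then have *: "fps_over E ((fps_const (fls_const (b - a)) + fps_X) * taylor b G1)"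
      using tx[of b] tx'[of b] by simp
    \<comment> \<open>Expanded at \<open>b = a\<close>, the factor \<open>x - a\<close> is the bare
      variable and only shifts coefficients; at any other point its constant term
      \<open>b - a\<close> is nonzero and can be divided by.\<close>
    show "fps_over E (taylor b G1)"
    proof (cases "b = a")
      case True
      then have "fps_over E (fps_X * taylor b G1)" using * by simp
      then show ?thesis by (rule fps_over_X_cancel[OF E])
    next
      case False
      have "fls_const (b - a) = fls_const b - (fls_const a :: complex fls)"
        by (simp add: fls_minus_const)
      then have "fls_const (b - a) \<in> E" using root_over[OF a] root_over[OF b] is_subfieldD(6)[OF E] by simp
      then show ?thesis
        using False by (intro fps_over_cancel[OF E *])
          (auto intro!: fps_over_add[OF E] fps_over_const[OF E] fps_over_X[OF E])
    qed
  qed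
  moreover have "fps_over E (xser (fps_const [:0, 1:] * G2))"
  proof -
    \<comment> \<open>As a series in \<open>1/x\<close> the factor \<open>1 - a/x\<close> has
      constant term 1, so the negative part is divided without any evaluation.\<close>
    have "xser (?y * G2) = xser V + fps_const (fps_to_fls c)"
      using arg_cong[OF c(2), of xser] by (simp add: h(6) xser_pconst algebra_simps)
    then have *: "fps_over E ((1 + fps_const (fls_const (- a)) * fps_X) * xser G2)"
      using UV(3) cE by (simp add: h(4) xser_linear fps_over_add[OF E] fps_over_const[OF E])
    have "fls_const (- a) \<in> E"
      unfolding is_ring_homD(5)[OF is_ring_hom_fls_const] by (rule is_subfieldD(3)[OF E root_over[OF a]])
    then have "fps_over E (1 + fps_const (fls_const (- a)) * fps_X)"
      by (intro fps_over_add[OF E] fps_over_1[OF E] fps_over_mult[OF E] fps_over_const[OF E] fps_over_X[OF E])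
    then have "fps_over E (xser G2)" by (rule fps_over_cancel[OF E *]) simp
    then show ?thesis by (simp add: h(4) xser_linear fps_over_mult[OF E] fps_over_X[OF E])
  qed
  moreover have "G = right G1 + left (fps_const [:0, 1:] * G2)"
    unfolding G12 by (simp add: l left_var)
  ultimately show ?thesis unfolding splits_over_def by blast
qed

text \<open>The given \<open>U\<close> and \<open>V\<close> may differ from \<open>t\<close> times
  the parts of \<open>G\<close> by opposite constants, so they cannot simply be divided by
  \<open>t\<close>. The strictly negative part has no exponent-0 term, so the constant is read off
  from that term of \<open>V\<close>.\<close>

lemma splits_over_t_cancel:
  assumes G: "finite_x G" and t: "t_var \<in> E" and F: "splits_over E R (fps_X * G)"
  shows "splits_over E R G"
proof -
  note r = is_ring_homD[OF is_ring_hom_right] and l = is_ring_homD[OF is_ring_hom_left]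
    and h = is_ring_homD[OF is_ring_hom_xser] and ty = is_ring_homD[OF is_ring_hom_taylor]
  obtain U V where UV: "fps_X * G = right U + left V" "taylor_over E R U" "fps_over E (xser V)"
    using F unfolding splits_over_def by blast
  obtain G1 G2 where G12: "G = right G1 + xpow (- 1) * left G2" using finite_x_split[OF G] .
  let ?y = "fps_const [:0, 1:] :: complex poly fps"
  have G: "G = right G1 + left (?y * G2)" unfolding G12 by (simp add: l left_var)
  have "fps_X * G = right (fps_X * G1) + left (fps_X * (?y * G2))"
    unfolding G r l right_fps_X left_fps_X by (simp only: distrib_left)
  then have "right (U - fps_X * G1) = left (fps_X * (?y * G2) - V)"
    using UV(1) by (simp add: r(6) l(6) algebra_simps)
  then obtain c where c: "U - fps_X * G1 = pconst c" "fps_X * (?y * G2) - V = pconst c" by (rule right_eq_left)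
  have X: "fps_X = pconst (fps_X :: complex fps)" by (auto simp: pconst_def fps_eq_iff fps_X_def)
  have x: "xser fps_X = fps_const (t_var :: complex fls)" "taylor b fps_X = fps_const t_var" for b
    by (subst X, simp add: xser_pconst taylor_pconst t_var_def)+
  have t0: "(t_var :: complex fls) \<noteq> 0" by (simp add: t_var_def)
  have eq: "fps_const t_var * xser (?y * G2) = xser V + fps_const (fps_to_fls c)"
    using arg_cong[OF c(2), of xser] by (simp only: h x xser_pconst algebra_simps)
  have "(fps_const t_var * xser (?y * G2)) $ 0 = 0" by (simp add: h xser_linear)
  then have "fps_to_fls c = - (xser V $ 0)" unfolding eq by (simp add: add_eq_0_iff)
  then have cE: "fps_to_fls c \<in> E" using UV(3) is_subfieldD(3)[OF E] by (simp add: fps_over_def)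
  have "fps_over E (fps_const t_var * xser (?y * G2))"
    unfolding eq by (intro fps_over_add[OF E] fps_over_const[OF E] UV(3) cE)
  then have V: "fps_over E (xser (?y * G2))"
    by (rule fps_over_cancel[OF E]) (auto intro: fps_over_const[OF E] simp: t t0)
  have "taylor_over E R G1"
    unfolding taylor_over_def
  proof
    fix b assume b: "b \<in> insert 0 R"
    have "fps_const t_var * taylor b G1 = taylor b U - fps_const (fps_to_fls c)"
      using arg_cong[OF c(1), of "taylor b"] by (simp only: ty x taylor_pconst algebra_simps)
    moreover have "fps_over E (taylor b U - fps_const (fps_to_fls c))"
      using UV(2) b cE by (intro fps_over_diff[OF E] fps_over_const[OF E]) (auto simp: taylor_over_def)
    ultimately have "fps_over E (fps_const t_var * taylor b G1)" by simp
    then show "fps_over E (taylor b G1)"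
      by (rule fps_over_cancel[OF E]) (auto intro: fps_over_const[OF E] simp: t t0)
  qed
  then show ?thesis unfolding splits_over_def using G V by blast
qed

lemma splits_over_xpow:
  assumes "splits_over E R F" shows "splits_over E R (xpow i * F)"
proof -
  have p: "splits_over E R (xpow (int n) * F)" for n
  proof (induction n)
    case (Suc n)
    have "xpow 1 * (xpow (int n) * F) = xpow (int (Suc n)) * F"
      by (simp add: mult.assoc[symmetric] xpow_mult_xpow)
    then show ?case using splits_over_x[OF Suc] by metis
  qed (use assms in simp)
  have m: "splits_over E R (xpow (- int n) * F)" for n
  proof (induction n)
    case (Suc n)
    \<comment> \<open>Division by \<open>x\<close> is division by \<open>x - a\<close> at
      \<open>a = 0\<close>.\<close>
    have "(xpow 1 - fps_const (fls_const 0)) * (xpow (- int (Suc n)) * F) = xpow (- int n) * F"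
      by (simp add: mult.assoc[symmetric] xpow_mult_xpow)
    then have "splits_over E R ((xpow 1 - fps_const (fls_const 0)) * (xpow (- int (Suc n)) * F))"
      using Suc by (simp only:)
    then show ?case
      by (rule splits_over_divide[OF finite_x_xpow[OF splits_over_finite_x[OF assms]], rotated]) simp
  qed (use assms in simp)
  show ?thesis using p[of "nat i"] m[of "nat (- i)"] by (cases "i \<ge> 0") auto
qed

lemma splits_over_0: "splits_over E R 0"
  using splits_over_right[OF taylor_over_intros(5)] by (simp add: is_ring_homD[OF is_ring_hom_right])

lemma splits_over_Ac: "splits_over E R F \<Longrightarrow> splits_over E R (Ac S k * F)"
proof -
  assume *: "splits_over E R F"
  have "splits_over E R (\<Sum>i\<in>B. xpow i * F)" for B
    by (induction B rule: infinite_finite_induct) (auto intro: splits_over_0 splits_over_add splits_over_xpow[OF *])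
  then show ?thesis unfolding Ac_eq_sum sum_distrib_right .
qed

text \<open>Linear factors are removed one by one. A multiple root consumes successive Taylor
  coefficients at the same point, which is why the invariant asks for all of them and not only for
  the value.\<close>

lemma splits_over_monic_divide:
  assumes "finite_x G" "lead_coeff p = 1" "\<And>a. poly p a = 0 \<Longrightarrow> a \<in> insert 0 R"
    "splits_over E R (right (fps_const p) * G)"
  shows "splits_over E R G"
  using assms
proof (induction "degree p" arbitrary: p G)
  case 0
  then have "p = 1" by (metis degree_eq_zeroE degree_pCons_0 lead_coeff_pCons(2) one_pCons)
  then show ?case using 0(5) by (simp add: is_ring_homD[OF is_ring_hom_right])
next
  case (Suc n)
  have "\<not> constant (poly p)" using Suc(2) by (simp add: constant_degree)
  then obtain a where a: "poly p a = 0" using fundamental_theorem_of_algebra by blast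
  then obtain q where q: "p = [:- a, 1:] * q" by (auto simp: poly_eq_0_iff_dvd)
  have "q \<noteq> 0" using Suc(2) q by auto
  then have "degree p = Suc (degree q)" unfolding q by (subst degree_mult_eq) auto
  then have dq: "n = degree q" using Suc(2) by simp
  have lq: "lead_coeff q = 1" using Suc(4) unfolding q lead_coeff_mult by simp
  let ?H = "(xpow 1 - fps_const (fls_const a)) * G"
  have rx: "right (fps_const [:- a, 1:]) = xpow 1 - fps_const (fls_const a)"
    by (auto simp: right_def subst_var_def fps_eq_iff map_poly_pCons xpow_def fls_X_conv_shift_1)
  have "fps_const p = fps_const q * fps_const [:- a, 1:]" unfolding q by (simp add: mult.commute)
  then have "right (fps_const p) * G = right (fps_const q) * ?H"
    by (simp only: is_ring_homD[OF is_ring_hom_right] rx mult.assoc)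
  moreover have "finite_x ?H"
    unfolding left_diff_distrib by (intro finite_x_diff finite_x_xpow finite_x_const Suc(3))
  moreover have "b \<in> insert 0 R" if "poly q b = 0" for b using Suc(5)[of b] that by (simp add: q)
  ultimately have "splits_over E R ?H" using Suc(6) Suc(1)[OF dq _ lq] by metis
  then show ?case using splits_over_divide[OF Suc(3)] Suc(5)[OF a] by blast
qed

end

lemma splits_over_xcoef:
  assumes E: "is_subfield E" and F: "splits_over E R F"
  shows "xcoef i F \<in> E"
proof -
  obtain U V where UV: "F = right U + left V" "taylor_over E R U" "fps_over E (xser V)"
    using F unfolding splits_over_def by blast
  have "fps_over E (xser U)" using UV(2) by (auto simp: taylor_over_def taylor_0)
  then show ?thesis
    using UV(3) by (auto simp: UV(1) xcoef_add xcoef_right xcoef_left fps_over_def is_subfieldD[OF E])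
qed

lemma A_fls_X_nth: "finite S \<Longrightarrow> A S k (fls_X :: 'a::field fls) $$ i = (if (i, k) \<in> S then 1 else 0)"
proof -
  assume fin: "finite S"
  have finB: "finite {i. (i, k) \<in> S}"
    using finite_vimageI[OF fin, of "\<lambda>i. (i, k)"] by (simp add: vimage_def inj_on_def)
  have "A S k (fls_X :: 'a fls) $$ i = (\<Sum>a | (a, k) \<in> S. if i = a then 1 else 0)"
    using Ac_mult_nth[of S k "1 :: 'a fls fps" 0 i] by simp
  then show ?thesis using finB by simp
qed

text \<open>Steps form a set, so \<open>x^M A_k\<close> has coefficients 0 and 1 and is monic once
  it is nonzero. The shift by \<open>M\<close> may add the root 0.\<close>

lemma Ac_eq_monic:
  assumes fin: "finite S" and ne: "(i0, k) \<in> S"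
  obtains p :: "complex poly" and M where "xpow M * Ac S k = right (fps_const p)" "lead_coeff p = 1"
    "\<And>a. poly p a = 0 \<Longrightarrow> a \<in> insert 0 (A_roots S k)"
proof -
  obtain M where M: "M \<ge> 0" "\<And>i k. (i, k) \<in> S \<Longrightarrow> \<bar>i\<bar> \<le> M" using step_bound[OF fin] by metis
  define p where "p = (\<Sum>i | (i, k) \<in> S. monom (1 :: complex) (nat (M + i)))"
  have finB: "finite {i. (i, k) \<in> S}"
    using finite_vimageI[OF fin, of "\<lambda>i. (i, k)"] by (simp add: vimage_def inj_on_def)
  have Mi: "M + i \<ge> 0" if "(i, k) \<in> S" for i using M(2)[OF that] by arith
  have c: "coeff p n = (if (int n - M, k) \<in> S then 1 else 0)" for n
  proof -
    have "coeff p n = (\<Sum>i | (i, k) \<in> S. if nat (M + i) = n then 1 else 0)"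
      by (simp add: p_def coeff_sum)
    also have "\<dots> = (\<Sum>i | (i, k) \<in> S. if i = int n - M then 1 else 0)"
      using Mi by (intro sum.cong refl if_cong) auto
    finally show ?thesis using finB by simp
  qed
  have "coeff p (nat (M + i0)) = 1" using ne Mi[OF ne] by (simp add: c)
  then have "p \<noteq> 0" by auto
  then have 1: "lead_coeff p = 1" using c[of "degree p"] by (metis leading_coeff_0_iff)
  have "right (fps_const p) = (\<Sum>i | (i, k) \<in> S. right (fps_const [:0, 1:] ^ nat (M + i)))"
    by (simp add: p_def is_ring_hom_sum[OF is_ring_hom_fps_const] is_ring_hom_sum[OF is_ring_hom_right]
        monom_altdef fps_const_power)
  also have "\<dots> = (\<Sum>i | (i, k) \<in> S. xpow M * xpow i)"
    using Mi by (intro sum.cong refl) (auto simp: xpow_mult_xpow xpow_eq_right)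
  finally have 2: "xpow M * Ac S k = right (fps_const p)" by (simp add: Ac_eq_sum sum_distrib_left)
  have "a \<in> insert 0 (A_roots S k)" if "poly p a = 0" for a
  proof (cases "a = 0")
    case False
    have "poly p a = (\<Sum>i | (i, k) \<in> S. a powi M * a powi i)"
      unfolding p_def poly_sum poly_monom
    proof (intro sum.cong refl)
      fix i assume "i \<in> {i. (i, k) \<in> S}"
      then have i: "M + i \<ge> 0" using Mi by blast
      have "1 * a ^ nat (M + i) = a powi (M + i)" using i by (simp add: power_int_def)
      also have "\<dots> = a powi M * a powi i" using False by (simp add: power_int_add)
      finally show "1 * a ^ nat (M + i) = a powi M * a powi i" .
    qed
    then have "a powi M * A S k a = 0" using that by (simp add: A_def sum_distrib_left)
    then have "A S k a = 0" using False by simp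
    moreover have "A S k (fls_X :: real fls) $$ i0 = 1" using ne by (simp add: A_fls_X_nth[OF fin])
    then have "A S k (fls_X :: real fls) \<noteq> 0" by force
    then have "A S k (x_var :: real fls fls) \<noteq> 0" by (simp add: A_x_var)
    ultimately show ?thesis using False by (simp add: A_roots_def)
  qed simp
  with 1 2 show ?thesis using that by blast
qed

lemma finite_x_slit_series:
  assumes "finite S" "\<forall>(i, j)\<in>S. \<bar>j\<bar> \<le> 1"
  shows "finite_x (slit_series S j)"
  using finite_slit_count_row[OF assms(1)] by (simp add: finite_x_def slit_series_nth[OF assms])

text \<open>At \<open>1/x = 0\<close> the relation \<open>Delta_0 Delta_- = (1 - H)^2\<close>
  reduces to \<open>Delta_0\<close>, so \<open>1 - H\<close> has constant term
  \<open>sqrt(Delta_0)\<close> there; the recursion for a square root yields the rest.\<close>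

lemma hit_poly_over:
  assumes fin: "finite S" and small: "\<forall>(i, j)\<in>S. \<bar>j\<bar> \<le> 1"
    and F: "(D0, Dp, Dm) = canonical_factorization (Delta S)"
    and E: "is_subfield E" "x_coeffs Dm \<subseteq> E" "fps_to_fls (map_coeffs complex_of_real (fps_sqrt D0)) \<in> E"
  shows "fps_over E (xser (hit_poly S))" "xser (hit_poly S :: complex poly fps) $ 0 \<noteq> 0"
proof -
  note h = is_ring_homD[OF is_ring_hom_xser] and hc = is_ring_homD[OF is_ring_hom_cpx]
    and e = is_ring_homD[OF is_ring_hom_ev0]
  have can: "D0 $ 0 = 1" "Dm $ 0 = 1" "ev0 Dm = 1"
    using canonical_factorization_Delta(1)[OF fin small F] by (simp_all add: is_canonical_factorization_iff)
  note eq = canonical_factorization_Delta(3)[OF fin small F]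
  define d where "d = map_coeffs complex_of_real (fps_sqrt D0)"
  have "(ev0 (hit_poly S))\<^sup>2 = D0"
    using arg_cong[OF eq, of ev0] can by (simp add: e ev0_pconst power2_eq_square)
  moreover have "ev0 (hit_poly S :: real poly fps) $ 0 = 1" by (simp add: ev0_nth hit_poly_0[OF fin small])
  ultimately have "ev0 (hit_poly S) = fps_sqrt D0" by (rule fps_sqrt_unique)
  then have "coeff_ser 0 (hit_poly S) = fps_sqrt D0" by (simp add: fps_eq_iff coeff_ser_def ev0_nth)
  then have "coeff_ser 0 (cpx (hit_poly S)) = d" by (simp add: coeff_ser_cpx d_def)
  then have x0: "xser (hit_poly S :: complex poly fps) $ 0 = fps_to_fls d"
    by (simp add: xser_nth_coeff_ser cpx_hit_poly[OF fin small])
  have "d $ 0 = 1" using fps_sqrt_square(2)[OF can(1)] by (simp add: d_def)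
  then have "d \<noteq> 0" by force
  then show nz: "xser (hit_poly S :: complex poly fps) $ 0 \<noteq> 0" unfolding x0 by simp
  have "cpx (pconst D0 * Dm) = cpx ((hit_poly S)\<^sup>2)" by (simp only: eq)
  then have "pconst (map_coeffs complex_of_real D0) * cpx Dm = hit_poly S * hit_poly S"
    by (simp only: hc power2_eq_square cpx_hit_poly[OF fin small] cpx_pconst)
  then have "xser (pconst (map_coeffs complex_of_real D0) * cpx Dm) = xser (hit_poly S * hit_poly S)" by (rule arg_cong)
  then have eq2: "fps_const (fps_to_fls (map_coeffs complex_of_real D0)) * xser (cpx Dm) = xser (hit_poly S) * xser (hit_poly S)"
    by (simp only: h xser_pconst)
  have "map_coeffs complex_of_real ((fps_sqrt D0)\<^sup>2) = d\<^sup>2"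
    unfolding d_def by (rule is_ring_hom_power[OF is_ring_hom_map_coeffs[OF is_ring_hom_of_real]])
  then have "fps_to_fls (map_coeffs complex_of_real D0) = (fps_to_fls d)\<^sup>2"
    by (simp add: fps_sqrt_square(1)[OF can(1)] fps_to_fls_power)
  then have D0E: "fps_to_fls (map_coeffs complex_of_real D0) \<in> E"
    using is_subfield_power[OF E(1,3)] by (simp add: d_def)
  have "fps_over E (xser (cpx Dm))" using E(2) by (auto simp: x_coeffs_eq fps_over_def)
  then have "fps_over E (xser (hit_poly S) * xser (hit_poly S :: complex poly fps))"
    unfolding eq2[symmetric] by (intro fps_over_mult[OF E(1)] fps_over_const[OF E(1)] D0E)
  then show "fps_over E (xser (hit_poly S))"
    by (rule fps_over_sqrt[OF E(1)]) (use nz x0 E(3) in \<open>auto simp: d_def\<close>)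
qed

lemma slit_series_splits_over:
  assumes fin: "finite S" and small: "\<forall>(i, j)\<in>S. \<bar>j\<bar> \<le> 1"
    and F: "(D0, Dp, Dm) = canonical_factorization (Delta S)"
    and E: "is_subfield E" "{t_var} \<union> point_generators S k D0 Dp Dm \<subseteq> E"
    and k: "k \<in> {1, - 1}" and ne: "(i0, k) \<in> S"
  shows "splits_over E (A_roots S k) (slit_series S (- k * int j))"
proof -
  let ?R = "A_roots S k"
  let ?G = "\<lambda>j. slit_series S (- k * int j) :: complex fls fps"
  have gens: "t_var \<in> E" "x_coeffs Dp \<subseteq> E" "x_coeffs Dm \<subseteq> E"
    "fps_to_fls (map_coeffs complex_of_real (fps_sqrt D0)) \<in> E"
    "\<And>a. a \<in> ?R \<Longrightarrow> fps_to_fls (fps_sqrt (subst_var complex_of_real a Dp)) \<in> E"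
    "\<And>a. a \<in> ?R \<Longrightarrow> fls_const a \<in> E"
    using E(2) by (auto simp: point_generators_def)
  note R = gens(6)
  have can: "Dp $ 0 = 1" "ev0 Dp = 1"
    using canonical_factorization_Delta(1)[OF fin small F] by (simp_all add: is_canonical_factorization_iff)
  note hc = is_ring_homD[OF is_ring_hom_cpx]
  have "cpx (Dp * (axis_poly S)\<^sup>2) = 1" using canonical_factorization_Delta(2)[OF fin small F] by (simp add: hc)
  then have Ds: "cpx Dp * (axis_poly S)\<^sup>2 = 1"
    by (simp only: hc power2_eq_square cpx_axis_poly[OF fin small])
  \<comment> \<open>At each point the relation \<open>Delta_+ S_0^2 = 1\<close> is expanded:
    \<open>Delta_+\<close> is a polynomial, so its Taylor coefficients are finite sums, and
    \<open>S_0\<close> needs only its value at the point as initial term.\<close>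
  have tay: "taylor_over E ?R (axis_poly S)"
    unfolding taylor_over_def
  proof
    fix a assume a: "a \<in> insert 0 ?R"
    have aE: "fls_const a \<in> E" using a R is_subfieldD(2)[OF E(1)] by auto
    note ty = is_ring_homD[OF is_ring_hom_taylor]
    obtain M where M: "M \<ge> 0" "\<And>i k. (i, k) \<in> S \<Longrightarrow> \<bar>i\<bar> \<le> M" using step_bound[OF fin] by metis
    have "bounded_degree (nat (2 * M)) Dp"
      by (rule canonical_factor_degree[OF fin small F M(1)], erule M(2))
    then have b: "bounded_degree (nat (2 * M)) (cpx Dp)" by (rule bounded_degree_cpx)
    have "taylor a (cpx Dp) = taylor a (\<Sum>k\<le>nat (2 * M). pconst (coeff_ser k (cpx Dp)) * fps_const [:0, 1:] ^ k)"
      using bounded_degree_eq_sum[OF b] by simp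
    also have "\<dots> = (\<Sum>k\<le>nat (2 * M). fps_const (xser (cpx Dp) $ k) * (fps_const (fls_const a) + fps_X) ^ k)"
      by (simp only: is_ring_hom_sum[OF is_ring_hom_taylor] ty is_ring_hom_power[OF is_ring_hom_taylor]
          taylor_pconst taylor_linear xser_nth_coeff_ser add_0_right)
    also have "fps_over E \<dots>"
      using gens(2) aE
      by (intro fps_over_sum[OF E(1)] fps_over_mult[OF E(1)] fps_over_const[OF E(1)] fps_over_power[OF E(1)]
          fps_over_add[OF E(1)] fps_over_X[OF E(1)]) (auto simp: x_coeffs_eq)
    finally have tD: "fps_over E (taylor a (cpx Dp))" .
    have "taylor a (cpx Dp * (axis_poly S)\<^sup>2) = 1" by (simp only: Ds ty)
    then have eq: "taylor a (cpx Dp) * (taylor a (axis_poly S) * taylor a (axis_poly S)) = 1"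
      by (simp only: ty power2_eq_square)
    have "evp a (axis_poly S) * fps_sqrt (evp a (cpx Dp)) = 1"
      by (rule hom_sqrt[OF is_ring_hom_evp evp_nth_0 Ds axis_poly_0[OF fin small]])
    then have "fps_to_fls (evp a (axis_poly S)) * fps_to_fls (fps_sqrt (evp a (cpx Dp))) = 1"
      by (metis is_ring_homD(1,4)[OF is_ring_hom_fps_to_fls])
    then have inv: "fps_to_fls (evp a (axis_poly S)) = inverse (fps_to_fls (fps_sqrt (evp a (cpx Dp))))"
      by (metis inverse_unique mult.commute)
    have "fps_to_fls (fps_sqrt (evp a (cpx Dp))) \<in> E"
    proof (cases "a = 0")
      case True
      \<comment> \<open>At 0 no generator is available, but the normalization of
        \<open>Delta_+\<close> makes the square root 1.\<close>
      have "evp 0 (cpx Dp) = map_coeffs complex_of_real (ev0 Dp)"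
        by (simp add: fps_eq_iff evp_def ev0_nth poly_0_coeff_0 coeff_cpx)
      then have "evp 0 (cpx Dp) = 1" using can by (simp add: fps_eq_iff)
      moreover have "fps_sqrt 1 = (1 :: complex fps)" by (rule fps_sqrt_unique[symmetric]) simp_all
      ultimately show ?thesis using True is_subfieldD(1)[OF E(1)] by simp
    next
      case False
      then show ?thesis using a gens(5) by (simp add: subst_var_eq_evp)
    qed
    then have s0: "taylor a (axis_poly S) $ 0 \<in> E"
      unfolding taylor_nth_0 inv by (rule is_subfieldD(4)[OF E(1)])
    have "(taylor a (cpx Dp) * (taylor a (axis_poly S) * taylor a (axis_poly S))) $ 0 = 1"
      by (simp only: eq) simp
    then have nz: "taylor a (cpx Dp) $ 0 \<noteq> 0" "taylor a (axis_poly S) $ 0 \<noteq> 0" by auto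
    have "fps_over E (taylor a (axis_poly S) * taylor a (axis_poly S))"
      by (rule fps_over_cancel[OF E(1) _ tD nz(1)]) (simp only: eq fps_over_1[OF E(1)])
    then show "fps_over E (taylor a (axis_poly S))"
      by (rule fps_over_sqrt[OF E(1)]) (use s0 nz(2) in auto)
  qed
  note sp = splits_over_const_mult[OF E(1) R] splits_over_Ac[OF E(1) R] splits_over_add[OF E(1) R]
  have t: "map_coeffs fls_const fps_X = (fps_X :: complex fls fps)" by (auto simp: fps_eq_iff fps_X_def)
  have neg: "splits_over E ?R (- F)" if "splits_over E ?R F" for F
  proof -
    have "map_coeffs fls_const (fps_const (- 1)) = (- 1 :: complex fls fps)"
      by (auto simp: fps_eq_iff fls_const_def) (metis fls_const_def is_ring_homD(1,5)[OF is_ring_hom_fls_const])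
    moreover have "fps_to_fls (fps_const (- 1)) \<in> E"
      using is_subfieldD(1,3)[OF E(1)]
      by (metis fps_const_to_fls is_ring_homD(1,5)[OF is_ring_hom_fls_const])
    ultimately show ?thesis using sp(1)[OF _ that, of "fps_const (- 1)"] by simp
  qed
  have tm: "splits_over E ?R (fps_X * F)" if "splits_over E ?R F" for F
    using sp(1)[OF _ that, of fps_X] gens(1) by (simp add: t t_var_def)
  have diff: "splits_over E ?R (F - G)" if "splits_over E ?R F" "splits_over E ?R G" for F G
    using sp(3)[OF _ that(1) neg[OF that(2)]] by simp
  obtain p :: "complex poly" and M where p: "xpow M * Ac S k = right (fps_const p)" "lead_coeff p = 1"
    "\<And>a. poly p a = 0 \<Longrightarrow> a \<in> insert 0 ?R"
    using Ac_eq_monic[OF fin ne] by blast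
  have divide: "splits_over E ?R G" if "finite_x G" "splits_over E ?R (Ac S k * G)" for G
  proof (rule splits_over_monic_divide[OF E(1) R that(1) p(2,3)])
    have "right (fps_const p) * G = xpow M * (Ac S k * G)" by (simp only: p(1)[symmetric] mult.assoc)
    then show "splits_over E ?R (right (fps_const p) * G)"
      using splits_over_xpow[OF E(1) R that(2)] by (simp only:)
  qed
  have finAc: "finite_x (Ac S k * G)" if "finite_x G" for G :: "complex fls fps"
  proof -
    have "finite_x (\<Sum>i\<in>B. xpow i * G)" for B
      by (induction B rule: infinite_finite_induct) (auto intro: finite_x_add finite_x_xpow that simp: finite_x_def[of 0])
    then show ?thesis unfolding Ac_eq_sum sum_distrib_right .
  qed
  note fG = finite_x_slit_series[OF fin small]
  have G0: "splits_over E ?R (?G 0)"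
    using splits_over_right[OF E(1) R tay] by (simp add: slit_series_0[OF fin small])
  have hit: "splits_over E ?R (left (hit_poly S))"
    by (rule splits_over_left[OF E(1) R hit_poly_over(1)[OF fin small F E(1) gens(3,4)]])
  have G1: "splits_over E ?R (?G 1)"
  proof (rule divide[OF fG], rule splits_over_t_cancel[OF E(1) R finAc[OF fG] gens(1)])
    have "splits_over E ?R (?G 0 - fps_X * (Ac S 0 * ?G 0) - left (hit_poly S))"
      by (intro diff tm sp(2) G0 hit) simp_all
    moreover have "?G 0 - fps_X * (Ac S 0 * ?G 0) - left (hit_poly S) = 2 * (fps_X * (Ac S k * ?G 1))"
    proof -
      have alg: "g - t * (a * g) - h = 2 * (t * (b * g'))" if "2 * t * b * g' = g * (1 - t * a) - h"
        for g g' t a b h :: "complex fls fps" using that by (simp add: algebra_simps)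
      show ?thesis
        by (rule alg) (use slit_series_first_row_hit[OF fin small k, where 'a=complex] in simp)
    qed
    ultimately have *: "splits_over E ?R (2 * (fps_X * (Ac S k * ?G 1)))" by simp
    have half: "fps_to_fls (fps_const (1 / 2 :: complex)) \<in> E"
    proof -
      have "fps_to_fls (fps_const (1 / 2 :: complex)) * 2 = 1"
        by (simp flip: fls_const_numeral)
      then have "fps_to_fls (fps_const (1 / 2 :: complex)) = inverse 2"
        by (metis inverse_unique mult.commute)
      then show ?thesis using is_subfieldD(4)[OF E(1) is_subfield_numeral[OF E(1)]] by metis
    qed
    have "map_coeffs fls_const (fps_const (1 / 2)) * (2 :: complex fls fps) = 1"
    proof -
      have "map_coeffs fls_const (fps_const (1 / 2)) * map_coeffs fls_const (2 :: complex fps)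
          = map_coeffs fls_const (fps_const (1 / 2) * (2 :: complex fps))"
        by (simp only: is_ring_homD[OF is_ring_hom_map_coeffs[OF is_ring_hom_fls_const]])
      also have "fps_const (1 / 2) * (2 :: complex fps) = 1" by (simp add: numeral_fps_const)
      finally show ?thesis
        by (simp only: is_ring_hom_numeral[OF is_ring_hom_map_coeffs[OF is_ring_hom_fls_const]]
            is_ring_homD[OF is_ring_hom_map_coeffs[OF is_ring_hom_fls_const]])
    qed
    then have eq: "map_coeffs fls_const (fps_const (1 / 2)) * (2 * (fps_X * (Ac S k * ?G 1))) = fps_X * (Ac S k * ?G 1)"
      by (simp only: mult.assoc[symmetric]) simp
    show "splits_over E ?R (fps_X * (Ac S k * ?G 1))"
      by (rule subst[OF eq, of "splits_over E ?R"], rule sp(1)[OF _ * half])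
  qed
  \<comment> \<open>The recurrence is solved for its term farthest from the axis, at the price of a
    division by \<open>t A_k\<close>.\<close>
  have step: "splits_over E ?R (?G (Suc (Suc n)))" if "splits_over E ?R (?G n)" "splits_over E ?R (?G (Suc n))" for n
  proof (rule divide[OF fG], rule splits_over_t_cancel[OF E(1) R finAc[OF fG] gens(1)])
    have rec: "?G (Suc n) = fps_X * (Ac S (- k) * ?G n + Ac S 0 * ?G (Suc n) + Ac S k * ?G (Suc (Suc n)))"
      by (rule slit_series_rec_row[OF fin small k])
    have "splits_over E ?R (?G (Suc n) - fps_X * (Ac S (- k) * ?G n) - fps_X * (Ac S 0 * ?G (Suc n)))"
      by (intro diff tm sp(2) that) simp_all
    moreover have "?G (Suc n) - fps_X * (Ac S (- k) * ?G n) - fps_X * (Ac S 0 * ?G (Suc n))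
        = fps_X * (Ac S k * ?G (Suc (Suc n)))"
    proof -
      have alg: "g - t * x - t * y = t * z" if "g = t * (x + y + z)" for g t x y z :: "complex fls fps"
        using that by (simp add: algebra_simps)
      show ?thesis by (rule alg[OF rec])
    qed
    ultimately show "splits_over E ?R (fps_X * (Ac S k * ?G (Suc (Suc n))))" by simp
  qed
  have "splits_over E ?R (?G j) \<and> splits_over E ?R (?G (Suc j))" for j
  proof (induction j)
    case 0 then show ?case using G0 G1 by simp
  next
    case (Suc n) then show ?case using step by blast
  qed
  then show ?thesis by blast
qed

section \<open>The case \<open>A\<^sub>k = 0\<close>\<close>

definition poly_over :: "'a::zero set \<Rightarrow> 'a poly \<Rightarrow> bool" where
  "poly_over K p \<longleftrightarrow> (\<forall>i. coeff p i \<in> K)"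

context
  fixes K :: "'a::field set"
  assumes K: "is_subfield K"
begin

lemma poly_over_intros:
  "poly_over K 0" "poly_over K 1" "c \<in> K \<Longrightarrow> poly_over K (monom c n)"
  "poly_over K p \<Longrightarrow> poly_over K q \<Longrightarrow> poly_over K (p + q)"
  "poly_over K p \<Longrightarrow> poly_over K q \<Longrightarrow> poly_over K (p - q)"
  "poly_over K p \<Longrightarrow> poly_over K q \<Longrightarrow> poly_over K (p * q)"
  "c \<in> K \<Longrightarrow> poly_over K p \<Longrightarrow> poly_over K (smult c p)"
  using is_subfield_coeff_mult[OF K]
  by (auto simp: poly_over_def is_subfieldD[OF K] coeff_1)

text \<open>The subfield is a set inside a larger field, so division with remainder is redone to
  keep track of where the coefficients lie. The induction runs on a strict bound \<open>n\<close>
  for the degree of \<open>p\<close>.\<close>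

lemma poly_over_division:
  assumes d: "poly_over K d" "d \<noteq> 0"
  shows "poly_over K p \<Longrightarrow> (\<And>i. i \<ge> n \<Longrightarrow> coeff p i = 0) \<Longrightarrow>
    \<exists>q r. poly_over K q \<and> poly_over K r \<and> p = q * d + r \<and> (r = 0 \<or> degree r < degree d)"
proof (induction n arbitrary: p)
  case 0
  then have "p = 0" by (intro poly_eqI) simp
  then show ?case by (intro exI[of _ 0]) (simp add: poly_over_intros)
next
  case (Suc n)
  show ?case
  proof (cases "n < degree d")
    case True
    have "degree p \<le> n" using Suc(3) by (intro degree_le) auto
    then show ?thesis using True Suc(2) by (intro exI[of _ 0] exI[of _ p]) (auto simp: poly_over_intros)
  next
    case False
    let ?m = "monom (coeff p n / lead_coeff d) (n - degree d)"
    have m: "poly_over K ?m"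
      using Suc(2) d by (intro poly_over_intros is_subfieldD[OF K]) (auto simp: poly_over_def)
    have "poly_over K (p - ?m * d)" by (intro poly_over_intros m Suc(2) d)
    moreover have "coeff (p - ?m * d) i = 0" if "i \<ge> n" for i
    proof (cases "i = n")
      case True
      then show ?thesis using False d(2) by (simp add: coeff_monom_mult)
    next
      case False
      then have "i - (n - degree d) > degree d" using that \<open>\<not> n < degree d\<close> by simp
      then show ?thesis using that False Suc(3)[of i] by (simp add: coeff_monom_mult coeff_eq_0)
    qed
    ultimately obtain q r where qr: "poly_over K q" "poly_over K r" "p - ?m * d = q * d + r"
      "r = 0 \<or> degree r < degree d" using Suc(1) by blast
    from qr(3) have "p = (q + ?m) * d + r" by (simp add: algebra_simps)
    then show ?thesis using qr poly_over_intros(4)[OF qr(1) m] by blast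
  qed
qed

lemma poly_over_bezout:
  assumes "poly_over K p" "poly_over K r"
  shows "\<exists>u v. poly_over K u \<and> poly_over K v \<and> u * p + v * r dvd p \<and> u * p + v * r dvd r"
  using assms
\<comment> \<open>The measure tells the zero remainder from a nonzero constant one, since both have
  degree 0.\<close>
proof (induction "if r = 0 then 0 else Suc (degree r)" arbitrary: p r rule: less_induct)
  case (less r p)
  show ?case
  proof (cases "r = 0")
    case True
    then show ?thesis by (intro exI[of _ 1] exI[of _ 0]) (simp add: poly_over_intros)
  next
    case False
    obtain q s where qs: "poly_over K q" "poly_over K s" "p = q * r + s" "s = 0 \<or> degree s < degree r"
      using poly_over_division[OF less(3) False less(2), of "Suc (degree p)"] coeff_eq_0[of p] by force
    have "(if s = 0 then 0 else Suc (degree s)) < (if r = 0 then 0 else Suc (degree r))"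
      using qs(4) False by auto
    from less(1)[OF this less(3) qs(2)] obtain u v where uv: "poly_over K u" "poly_over K v"
      "u * r + v * s dvd r" "u * r + v * s dvd s" by blast
    have "v * p + (u - v * q) * r = u * r + v * s" by (simp add: qs(3) algebra_simps)
    moreover have "u * r + v * s dvd p" unfolding qs(3) using uv by (simp add: dvd_add dvd_mult)
    ultimately show ?thesis using uv poly_over_intros(5)[OF uv(1) poly_over_intros(6)[OF uv(2) qs(1)]]
      by (intro exI[of _ v] exI[of _ "u - v * q"]) simp
  qed
qed

end

section \<open>A Bezout relation for the two factors, up to a power of \<open>t\<close>\<close>

lemma xser_inject: "xser D = xser E \<longleftrightarrow> D = E"
proof
  assume *: "xser D = xser E"
  show "D = E"
  proof (intro fps_ext poly_eqI)
    fix n k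
    have "xser D $ k = xser E $ k" using * by simp
    then have "coeff_ser k D = coeff_ser k E" by (simp add: xser_nth_coeff_ser)
    then show "coeff (D $ n) k = coeff (E $ n) k" by (simp add: coeff_ser_def fps_eq_iff)
  qed
qed simp

lemma xser_eq_fps_of_poly:
  assumes "bounded_degree N D"
  obtains p where "xser D = fps_of_poly p" "degree p \<le> N"
proof
  note hom = is_ring_hom_fps_to_fls
  show "xser D = fps_of_poly (xpoly fps_to_fls D)"
    by (rule fps_ext) (simp add: coeff_xpoly[OF hom assms] xser_nth_coeff_ser)
  show "degree (xpoly fps_to_fls D) \<le> N"
    by (rule degree_le) (auto simp: coeff_xpoly[OF hom assms] bounded_degree_coeff_ser[OF assms])
qed

text \<open>The exponent \<open>e\<close> adds up the orders of the poles in \<open>t\<close> of all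
  coefficients, a crude common denominator.\<close>

lemma clear_denominators:
  fixes P :: "'a::field fls poly"
  obtains e D where "xser D = fps_const (fls_X ^ e) * fps_of_poly P" "bounded_degree (degree P) D"
proof -
  define e where "e = (\<Sum>k\<le>degree P. nat (- fls_subdegree (coeff P k)))"
  define g where "g k = fls_regpart (fls_X ^ e * coeff P k)" for k
  have g: "fps_to_fls (g k) = fls_X ^ e * coeff P k" if "k \<le> degree P" for k
  proof (cases "coeff P k = 0")
    case True
    then show ?thesis by (simp add: g_def)
  next
    case False
    have "nat (- fls_subdegree (coeff P k)) \<le> e"
      unfolding e_def using that by (intro member_le_sum) auto
    then have "fls_subdegree (fls_X ^ e * coeff P k) \<ge> 0"
      using False by (simp add: fls_subdegree_pow)
    then show ?thesis unfolding g_def by (rule fls_regpart_to_fls_trivial)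
  qed
  define D where "D = Abs_fps (\<lambda>n. \<Sum>k\<le>degree P. monom (g k $ n) k)"
  have c: "coeff (D $ n) k = (if k \<le> degree P then g k $ n else 0)" for n k
    by (simp add: D_def coeff_sum)
  show ?thesis
  proof
    show "bounded_degree (degree P) D" by (rule bounded_degreeI) (simp add: c)
    show "xser D = fps_const (fls_X ^ e) * fps_of_poly P"
    proof (rule fps_ext)
      fix k
      have "coeff_ser k D = (if k \<le> degree P then g k else 0)" by (auto simp: coeff_ser_def c fps_eq_iff)
      then show "xser D $ k = (fps_const (fls_X ^ e) * fps_of_poly P) $ k"
        using g[of k] by (simp add: xser_nth_coeff_ser coeff_eq_0)
    qed
  qed
qed

text \<open>Modulo \<open>t\<close> the relation reads \<open>a = b x\<^sup>m\<close> with \<open>a\<close> of degree less than \<open>m\<close>.\<close>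

lemma coprime_modulo_t:
  fixes a b P Q :: "'a::field poly fps"
  assumes eq: "a * P = b * Q" and "P $ 0 = 1" "Q $ 0 = monom 1 m" "\<And>n. degree (a $ n) < m"
  shows "a = 0"
proof -
  have "a $ n = 0 \<and> b $ n = 0" for n
  proof (induction n rule: less_induct)
    case (less n)
    have "(\<Sum>i=0..n. f i) = f n" if "\<And>i. i < n \<Longrightarrow> f i = 0" for f :: "nat \<Rightarrow> 'a poly"
      using that by (simp add: atMost_atLeast0[symmetric] lessThan_Suc_atMost[symmetric])
    then have "(a * P) $ n = a $ n * P $ 0" "(b * Q) $ n = b $ n * Q $ 0"
      using less by (simp_all add: fps_mult_nth)
    then have *: "a $ n = b $ n * monom 1 m" using eq assms(2,3) by simp
    have "b $ n = 0"
    proof (rule ccontr)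
      assume "b $ n \<noteq> 0"
      then have "degree (a $ n) = degree (b $ n) + m" unfolding * by (subst degree_mult_eq) (auto simp: degree_monom_eq)
      then show False using assms(4)[of n] by simp
    qed
    then show ?case using * by simp
  qed
  then show ?thesis by (simp add: fps_eq_iff)
qed

lemma fps_of_poly_over: "fps_over E (fps_of_poly p) \<longleftrightarrow> poly_over E p"
  by (simp add: fps_over_def poly_over_def)

text \<open>Over the field the gcd of the two polynomials is a constant, so a Bezout relation with
  value 1 exists; clearing the denominators in \<open>t\<close> of its cofactors turns 1 into a
  power of \<open>t\<close>.\<close>

lemma bezout_modulo_t_power:
  fixes P Q :: "complex poly fps"
  assumes E: "is_subfield E" "t_var \<in> E"
    and P: "bounded_degree N P" "P $ 0 = 1" "fps_over E (xser P)"
    and Q: "bounded_degree m Q" "Q $ 0 = monom 1 m" "fps_over E (xser Q)"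
  obtains U V e M where "U * P + V * Q = pconst (fps_X ^ e)" "bounded_degree M U" "bounded_degree M V"
    "fps_over E (xser U)" "fps_over E (xser V)"
proof -
  note h = is_ring_homD[OF is_ring_hom_xser]
  obtain p where p: "xser P = fps_of_poly p" using xser_eq_fps_of_poly[OF P(1)] by blast
  obtain r where r: "xser Q = fps_of_poly r" "degree r \<le> m" using xser_eq_fps_of_poly[OF Q(1)] by blast
  have xt: "xser (pconst (fps_X ^ e)) = fps_const (fls_X ^ e)" for e
    by (simp add: xser_pconst fps_to_fls_power)
  have tE: "fls_X ^ e \<in> E" for e using is_subfield_power[OF E] by (simp add: t_var_def)
  obtain u v where uv: "poly_over E u" "poly_over E v" "u * p + v * r dvd p" "u * p + v * r dvd r"
    using poly_over_bezout[OF E(1), of p r] P(3) Q(3) by (auto simp: p r(1) fps_of_poly_over)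
  define d where "d = u * p + v * r"
  obtain p1 r1 where pr1: "p = d * p1" "r = d * r1" using uv(3,4) unfolding d_def by (elim dvdE) blast
  have "r \<noteq> 0"
  proof
    assume "r = 0"
    then have "xser Q = xser 0" by (simp add: r h)
    then have "Q = 0" by (simp only: xser_inject)
    then show False using Q(2) by simp
  qed
  then have nz: "d \<noteq> 0" "r1 \<noteq> 0" using pr1 by auto
  \<comment> \<open>A common factor \<open>d\<close> of positive degree gives
    \<open>r1 * p = p1 * r\<close> with \<open>degree r1 < m\<close>. Once denominators are cleared,
    reduction modulo \<open>t\<close> forces \<open>r1 = 0\<close>.\<close>
  have "degree d = 0"
  proof (rule ccontr)
    assume "degree d \<noteq> 0"
    then have dr: "degree r1 < m" using r(2) nz unfolding pr1(2) by (simp add: degree_mult_eq)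
    obtain e1 D1 where D1: "xser D1 = fps_const (fls_X ^ e1) * fps_of_poly r1" "bounded_degree (degree r1) D1"
      by (rule clear_denominators)
    obtain e2 D2 where D2: "xser D2 = fps_const (fls_X ^ e2) * fps_of_poly p1"
      by (rule clear_denominators)
    have "xser (D1 * pconst (fps_X ^ e2) * P) = xser (D2 * pconst (fps_X ^ e1) * Q)"
      unfolding h xt D1(1) D2 p r(1) pr1 fps_of_poly_mult by (simp only: mult_ac)
    then have "D1 * pconst (fps_X ^ e2) * P = D2 * pconst (fps_X ^ e1) * Q" by (simp only: xser_inject)
    moreover have "degree ((D1 * pconst (fps_X ^ e2)) $ n) < m" for n
      using bounded_degree_mult[OF D1(2) bounded_degree_pconst[of "fps_X ^ e2"]] dr
      unfolding bounded_degree_def by (metis add_0_right le_less_trans)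
    ultimately have "D1 * pconst (fps_X ^ e2) = 0" by (rule coprime_modulo_t[OF _ P(2) Q(2)])
    then have "xser (D1 * pconst (fps_X ^ e2)) = 0" by (simp only: h)
    then show False using nz(2) unfolding h xt D1(1) by simp
  qed
  then obtain c where c: "d = [:c:]" using degree_eq_zeroE by blast
  have "poly_over E d" unfolding d_def using P(3) Q(3) uv
    by (intro poly_over_intros[OF E(1)]) (auto simp: p r(1) fps_of_poly_over)
  then have cE: "c \<in> E" unfolding c poly_over_def by (metis coeff_pCons_0)
  have c0: "c \<noteq> 0" using nz c by auto
  obtain e1 U0 where U0: "xser U0 = fps_const (fls_X ^ e1) * fps_of_poly (smult (inverse c) u)"
    "bounded_degree (degree (smult (inverse c) u)) U0" by (rule clear_denominators)
  obtain e2 V0 where V0: "xser V0 = fps_const (fls_X ^ e2) * fps_of_poly (smult (inverse c) v)"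
    "bounded_degree (degree (smult (inverse c) v)) V0" by (rule clear_denominators)
  define U V where "U = U0 * pconst (fps_X ^ e2)" and "V = V0 * pconst (fps_X ^ e1)"
  have xU: "xser U = fps_const (fls_X ^ (e1 + e2)) * fps_of_poly (smult (inverse c) u)"
    "xser V = fps_const (fls_X ^ (e1 + e2)) * fps_of_poly (smult (inverse c) v)"
    unfolding U_def V_def h xt U0(1) V0(1) by (simp_all add: power_add mult_ac)
  define M where "M = max (degree (smult (inverse c) u)) (degree (smult (inverse c) v))"
  have bd: "bounded_degree M U" "bounded_degree M V"
    using bounded_degree_mult[OF U0(2) bounded_degree_pconst[of "fps_X ^ e2"]]
      bounded_degree_mult[OF V0(2) bounded_degree_pconst[of "fps_X ^ e1"]]
    unfolding U_def V_def M_def bounded_degree_def by (auto intro: le_trans)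
  have "smult (inverse c) u * p + smult (inverse c) v * r = smult (inverse c) d"
    by (simp add: d_def smult_add_right)
  also have "\<dots> = 1" using c0 by (simp add: c one_pCons)
  finally have one: "smult (inverse c) u * p + smult (inverse c) v * r = 1" .
  have "xser (U * P + V * Q) = fps_const (fls_X ^ (e1 + e2)) *
      fps_of_poly (smult (inverse c) u * p + smult (inverse c) v * r)"
    unfolding h xU p r(1) fps_of_poly_add fps_of_poly_mult by (simp only: distrib_left mult.assoc)
  also have "\<dots> = xser (pconst (fps_X ^ (e1 + e2)))" unfolding one xt by simp
  finally have "U * P + V * Q = pconst (fps_X ^ (e1 + e2))" by (simp only: xser_inject)
  moreover have "fps_over E (xser U)" "fps_over E (xser V)"
    unfolding xU using uv cE
    by (auto intro!: fps_over_mult[OF E(1)] fps_over_const[OF E(1)] tE poly_over_intros[OF E(1)]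
        is_subfieldD[OF E(1)] simp: fps_of_poly_over simp del: fps_of_poly_smult)
  ultimately show ?thesis using that bd by blast
qed

text \<open>Weaker than \<open>splits_over\<close>: no Taylor condition is kept, since
  \<open>A_k = 0\<close> contributes no roots and no division by linear factors takes place.\<close>

definition coeffs_over :: "complex fls set \<Rightarrow> complex fls fps \<Rightarrow> bool" where
  "coeffs_over E F \<longleftrightarrow> (\<forall>i. xcoef i F \<in> E)"

context
  fixes E :: "complex fls set"
  assumes E: "is_subfield E"
begin

lemma coeffs_over_intros:
  "coeffs_over E 0"
  "coeffs_over E F \<Longrightarrow> coeffs_over E G \<Longrightarrow> coeffs_over E (F + G)"
  "coeffs_over E F \<Longrightarrow> coeffs_over E (xpow k * F)"
  "fps_to_fls c \<in> E \<Longrightarrow> coeffs_over E F \<Longrightarrow> coeffs_over E (map_coeffs fls_const c * F)"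
  "fps_over E (xser U) \<Longrightarrow> coeffs_over E (right U)"
  "fps_over E (xser U) \<Longrightarrow> coeffs_over E (left U)"
  by (auto simp: coeffs_over_def xcoef_add xcoef_0 xcoef_xpow_mult xcoef_const_mult xcoef_right xcoef_left
      fps_over_def is_subfieldD[OF E])

lemma coeffs_over_sum: "(\<And>b. b \<in> B \<Longrightarrow> coeffs_over E (F b)) \<Longrightarrow> coeffs_over E (sum F B)"
  by (induction B rule: infinite_finite_induct) (auto intro: coeffs_over_intros)

lemma coeffs_over_Ac: "coeffs_over E F \<Longrightarrow> coeffs_over E (Ac S k * F)"
  unfolding Ac_eq_sum sum_distrib_right by (intro coeffs_over_sum coeffs_over_intros)

text \<open>Bounded degree makes each coefficient of the product a finite combination of
  coefficients of \<open>F\<close>.\<close>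

lemma coeffs_over_right_mult:
  assumes "bounded_degree M U" "fps_over E (xser U)" "coeffs_over E F"
  shows "coeffs_over E (right U * F)"
proof -
  have "right U = right (\<Sum>k\<le>M. pconst (coeff_ser k U) * fps_const [:0, 1:] ^ k)"
    using bounded_degree_eq_sum[OF assms(1)] by simp
  also have "\<dots> = (\<Sum>k\<le>M. map_coeffs fls_const (coeff_ser k U) * xpow (int k))"
    by (simp only: is_ring_hom_sum[OF is_ring_hom_right] is_ring_homD[OF is_ring_hom_right]
        right_pconst xpow_eq_right[OF of_nat_0_le_iff] nat_int)
  finally have "right U * F = (\<Sum>k\<le>M. map_coeffs fls_const (coeff_ser k U) * (xpow (int k) * F))"
    by (simp only: sum_distrib_right mult.assoc)
  then show ?thesis
    using assms(2,3) by (auto intro!: coeffs_over_sum coeffs_over_intros simp: fps_over_def xser_nth_coeff_ser)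
qed

end

text \<open>Partial fractions with \<open>s = 1/P\<close> and \<open>q = 1/Q\<close>: multiplying
  \<open>s^a q^b\<close> by the relation \<open>U P + V x^m Q = t^e\<close> gives two terms in which
  \<open>a\<close> or \<open>b\<close> has dropped by one. At the end only powers of
  \<open>s\<close> or only powers of \<open>q\<close> remain, and their coefficients are
  known.\<close>

lemma degenerate_right_left_coeffs_over:
  fixes P Q s q :: "complex poly fps"
  assumes E: "is_subfield E" "t_var \<in> E"
    and P: "bounded_degree N P" "P $ 0 = 1" "fps_over E (xser P)" "P * s = 1"
    and Q: "lower (int m) (left Q)" "Q $ 0 = 1" "fps_over E (xser Q)" "Q * q = 1" "xser Q $ 0 \<noteq> 0"
    and s0: "xser s $ 0 = 1"
  shows "coeffs_over E (right (s ^ a) * left (q ^ b))"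
proof -
  note r = is_ring_homD[OF is_ring_hom_right] and l = is_ring_homD[OF is_ring_hom_left]
    and h = is_ring_homD[OF is_ring_hom_xser]
  \<comment> \<open>\<open>T\<close> is the reversal \<open>x^m Q\<close>, a polynomial in
    \<open>x\<close>; at \<open>t = 0\<close> it is \<open>x^m\<close>, the shape the coprimality
    argument requires.\<close>
  obtain T where T: "left Q = xpow (- int m) * right T" using Q(1) by (auto simp: lower_def)
  have T': "right T = xpow (int m) * left Q"
    unfolding T mult.assoc[symmetric] xpow_mult_xpow by simp
  have c: "coeff (T $ n) k = (if k \<le> m then coeff (Q $ n) (m - k) else 0)" for n k
  proof -
    have "(right T $ n) $$ int k = ((xpow (int m) * left Q) $ n) $$ int k" by (simp only: T')
    then show ?thesis by (auto simp: right_nth xpow_mult_nth left_nth nat_diff_distrib)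
  qed
  have bT: "bounded_degree m T" by (rule bounded_degreeI) (simp add: c)
  have T0: "T $ 0 = monom 1 m" by (rule poly_eqI) (auto simp: c Q(2) coeff_1)
  have "xser T $ k \<in> E" for k
  proof -
    have "coeff_ser k T = (if k \<le> m then coeff_ser (m - k) Q else 0)" by (simp add: coeff_ser_def c fps_eq_iff)
    then show ?thesis using Q(3) by (auto simp: xser_nth_coeff_ser fps_over_def is_subfieldD[OF E(1)])
  qed
  then have xT: "fps_over E (xser T)" by (simp add: fps_over_def)
  obtain U V e M where UV: "U * P + V * T = pconst (fps_X ^ e)" "bounded_degree M U" "bounded_degree M V"
    "fps_over E (xser U)" "fps_over E (xser V)"
    using bezout_modulo_t_power[OF E P(1-3) bT T0 xT] .
  have "xser P * xser s = 1" using arg_cong[OF P(4), of xser] by (simp only: h)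
  moreover from this have "xser P $ 0 \<noteq> 0" using s0 by (metis fps_mult_nth_0 fps_one_nth mult_zero_left zero_neq_one)
  ultimately have xs: "fps_over E (xser s)"
    using P(3) fps_over_cancel[OF E(1), of "xser P" "xser s"] fps_over_1[OF E(1)] by simp
  have "xser Q * xser q = 1" using arg_cong[OF Q(4), of xser] by (simp only: h)
  then have xq: "fps_over E (xser q)"
    using Q(3,5) fps_over_cancel[OF E(1), of "xser Q" "xser q"] fps_over_1[OF E(1)] by simp
  note hp = is_ring_hom_power[OF is_ring_hom_xser]
  show ?thesis
  proof (induction "a + b" arbitrary: a b)
    case 0
    then show ?case
      using coeffs_over_intros(5)[OF E(1), of 1] fps_over_1[OF E(1)] by (simp add: r l h)
  next
    case (Suc n)
    show ?case
    proof (cases "a = 0 \<or> b = 0")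
      case True
      then show ?thesis
        using coeffs_over_intros(5)[OF E(1), of "s ^ a"] coeffs_over_intros(6)[OF E(1), of "q ^ b"]
          fps_over_power[OF E(1) xs] fps_over_power[OF E(1) xq] by (auto simp: r l hp)
    next
      case False
      then obtain a' b' where ab: "a = Suc a'" "b = Suc b'" by (meson not0_implies_Suc)
      have n: "n = a' + b" "n = a + b'" using Suc(2) ab by auto
      have 1: "right P * right (s ^ a) = right (s ^ a')"
      proof -
        have "P * s ^ a = (P * s) * s ^ a'" by (simp only: ab power_Suc mult.assoc)
        then show ?thesis by (simp only: r(4)[symmetric] P(4) mult_1_left)
      qed
      have 2: "left Q * left (q ^ b) = left (q ^ b')"
      proof -
        have "Q * q ^ b = (Q * q) * q ^ b'" by (simp only: ab power_Suc mult.assoc)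
        then show ?thesis by (simp only: l(4)[symmetric] Q(4) mult_1_left)
      qed
      have "map_coeffs fls_const (fps_X ^ e) = right U * right P + right V * (xpow (int m) * left Q)"
        using arg_cong[OF UV(1), of right] by (simp only: r T' right_pconst)
      then have "map_coeffs fls_const (fps_X ^ e) * (right (s ^ a) * left (q ^ b)) =
          right U * ((right P * right (s ^ a)) * left (q ^ b))
          + right V * (xpow (int m) * (right (s ^ a) * (left Q * left (q ^ b))))"
        by (simp only: distrib_right distrib_left mult_ac)
      also have "\<dots> = right U * (right (s ^ a') * left (q ^ b)) + right V * (xpow (int m) * (right (s ^ a) * left (q ^ b')))"
        by (simp only: 1 2)
      also have "coeffs_over E \<dots>"
        using Suc(1)[OF n(1)] Suc(1)[OF n(2)]
        by (intro coeffs_over_intros(2)[OF E(1)] coeffs_over_right_mult[OF E(1) UV(2,4)]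
            coeffs_over_right_mult[OF E(1) UV(3,5)] coeffs_over_intros(3)[OF E(1)])
      finally have *: "coeffs_over E (map_coeffs fls_const (fps_X ^ e) * (right (s ^ a) * left (q ^ b)))" .
      show ?thesis
        unfolding coeffs_over_def
      proof
        fix i
        let ?c = "xcoef i (right (s ^ a) * left (q ^ b))"
        have "t_var ^ e * ?c \<in> E"
          using * by (simp add: coeffs_over_def xcoef_const_mult fps_to_fls_power t_var_def)
        then have "inverse (t_var ^ e) * (t_var ^ e * ?c) \<in> E"
          by (rule is_subfieldD(7)[OF E(1) is_subfieldD(4)[OF E(1) is_subfield_power[OF E]]])
        moreover have "inverse (t_var ^ e) * (t_var ^ e * ?c) = ?c"
          by (simp add: t_var_def flip: mult.assoc)
        ultimately show "?c \<in> E" by simp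
      qed
    qed
  qed
qed

text \<open>Without steps toward the axis the first-row identity reads
  \<open>S_0 (1 - t A_0) = 1 - H\<close>. Hence \<open>1 - t A_0\<close> is the product of
  \<open>P = 1/S_0\<close> and \<open>1 - H\<close>, whose degrees are bounded by those of
  \<open>1 - t A_0\<close>.\<close>

lemma degenerate_slit_series_coeffs_over:
  assumes fin: "finite S" and small: "\<forall>(i, j)\<in>S. \<bar>j\<bar> \<le> 1"
    and F: "(D0, Dp, Dm) = canonical_factorization (Delta S)"
    and E: "is_subfield E" "{t_var} \<union> point_generators S k D0 Dp Dm \<subseteq> E"
    and k: "k \<in> {1, - 1}" and empty: "\<And>i. (i, k) \<notin> S"
  shows "coeffs_over E (slit_series S (- k * int j))"
proof -
  note r = is_ring_homD[OF is_ring_hom_right] and l = is_ring_homD[OF is_ring_hom_left]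
    and h = is_ring_homD[OF is_ring_hom_xser]
  let ?G = "\<lambda>j. slit_series S (- k * int j) :: complex fls fps"
  have gens: "t_var \<in> E" "x_coeffs Dp \<subseteq> E" "x_coeffs Dm \<subseteq> E"
    "fps_to_fls (map_coeffs complex_of_real (fps_sqrt D0)) \<in> E"
    using E(2) by (auto simp: point_generators_def)
  have A0: "A S k (fls_X :: complex fls) = 0" by (simp add: A_def empty)
  define s hp where "s = (axis_poly S :: complex poly fps)" and "hp = (hit_poly S :: complex poly fps)"
  have s0: "s $ 0 = 1" and h0: "hp $ 0 = 1" unfolding s_def hp_def
    by (rule axis_poly_0[OF fin small] hit_poly_0[OF fin small])+
  obtain P where P: "s * P = 1" "P $ 0 = 1" using fps_unit_inverse_exists[OF s0] .
  obtain q where q: "hp * q = 1" using fps_unit_inverse_exists[OF h0] .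
  let ?K = "1 - fps_X * Ac S 0 :: complex fls fps"
  have sK: "right s * ?K = left hp"
    using slit_series_first_row_hit[OF fin small k, where 'a=complex]
    by (simp add: A0 slit_series_0[OF fin small] s_def hp_def)
  have "right P * (right s * ?K) = right (s * P) * ?K" by (simp only: r mult_ac)
  then have K: "?K = right P * left hp" by (simp add: sK P r)
  obtain M where M: "M \<ge> 0" "\<And>i k. (i, k) \<in> S \<Longrightarrow> \<bar>i\<bar> \<le> M" using step_bound[OF fin] by metis
  have ul: "upper M ?K" "lower M ?K" by (rule upper_kernel[OF M(1)], erule M(2))+
  have bP: "bounded_degree (nat M) P"
    by (rule right_left_factor_bounded_degree(1)[OF K P(2) h0 ul M(1)])
  have "lower (0 + M) (right s * ?K)" by (rule lower_mult[OF lower_right ul(2)])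
  then have lh: "lower (int (nat M)) (left hp)" using M(1) by (simp add: sK)
  have xs: "fps_over E (xser s)" unfolding s_def by (rule axis_poly_over[OF fin small F E(1) gens(2)])
  have xs0: "xser s $ 0 = 1"
    by (simp add: s_def xser_nth coeff_axis_poly_0[OF fin small] fps_one_def[symmetric])
  have "xser s * xser P = 1" using arg_cong[OF P(1), of xser] by (simp only: h)
  then have xP: "fps_over E (xser P)"
    using fps_over_cancel[OF E(1), of "xser s" "xser P"] xs xs0 fps_over_1[OF E(1)] by simp
  have main: "coeffs_over E (right (s ^ a) * left (q ^ b))" for a b
    by (rule degenerate_right_left_coeffs_over[OF E(1) gens(1) bP P(2) xP _ lh h0 _ q _ xs0])
       (use P(1) hit_poly_over[OF fin small F E(1) gens(3,4)] in \<open>simp_all add: mult.commute hp_def\<close>)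
  have inv: "right s * left q * ?K = 1"
  proof -
    have "right s * left q * ?K = right (s * P) * left (hp * q)" unfolding K by (simp only: r l mult_ac)
    then show ?thesis by (simp add: P q r l)
  qed
  have step: "?G (Suc n) = right s * left q * (fps_X * (Ac S (- k) * ?G n))" for n
  proof -
    have alg: "g' = w * (t * x)" if "g' = t * (x + a * g' + z)" "z = 0" "w * (1 - t * a) = 1"
      for g' w t x a z :: "complex fls fps"
    proof -
      have "(1 - t * a) * g' = t * x" using that(1,2) by (simp add: algebra_simps)
      then have "w * ((1 - t * a) * g') = w * (t * x)" by simp
      then show ?thesis using that(3) by (simp only: mult.assoc[symmetric] mult_1_left)
    qed
    show ?thesis
      by (rule alg[OF slit_series_rec_row[OF fin small k] _ inv]) (simp add: A0)
  qed
  \<comment> \<open>Each row contributes \<open>t A_-k / (1 - t A_0) = t A_-k S_0 / (1 - H)\<close>,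
    and row 0 supplies one more \<open>S_0\<close>, hence the exponents \<open>Suc n\<close> and
    \<open>n\<close>.\<close>
  have "?G n = fps_X ^ n * (Ac S (- k) ^ n * (right (s ^ Suc n) * left (q ^ n)))" for n
  proof (induction n)
    case 0
    then show ?case by (simp add: slit_series_0[OF fin small] s_def l)
  next
    case (Suc n)
    have alg: "s' * q' * (t * (x * (t ^ n * (x ^ n * (S' * Q'))))) = t ^ Suc n * (x ^ Suc n * (s' * S' * (q' * Q')))"
      for s' q' t x S' Q' :: "complex fls fps" by (simp add: mult_ac)
    show ?case
      unfolding step Suc by (subst alg) (simp only: r(4)[symmetric] l(4)[symmetric] power_Suc[symmetric])
  qed
  moreover have "coeffs_over E (Ac S (- k) ^ n * F)" if "coeffs_over E F" for n F
    by (induction n) (use that in \<open>auto simp: mult.assoc intro: coeffs_over_Ac[OF E(1)] simp del: fps_const_power\<close>)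
  moreover have "coeffs_over E (fps_X ^ n * F)" if "coeffs_over E F" for n F
  proof -
    have "map_coeffs fls_const (fps_X ^ n) = (fps_X ^ n :: complex fls fps)"
      by (auto simp: fps_eq_iff fps_X_power_nth)
    then show ?thesis
      using coeffs_over_intros(4)[OF E(1) _ that, of "fps_X ^ n"] is_subfield_power[OF E(1) gens(1)]
      by (simp add: fps_to_fls_power t_var_def)
  qed
  ultimately show ?thesis using main by metis
qed

lemma slit_gf_point_in_generated_field:
  assumes fin: "finite S" and small: "\<forall>(i, j)\<in>S. \<bar>j\<bar> \<le> 1"
    and F: "(D0, Dp, Dm) = canonical_factorization (Delta S)" and k: "k \<in> {1, - 1}"
  shows "slit_gf_point S i (- k * int j) \<in> generated_field ({t_var} \<union> point_generators S k D0 Dp Dm)"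
proof -
  let ?E = "generated_field ({t_var} \<union> point_generators S k D0 Dp Dm)"
  have E: "is_subfield ?E" by (rule is_subfield_generated_field)
  have sub: "{t_var} \<union> point_generators S k D0 Dp Dm \<subseteq> ?E" by (auto intro: generated_field.incl)
  have "xcoef i (slit_series S (- k * int j)) \<in> ?E"
  proof (cases "\<exists>i0. (i0, k) \<in> S")
    case True
    then show ?thesis
      using splits_over_xcoef[OF E slit_series_splits_over[OF fin small F E sub k]] by blast
  next
    case False
    then show ?thesis
      using degenerate_slit_series_coeffs_over[OF fin small F E sub k] by (simp add: coeffs_over_def)
  qed
  then show ?thesis by (simp only: slit_gf_point_eq[OF fin small])
qed

theorem theorem7p2:
  fixes S :: "(int \<times> int) set"
    and D0 :: "real fps" and Dp Dm :: "real poly fps"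
  assumes "finite S"
    and "\<forall>(i, j)\<in>S. \<bar>j\<bar> \<le> 1"
    and "(D0, Dp, Dm) = canonical_factorization (Delta S)"
  shows "(\<forall>j::int. algebraic_over (generated_field {x_var, t_var}) (fps_to_fls (slit_gf S j)))
    \<and> (\<forall>j::nat. fps_to_fls (slit_gf S (int j)) =
          1 / fps_to_fls (fps_sqrt (subst_var fls_const fls_X Dp)) * Z_quot S (-1) ^ j)
    \<and> (\<forall>j::nat. fps_to_fls (slit_gf S (- int j)) =
          1 / fps_to_fls (fps_sqrt (subst_var fls_const fls_X Dp)) * Z_quot S 1 ^ j)
    \<and> (\<forall>i j. algebraic_over (generated_field {t_var}) (slit_gf_point S i j))
    \<and> (\<forall>i. slit_gf_point S i 0 \<in> generated_field ({t_var} \<union> x_coeffs Dp))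
    \<and> (\<forall>i j. j > 0 \<longrightarrow>
          slit_gf_point S i j \<in> generated_field ({t_var} \<union> point_generators S (-1) D0 Dp Dm))
    \<and> (\<forall>i j. j < 0 \<longrightarrow>
          slit_gf_point S i j \<in> generated_field ({t_var} \<union> point_generators S 1 D0 Dp Dm))"
proof (intro conjI allI impI)
  note closed = slit_gf_closed_form[OF assms] and point = slit_gf_point_in_generated_field[OF assms]
  show "algebraic_over (generated_field {x_var, t_var}) (fps_to_fls (slit_gf S j))" for j
    by (rule algebraic_slit_gf[OF assms])
  show "fps_to_fls (slit_gf S (int j)) =
      1 / fps_to_fls (fps_sqrt (subst_var fls_const fls_X Dp)) * Z_quot S (-1) ^ j" for j
    using closed[of "-1" j] by simp
  show "fps_to_fls (slit_gf S (- int j)) =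
      1 / fps_to_fls (fps_sqrt (subst_var fls_const fls_X Dp)) * Z_quot S 1 ^ j" for j
    using closed[of 1 j] by simp
  show pos: "slit_gf_point S i j \<in> generated_field ({t_var} \<union> point_generators S (-1) D0 Dp Dm)"
    if "j > 0" for i j
    using point[of "-1" i "nat j"] that by simp
  show neg: "slit_gf_point S i j \<in> generated_field ({t_var} \<union> point_generators S 1 D0 Dp Dm)"
    if "j < 0" for i j
    using point[of 1 i "nat (- j)"] that by simp
  show "algebraic_over (generated_field {t_var}) (slit_gf_point S i j)" for i j
  proof -
    \<comment> \<open>Every ordinate, 0 included, has this form, so algebraicity follows from
      membership in a field with algebraic generators.\<close>
    obtain k n where k: "k \<in> {1, - 1}" "j = - k * int n"
    proof (cases "j \<ge> 0")
      case True then show ?thesis using that[of "-1" "nat j"] by simp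
    next
      case False then show ?thesis using that[of 1 "nat (- j)"] by simp
    qed
    show ?thesis
      unfolding k(2)
      by (rule generated_field_algebraic_over[OF is_subfield_generated_field
            point_generators_algebraic[OF assms] point[OF k(1)]])
  qed
  show "slit_gf_point S i 0 \<in> generated_field ({t_var} \<union> x_coeffs Dp)" for i
  proof -
    let ?E = "generated_field ({t_var} \<union> x_coeffs Dp)"
    have E: "is_subfield ?E" by (rule is_subfield_generated_field)
    have "x_coeffs Dp \<subseteq> ?E" by (auto intro: generated_field.incl)
    from axis_poly_over[OF assms E this] is_subfieldD(2)[OF E] show ?thesis
      by (simp add: slit_gf_point_eq[OF assms(1,2)] slit_series_0[OF assms(1,2)] xcoef_right fps_over_def)
  qed
qed

end
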